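(* Let $k$ be an algebraically closed field, let $A$ be a finitely generated associative $k$-algebra, and let $n\ge 1$. Suppose $A$ is coherent, and let $M\cong k^n$ be a left $A$-module of dimension $n$ over $k$ with $\mathrm{Ext}^2_A(M,M)=0$. Then the $k$-point of $\mathrm{Rep}_A^n$ corresponding to $M$ is a smooth point of the $k$-scheme $\mathrm{Rep}_A^n$.
   Context: "$A$-module" means left $A$-module. An $A$-bimodule is the same as a left module over $A^e=A\otimes_k A^{\mathrm{op}}$; a finite rank free $A$-bimodule is a free $A^e$-module of finite rank. The algebra $A$ is called coherent if the kernel of any morphism between finite rank free $A$-bimodules is a finitely generated $A$-bimodule. $\mathrm{Rep}_A^n$ is the affine $k$-scheme of finite type representing the functor from commutative $k$-algebras to sets $B\mapsto \mathrm{Hom}_{k\text{-alg}}(A,M_n(B))$, where $M_n(B)$ is the ring of $n\times n$ matrices over $B$. A $k$-point $\mu:A\to M_n(k)$ is the same thing as an $A$-module structure on $k^n$; the $k$-point corresponding to $M\cong k^n$ is the one given by the $A$-module structure on $k^n$. *)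

theory Defs
  imports
    "HOL-Analysis.Cartesian_Space"
    "HOL-Library.Poly_Mapping"
    "HOL-Computational_Algebra.Polynomial"
    "HOL-Algebra.Algebra"
begin

section \<open>Associative algebras and left modules\<close>

definition univ_ring :: "'b::ring_1 ring" where
  "univ_ring = \<lparr>carrier = UNIV, mult = (*), one = 1, ring.zero = 0, add = (+)\<rparr>"

text \<open>
  An associative unital algebra over the field \<open>'k\<close> is a ring \<open>A\<close> with a unital ring
  homomorphism \<open>\<iota>\<close> from \<open>'k\<close> to the centre of \<open>A\<close>; the scalar \<open>c\<close> acts as multiplication by \<open>\<iota> c\<close>.
\<close>

definition assoc_algebra :: "('k::field \<Rightarrow> 'a) \<Rightarrow> 'a ring \<Rightarrow> bool" where
  "assoc_algebra \<iota> A \<longleftrightarrow> ring A \<and> \<iota> \<in> ring_hom univ_ring A \<and>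
     (\<forall>c. \<forall>a\<in>carrier A. \<iota> c \<otimes>\<^bsub>A\<^esub> a = a \<otimes>\<^bsub>A\<^esub> \<iota> c)"

definition finitely_generated_algebra :: "('k::field \<Rightarrow> 'a) \<Rightarrow> 'a ring \<Rightarrow> bool" where
  "finitely_generated_algebra \<iota> A \<longleftrightarrow>
     (\<exists>S. finite S \<and> S \<subseteq> carrier A \<and> generate_ring A (range \<iota> \<union> S) = carrier A)"

text \<open>The locale \<^locale>\<open>module\<close> of the library requires a commutative ring of scalars.\<close>

locale left_module = R?: ring R + M?: abelian_group M
  for R :: "('r, 's) ring_scheme" (structure) and M :: "('r, 'm, 'z) module_scheme" (structure) +
  assumes smult_closed [simp, intro]:
      "\<lbrakk>a \<in> carrier R; x \<in> carrier M\<rbrakk> \<Longrightarrow> a \<odot>\<^bsub>M\<^esub> x \<in> carrier M"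
    and smult_l_distr:
      "\<lbrakk>a \<in> carrier R; b \<in> carrier R; x \<in> carrier M\<rbrakk> \<Longrightarrow>
       (a \<oplus>\<^bsub>R\<^esub> b) \<odot>\<^bsub>M\<^esub> x = a \<odot>\<^bsub>M\<^esub> x \<oplus>\<^bsub>M\<^esub> b \<odot>\<^bsub>M\<^esub> x"
    and smult_r_distr:
      "\<lbrakk>a \<in> carrier R; x \<in> carrier M; y \<in> carrier M\<rbrakk> \<Longrightarrow>
       a \<odot>\<^bsub>M\<^esub> (x \<oplus>\<^bsub>M\<^esub> y) = a \<odot>\<^bsub>M\<^esub> x \<oplus>\<^bsub>M\<^esub> a \<odot>\<^bsub>M\<^esub> y"
    and smult_assoc:
      "\<lbrakk>a \<in> carrier R; b \<in> carrier R; x \<in> carrier M\<rbrakk> \<Longrightarrow>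
       (a \<otimes>\<^bsub>R\<^esub> b) \<odot>\<^bsub>M\<^esub> x = a \<odot>\<^bsub>M\<^esub> (b \<odot>\<^bsub>M\<^esub> x)"
    and smult_one [simp]: "x \<in> carrier M \<Longrightarrow> \<one>\<^bsub>R\<^esub> \<odot>\<^bsub>M\<^esub> x = x"

definition lin_maps ::
  "('r, 's) ring_scheme \<Rightarrow> ('r, 'm, 'y) module_scheme \<Rightarrow> ('r, 'n, 'z) module_scheme \<Rightarrow> ('m \<Rightarrow> 'n) set"
  where
  "lin_maps R M N = {\<phi> \<in> carrier M \<rightarrow>\<^sub>E carrier N.
     (\<forall>x\<in>carrier M. \<forall>y\<in>carrier M. \<phi> (x \<oplus>\<^bsub>M\<^esub> y) = \<phi> x \<oplus>\<^bsub>N\<^esub> \<phi> y) \<and>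
     (\<forall>a\<in>carrier R. \<forall>x\<in>carrier M. \<phi> (a \<odot>\<^bsub>M\<^esub> x) = a \<odot>\<^bsub>N\<^esub> \<phi> x)}"

definition hom_group ::
  "('r, 's) ring_scheme \<Rightarrow> ('r, 'm, 'y) module_scheme \<Rightarrow> ('r, 'n, 'z) module_scheme \<Rightarrow> ('m \<Rightarrow> 'n) monoid"
  where
  "hom_group R M N = \<lparr>carrier = lin_maps R M N,
     mult = (\<lambda>\<phi> \<psi>. \<lambda>x\<in>carrier M. \<phi> x \<oplus>\<^bsub>N\<^esub> \<psi> x),
     one = (\<lambda>x\<in>carrier M. \<zero>\<^bsub>N\<^esub>)\<rparr>"

definition finitely_generated_submodule ::
  "('r, 's) ring_scheme \<Rightarrow> ('r, 'm, 'z) module_scheme \<Rightarrow> 'm set \<Rightarrow> bool" where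
  "finitely_generated_submodule R M K \<longleftrightarrow> submodule K R M \<and>
     (\<exists>S. finite S \<and> K = \<Inter>{N. submodule N R M \<and> S \<subseteq> N})"

text \<open>
  The free left module on the set \<open>B\<close>: finitely supported \<open>R\<close>-valued functions vanishing off \<open>B\<close>.
  The multiplicative fields of the module record are irrelevant.
\<close>

definition free_module :: "('r, 's) ring_scheme \<Rightarrow> 'x set \<Rightarrow> ('r, 'x \<Rightarrow> 'r) module" where
  "free_module R B =
    \<lparr>carrier = {f. range f \<subseteq> carrier R \<and> finite {x. f x \<noteq> \<zero>\<^bsub>R\<^esub>} \<and> {x. f x \<noteq> \<zero>\<^bsub>R\<^esub>} \<subseteq> B},
     mult = undefined, one = undefined,
     ring.zero = (\<lambda>_. \<zero>\<^bsub>R\<^esub>), add = (\<lambda>f g x. f x \<oplus>\<^bsub>R\<^esub> g x),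
     smult = (\<lambda>a f x. a \<otimes>\<^bsub>R\<^esub> f x)\<rparr>"

section \<open>The enveloping algebra and coherence\<close>

definition op_ring :: "'a ring \<Rightarrow> 'a ring" where
  "op_ring A = A\<lparr>mult := \<lambda>x y. y \<otimes>\<^bsub>A\<^esub> x\<rparr>"

text \<open>The monoid ring with integer coefficients of the multiplicative monoid of \<open>A \<times> B\<close>.\<close>

definition pair_ring :: "'a ring \<Rightarrow> 'b ring \<Rightarrow> ('a \<times> 'b \<Rightarrow>\<^sub>0 int) ring" where
  "pair_ring A B =
    \<lparr>carrier = {z. Poly_Mapping.keys z \<subseteq> carrier A \<times> carrier B},
     mult = (\<lambda>y z. frag_extend (\<lambda>(a, b). frag_extend (\<lambda>(a', b').
               frag_of (a \<otimes>\<^bsub>A\<^esub> a', b \<otimes>\<^bsub>B\<^esub> b')) z) y),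
     one = frag_of (\<one>\<^bsub>A\<^esub>, \<one>\<^bsub>B\<^esub>), ring.zero = 0, add = (+)\<rparr>"

definition tensor_relations ::
  "('k::field \<Rightarrow> 'a) \<Rightarrow> 'a ring \<Rightarrow> ('k \<Rightarrow> 'b) \<Rightarrow> 'b ring \<Rightarrow> ('a \<times> 'b \<Rightarrow>\<^sub>0 int) set" where
  "tensor_relations \<iota> A \<kappa> B =
     {frag_of (a \<oplus>\<^bsub>A\<^esub> a', b) - frag_of (a, b) - frag_of (a', b) |a a' b.
        a \<in> carrier A \<and> a' \<in> carrier A \<and> b \<in> carrier B} \<union>
     {frag_of (a, b \<oplus>\<^bsub>B\<^esub> b') - frag_of (a, b) - frag_of (a, b') |a b b'.
        a \<in> carrier A \<and> b \<in> carrier B \<and> b' \<in> carrier B} \<union>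
     {frag_of (\<iota> c \<otimes>\<^bsub>A\<^esub> a, b) - frag_of (a, \<kappa> c \<otimes>\<^bsub>B\<^esub> b) |c a b.
        a \<in> carrier A \<and> b \<in> carrier B}"

text \<open>
  The tensor product over \<open>'k\<close> of two algebras: formal integer combinations of pairs modulo the
  bilinearity relations. The subgroup generated by the relations is already an ideal.
\<close>

definition tensor_algebra ::
  "('k::field \<Rightarrow> 'a) \<Rightarrow> 'a ring \<Rightarrow> ('k \<Rightarrow> 'b) \<Rightarrow> 'b ring \<Rightarrow> ('a \<times> 'b \<Rightarrow>\<^sub>0 int) set ring" where
  "tensor_algebra \<iota> A \<kappa> B =
     pair_ring A B Quot (Idl\<^bsub>pair_ring A B\<^esub> (tensor_relations \<iota> A \<kappa> B))"

definition enveloping_algebra :: "('k::field \<Rightarrow> 'a) \<Rightarrow> 'a ring \<Rightarrow> ('a \<times> 'a \<Rightarrow>\<^sub>0 int) set ring" where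
  "enveloping_algebra \<iota> A = tensor_algebra \<iota> A \<iota> (op_ring A)"

text \<open>
  Bimodules over \<open>A\<close> are left modules over the enveloping algebra.
\<close>

definition coherent_algebra :: "('k::field \<Rightarrow> 'a) \<Rightarrow> 'a ring \<Rightarrow> bool" where
  "coherent_algebra \<iota> A \<longleftrightarrow>
     (let E = enveloping_algebra \<iota> A in
      \<forall>(p::nat) (q::nat). \<forall>\<phi> \<in> lin_maps E (free_module E {..<p}) (free_module E {..<q}).
        finitely_generated_submodule E (free_module E {..<p})
          (a_kernel (free_module E {..<p}) (free_module E {..<q}) \<phi>))"

section \<open>The second Ext group\<close>

text \<open>The linear map from the free module on a subset \<open>B\<close> of \<open>M\<close> extending the inclusion of \<open>B\<close>.\<close>

definition free_cover ::
  "('r, 's) ring_scheme \<Rightarrow> ('r, 'm, 'z) module_scheme \<Rightarrow> 'm set \<Rightarrow> ('m \<Rightarrow> 'r) \<Rightarrow> 'm" where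
  "free_cover R M B = (\<lambda>f\<in>carrier (free_module R B).
     finsum M (\<lambda>x. f x \<odot>\<^bsub>M\<^esub> x) {x. f x \<noteq> \<zero>\<^bsub>R\<^esub>})"

text \<open>
  Ext is computed from the standard free resolution
  \<open>F3 \<rightarrow> F2 \<rightarrow> F1 \<rightarrow> F0 \<rightarrow> M \<rightarrow> 0\<close>, in which \<open>F0\<close> is free on the set \<open>M\<close> and each further term is free
  on the underlying set of the preceding kernel: it is the second cohomology group of the complex
  \<open>Hom(F0, N) \<rightarrow> Hom(F1, N) \<rightarrow> Hom(F2, N) \<rightarrow> Hom(F3, N)\<close>.
\<close>

definition Ext2 ::
  "('r, 's) ring_scheme \<Rightarrow> ('r, 'm, 'y) module_scheme \<Rightarrow> ('r, 'n, 'z) module_scheme \<Rightarrow>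
   (((('m \<Rightarrow> 'r) \<Rightarrow> 'r) \<Rightarrow> 'r) \<Rightarrow> 'n) set monoid" where
  "Ext2 R M N =
    (let F0 = free_module R (carrier M); d0 = free_cover R M (carrier M);
         K0 = a_kernel F0 M d0;
         F1 = free_module R K0; d1 = free_cover R F0 K0;
         K1 = a_kernel F1 F0 d1;
         F2 = free_module R K1; d2 = free_cover R F1 K1;
         K2 = a_kernel F2 F1 d2;
         F3 = free_module R K2; d3 = free_cover R F2 K2;
         Z = kernel (hom_group R F2 N) (hom_group R F3 N) (\<lambda>\<phi>. compose (carrier F3) \<phi> d3);
         B = (\<lambda>\<psi>. compose (carrier F2) \<psi> d2) ` carrier (hom_group R F1 N)
     in (hom_group R F2 N)\<lparr>carrier := Z\<rparr> Mod B)"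

section \<open>Polynomials in several variables\<close>

type_synonym ('v, 'k) mpoly = "('v \<Rightarrow>\<^sub>0 nat) \<Rightarrow>\<^sub>0 'k"

definition mvar :: "'v \<Rightarrow> ('v, 'k::comm_ring_1) mpoly" where
  "mvar v = Poly_Mapping.single (Poly_Mapping.single v 1) 1"

definition mconst :: "'k \<Rightarrow> ('v, 'k::comm_ring_1) mpoly" where
  "mconst c = Poly_Mapping.single 0 c"

definition mpoly_ring :: "'v set \<Rightarrow> ('v, 'k::comm_ring_1) mpoly ring" where
  "mpoly_ring V =
    \<lparr>carrier = {p. \<forall>m\<in>Poly_Mapping.keys p. Poly_Mapping.keys m \<subseteq> V},
     mult = (*), one = 1, ring.zero = 0, add = (+)\<rparr>"

definition mon_eval :: "('v \<Rightarrow> 'b) \<Rightarrow> ('v \<Rightarrow>\<^sub>0 nat) \<Rightarrow> 'b::comm_ring_1" where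
  "mon_eval t m = (\<Prod>v\<in>Poly_Mapping.keys m. t v ^ Poly_Mapping.lookup m v)"

definition mpoly_eval :: "('k \<Rightarrow> 'b) \<Rightarrow> ('v \<Rightarrow> 'b) \<Rightarrow> ('v, 'k::comm_ring_1) mpoly \<Rightarrow> 'b::comm_ring_1"
  where
  "mpoly_eval \<beta> t p =
     (\<Sum>m\<in>Poly_Mapping.keys p. \<beta> (Poly_Mapping.lookup p m) * mon_eval t m)"

definition mpoly_deriv :: "'v \<Rightarrow> ('v, 'k::comm_ring_1) mpoly \<Rightarrow> ('v, 'k) mpoly" where
  "mpoly_deriv v p = (\<Sum>m\<in>Poly_Mapping.keys p.
     Poly_Mapping.single (m - Poly_Mapping.single v 1)
       (of_nat (Poly_Mapping.lookup m v) * Poly_Mapping.lookup p m))"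

section \<open>Smooth points of affine schemes\<close>

text \<open>\<open>l : R \<rightarrow> S\<close> exhibits \<open>S\<close> as the localization of \<open>R\<close> at the powers of \<open>h\<close>.\<close>

definition localization_away ::
  "('r, 'x) ring_scheme \<Rightarrow> 'r \<Rightarrow> ('s, 'y) ring_scheme \<Rightarrow> ('r \<Rightarrow> 's) \<Rightarrow> bool" where
  "localization_away R h S l \<longleftrightarrow> l \<in> ring_hom R S \<and> l h \<in> Units S \<and>
     (\<forall>s\<in>carrier S. \<exists>r\<in>carrier R. \<exists>m::nat. s \<otimes>\<^bsub>S\<^esub> (l h [^]\<^bsub>S\<^esub> m) = l r) \<and>
     (\<forall>r\<in>carrier R. l r = \<zero>\<^bsub>S\<^esub> \<longrightarrow> (\<exists>m::nat. h [^]\<^bsub>R\<^esub> m \<otimes>\<^bsub>R\<^esub> r = \<zero>\<^bsub>R\<^esub>))"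

text \<open>
  Let \<open>R\<close> be a commutative \<open>'k\<close>-algebra with structure map \<open>\<kappa>\<close>, and let \<open>x : R \<rightarrow> 'k\<close> be a \<open>'k\<close>-point
  of \<open>Spec R\<close>. The scheme is smooth at \<open>x\<close> iff some open neighbourhood \<open>D(h)\<close> of \<open>x\<close> is isomorphic
  over \<open>'k\<close> to \<open>Spec 'k[T\<^sub>1, \<dots>, T\<^sub>N]/(f\<^sub>1, \<dots>, f\<^sub>c)\<close> in such a way that the Jacobian matrix of
  \<open>f\<^sub>1, \<dots>, f\<^sub>c\<close> has rank \<open>c\<close> (that is, linearly independent rows) at the point \<open>t\<close> corresponding
  to \<open>x\<close>. Basic open sets suffice: a basic open subset \<open>D(g)\<close> of the right-hand side is of the same
  form, by the additional variable \<open>y\<close> and the additional equation \<open>g y - 1\<close>.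
\<close>

definition smooth_point :: "('k::field \<Rightarrow> 'r) \<Rightarrow> ('r, 'x) ring_scheme \<Rightarrow> ('r \<Rightarrow> 'k) \<Rightarrow> bool" where
  "smooth_point \<kappa> R x \<longleftrightarrow>
    (\<exists>h\<in>carrier R. x h \<noteq> 0 \<and>
      (\<exists>(N::nat) (c::nat) (f :: nat \<Rightarrow> (nat, 'k) mpoly) (t :: nat \<Rightarrow> 'k) l.
        let P = mpoly_ring {..<N}; J = Idl\<^bsub>P\<^esub> (f ` {..<c}) in
        (\<forall>i<c. f i \<in> carrier P) \<and>
        localization_away R h (P Quot J) l \<and>
        (\<forall>a. l (\<kappa> a) = J +>\<^bsub>P\<^esub> mconst a) \<and>
        (\<forall>i<c. mpoly_eval id t (f i) = 0) \<and>
        (\<forall>r\<in>carrier R. \<forall>p\<in>l r. x r = mpoly_eval id t p) \<and>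
        (\<forall>w :: nat \<Rightarrow> 'k.
           (\<forall>j<N. (\<Sum>i<c. w i * mpoly_eval id t (mpoly_deriv j (f i))) = 0) \<longrightarrow> (\<forall>i<c. w i = 0))))"

section \<open>The representation scheme\<close>

text \<open>
  The coordinate ring of the scheme of \<open>n\<close>-dimensional representations, \<open>n = CARD('n)\<close>, is generated
  by the entries \<open>x\<^bsub>a,i,j\<^esub>\<close> of a generic matrix for each \<open>a\<close> in \<open>A\<close>, subject to the relations saying
  that \<open>a \<mapsto> (x\<^bsub>a,i,j\<^esub>)\<close> is a homomorphism of \<open>'k\<close>-algebras.
\<close>

definition rep_poly_ring :: "'a ring \<Rightarrow> ('a \<times> 'n \<times> 'n, 'k::field) mpoly ring" where
  "rep_poly_ring A = mpoly_ring (carrier A \<times> UNIV)"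

definition rep_relations :: "('k::field \<Rightarrow> 'a) \<Rightarrow> 'a ring \<Rightarrow> ('a \<times> 'n::finite \<times> 'n, 'k) mpoly set" where
  "rep_relations \<iota> A =
     {mvar (a \<oplus>\<^bsub>A\<^esub> b, i, j) - mvar (a, i, j) - mvar (b, i, j) |a b i j.
        a \<in> carrier A \<and> b \<in> carrier A} \<union>
     {mvar (a \<otimes>\<^bsub>A\<^esub> b, i, j) - (\<Sum>l\<in>UNIV. mvar (a, i, l) * mvar (b, l, j)) |a b i j.
        a \<in> carrier A \<and> b \<in> carrier A} \<union>
     {mvar (\<iota> c, i, j) - (if i = j then mconst c else 0) |c i j. True}"

definition rep_ideal :: "('k::field \<Rightarrow> 'a) \<Rightarrow> 'a ring \<Rightarrow> ('a \<times> 'n::finite \<times> 'n, 'k) mpoly set" where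
  "rep_ideal \<iota> A = Idl\<^bsub>rep_poly_ring A\<^esub> (rep_relations \<iota> A)"

definition rep_ring :: "('k::field \<Rightarrow> 'a) \<Rightarrow> 'a ring \<Rightarrow> ('a \<times> 'n::finite \<times> 'n, 'k) mpoly set ring" where
  "rep_ring \<iota> A = rep_poly_ring A Quot rep_ideal \<iota> A"

definition rep_scalar :: "('k::field \<Rightarrow> 'a) \<Rightarrow> 'a ring \<Rightarrow> 'k \<Rightarrow> ('a \<times> 'n::finite \<times> 'n, 'k) mpoly set"
  where
  "rep_scalar \<iota> A c = rep_ideal \<iota> A +>\<^bsub>rep_poly_ring A\<^esub> mconst c"

definition rep_coord ::
  "('k::field \<Rightarrow> 'a) \<Rightarrow> 'a ring \<Rightarrow> 'a \<Rightarrow> 'n \<Rightarrow> 'n \<Rightarrow> ('a \<times> 'n::finite \<times> 'n, 'k) mpoly set" where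
  "rep_coord \<iota> A a i j = rep_ideal \<iota> A +>\<^bsub>rep_poly_ring A\<^esub> mvar (a, i, j)"

text \<open>
  The functor of points: for a commutative \<open>'k\<close>-algebra \<open>'b\<close> with structure map \<open>\<beta>\<close>, the algebra
  homomorphisms from \<open>A\<close> to the matrices over \<open>'b\<close>.
\<close>

definition rep_functor ::
  "('k::field \<Rightarrow> 'a) \<Rightarrow> 'a ring \<Rightarrow> ('k \<Rightarrow> 'b::comm_ring_1) \<Rightarrow> ('a \<Rightarrow> 'b^'n^'n) set" where
  "rep_functor \<iota> A \<beta> = {\<rho> \<in> extensional (carrier A).
     (\<forall>a\<in>carrier A. \<forall>b\<in>carrier A. \<rho> (a \<oplus>\<^bsub>A\<^esub> b) = \<rho> a + \<rho> b \<and> \<rho> (a \<otimes>\<^bsub>A\<^esub> b) = \<rho> a ** \<rho> b) \<and>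
     (\<forall>c. \<rho> (\<iota> c) = mat (\<beta> c))}"

text \<open>The \<open>'k\<close>-point of the representation scheme given by \<open>\<rho> : A \<rightarrow> M\<^sub>n('k)\<close>.\<close>

definition point_of_rep ::
  "('a \<Rightarrow> 'k::field^'n^'n) \<Rightarrow> ('a \<times> 'n::finite \<times> 'n, 'k) mpoly set \<Rightarrow> 'k" where
  "point_of_rep \<rho> C = the_elem (mpoly_eval id (\<lambda>(a, i, j). \<rho> a $ i $ j) ` C)"

text \<open>\<open>\<theta>\<close> is an isomorphism of \<open>'k\<close>-vector spaces from the column vectors to \<open>M\<close>.\<close>

definition module_frame :: "('k::field \<Rightarrow> 'a) \<Rightarrow> ('a, 'm) module \<Rightarrow> ('k^'n \<Rightarrow> 'm) \<Rightarrow> bool" where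
  "module_frame \<iota> M \<theta> \<longleftrightarrow> bij_betw \<theta> UNIV (carrier M) \<and>
     (\<forall>u v. \<theta> (u + v) = \<theta> u \<oplus>\<^bsub>M\<^esub> \<theta> v) \<and> (\<forall>c v. \<theta> (c *s v) = \<iota> c \<odot>\<^bsub>M\<^esub> \<theta> v)"

definition rep_of_module ::
  "'a ring \<Rightarrow> ('a, 'm) module \<Rightarrow> ('k::field^'n \<Rightarrow> 'm) \<Rightarrow> 'a \<Rightarrow> 'k^'n^'n" where
  "rep_of_module A M \<theta> = (\<lambda>a\<in>carrier A. matrix (\<lambda>v. inv_into UNIV \<theta> (a \<odot>\<^bsub>M\<^esub> \<theta> v)))"

section \<open>The enveloping algebra is a ring\<close>

lemma frag_extend_fun_diff:
  "frag_extend (\<lambda>p. g p - h p :: 'a \<Rightarrow>\<^sub>0 int) y = frag_extend g y - frag_extend h y"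
proof -
  have "frag_cmul c (u - v) = frag_cmul c u - frag_cmul c v" for c and u v :: "'a \<Rightarrow>\<^sub>0 int"
    by (rule poly_mapping_eqI) (simp add: lookup_minus right_diff_distrib)
  then show ?thesis by (simp add: frag_extend_def sum_subtractf)
qed

lemma pair_ring_is_ring:
  assumes "ring A" "ring B"
  shows "ring (pair_ring A B)"
proof -
  interpret A: ring A by fact
  interpret B: ring B by fact
  let ?S = "carrier A \<times> carrier B"
  define m where "m y z = mult (pair_ring A B) y z" for y z
  have m: "m y z = frag_extend (\<lambda>p. frag_extend (\<lambda>q. frag_of (fst p \<otimes>\<^bsub>A\<^esub> fst q, snd p \<otimes>\<^bsub>B\<^esub> snd q)) z) y" for y z
    by (simp add: m_def pair_ring_def case_prod_unfold)
  have of: "m (frag_of p) (frag_of q) = frag_of (fst p \<otimes>\<^bsub>A\<^esub> fst q, snd p \<otimes>\<^bsub>B\<^esub> snd q)" for p q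
    by (simp add: m)
  have dl: "m (y - y') z = m y z - m y' z" for y y' z by (simp add: m frag_extend_diff)
  have dr: "m y (z - z') = m y z - m y z'" for y z z'
    by (simp add: m frag_extend_diff frag_extend_fun_diff)
  have zl: "m 0 z = 0" for z by (simp add: m)
  have zr: "m z 0 = 0" for z using dr[of z 0 0] by simp
  have al: "m (y + y') z = m y z + m y' z" for y y' z
    using dl[of y "0 - y'" z] dl[of 0 y' z] by (simp add: zl)
  have ar: "m y (z + z') = m y z + m y z'" for y z z'
    using dr[of y z "0 - z'"] dr[of y 0 z'] by (simp add: zr)
  have closed: "Poly_Mapping.keys (m y z) \<subseteq> ?S"
    if "Poly_Mapping.keys y \<subseteq> ?S" "Poly_Mapping.keys z \<subseteq> ?S" for y z
    using that(1)
  proof (induction y rule: frag_induction)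
    case (one p)
    show ?case using that(2)
    proof (induction z rule: frag_induction)
      case (one q) then show ?case using \<open>p \<in> ?S\<close> by (auto simp: of)
    next
      case (diff a b) then show ?case using keys_diff[of "m (frag_of p) a" "m (frag_of p) b"] by (auto simp: dr)
    qed (auto simp: zr)
  next
    case (diff a b) then show ?case using keys_diff[of "m a z" "m b z"] by (auto simp: dl)
  qed (auto simp: zl)
  have assoc: "m (m x y) z = m x (m y z)"
    if x: "Poly_Mapping.keys x \<subseteq> ?S" and y: "Poly_Mapping.keys y \<subseteq> ?S" and z: "Poly_Mapping.keys z \<subseteq> ?S" for x y z
    using x
  proof (induction x rule: frag_induction)
    case (one p)
    show ?case using y
    proof (induction y rule: frag_induction)
      case (one q)
      show ?case using z
      proof (induction z rule: frag_induction)
        case (one r) then show ?case using \<open>p \<in> ?S\<close> \<open>q \<in> ?S\<close> by (auto simp: of A.m_assoc B.m_assoc)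
      qed (auto simp: zr dr)
    qed (auto simp: zr dr zl dl)
  qed (auto simp: zl dl)
  have onel: "m (frag_of (\<one>\<^bsub>A\<^esub>, \<one>\<^bsub>B\<^esub>)) z = z" if "Poly_Mapping.keys z \<subseteq> ?S" for z
    using that by (induction z rule: frag_induction) (auto simp: zr dr of)
  have oner: "m z (frag_of (\<one>\<^bsub>A\<^esub>, \<one>\<^bsub>B\<^esub>)) = z" if "Poly_Mapping.keys z \<subseteq> ?S" for z
    using that by (induction z rule: frag_induction) (auto simp: zl dl of)
  have simps: "carrier (pair_ring A B) = {z. Poly_Mapping.keys z \<subseteq> ?S}"
    "mult (pair_ring A B) = m" "\<one>\<^bsub>pair_ring A B\<^esub> = frag_of (\<one>\<^bsub>A\<^esub>, \<one>\<^bsub>B\<^esub>)"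
    "add (pair_ring A B) = (+)" "\<zero>\<^bsub>pair_ring A B\<^esub> = 0"
    by (auto simp: m_def fun_eq_iff) (auto simp: pair_ring_def)
  show ?thesis
  proof (rule ringI)
    show "abelian_group (pair_ring A B)"
    proof (rule abelian_groupI)
      fix x y assume "x \<in> carrier (pair_ring A B)" "y \<in> carrier (pair_ring A B)"
      then show "x \<oplus>\<^bsub>pair_ring A B\<^esub> y \<in> carrier (pair_ring A B)"
        using keys_add[of x y] by (auto simp: simps)
    next
      fix x assume "x \<in> carrier (pair_ring A B)"
      then show "\<exists>y\<in>carrier (pair_ring A B). y \<oplus>\<^bsub>pair_ring A B\<^esub> x = \<zero>\<^bsub>pair_ring A B\<^esub>"
        by (intro bexI[of _ "- x"]) (auto simp: simps)
    qed (auto simp: simps)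
    show "Group.monoid (pair_ring A B)"
      by (rule monoidI) (use closed assoc onel oner in \<open>auto simp: simps\<close>)
  qed (auto simp: simps al ar)
qed

lemma ring_op_ring: "ring A \<Longrightarrow> ring (op_ring A)"
proof -
  assume "ring A"
  interpret ring A by fact
  show ?thesis
  proof (rule ringI)
    show "abelian_group (op_ring A)"
    proof (rule abelian_groupI)
      fix x assume "x \<in> carrier (op_ring A)"
      then show "\<exists>y\<in>carrier (op_ring A). y \<oplus>\<^bsub>op_ring A\<^esub> x = \<zero>\<^bsub>op_ring A\<^esub>"
        by (intro bexI[of _ "\<ominus>\<^bsub>A\<^esub> x"]) (auto simp: op_ring_def l_neg)
    qed (auto simp: op_ring_def a_ac)
    show "Group.monoid (op_ring A)"
      by (rule monoidI) (auto simp: op_ring_def m_assoc)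
  qed (auto simp: op_ring_def l_distr r_distr)
qed

lemma tensor_relations_in_carrier:
  assumes "assoc_algebra \<iota> A" "assoc_algebra \<kappa> B"
  shows "tensor_relations \<iota> A \<kappa> B \<subseteq> carrier (pair_ring A B)"
proof -
  interpret A: ring A using assms by (simp add: assoc_algebra_def)
  interpret B: ring B using assms by (simp add: assoc_algebra_def)
  have i: "\<iota> c \<in> carrier A" "\<kappa> c \<in> carrier B" for c
    using assms by (auto simp: assoc_algebra_def ring_hom_def univ_ring_def Pi_iff)
  have d: "u - v \<in> carrier (pair_ring A B)"
    if "u \<in> carrier (pair_ring A B)" "v \<in> carrier (pair_ring A B)" for u v
    using keys_diff[of u v] that by (auto simp: pair_ring_def)
  have f: "frag_of (a, b) \<in> carrier (pair_ring A B)" if "a \<in> carrier A" "b \<in> carrier B" for a b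
    using that by (simp add: pair_ring_def)
  have "frag_of (a \<oplus>\<^bsub>A\<^esub> a', b) - frag_of (a, b) - frag_of (a', b) \<in> carrier (pair_ring A B)"
    if "a \<in> carrier A" "a' \<in> carrier A" "b \<in> carrier B" for a a' b
    using that by (simp add: d f)
  moreover have "frag_of (a, b \<oplus>\<^bsub>B\<^esub> b') - frag_of (a, b) - frag_of (a, b') \<in> carrier (pair_ring A B)"
    if "a \<in> carrier A" "b \<in> carrier B" "b' \<in> carrier B" for a b b'
    using that by (simp add: d f)
  moreover have "frag_of (\<iota> c \<otimes>\<^bsub>A\<^esub> a, b) - frag_of (a, \<kappa> c \<otimes>\<^bsub>B\<^esub> b) \<in> carrier (pair_ring A B)"
    if "a \<in> carrier A" "b \<in> carrier B" for a b c
    using that by (simp add: d f i)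
  ultimately show ?thesis
    unfolding tensor_relations_def by (intro Un_least subsetI; elim CollectE exE conjE; simp)
qed

lemma assoc_algebra_op: "assoc_algebra \<iota> A \<Longrightarrow> assoc_algebra \<iota> (op_ring A)"
proof -
  assume A: "assoc_algebra \<iota> A"
  then have comm: "\<iota> c \<otimes>\<^bsub>A\<^esub> a = a \<otimes>\<^bsub>A\<^esub> \<iota> c" if "a \<in> carrier A" for a c
    using that unfolding assoc_algebra_def by blast
  have h: "\<iota> \<in> ring_hom univ_ring A" and A': "ring A" using A by (simp_all add: assoc_algebra_def)
  have "\<iota> \<in> ring_hom univ_ring (op_ring A)"
  proof (rule ring_hom_memI)
    fix x y
    show "\<iota> (x \<otimes>\<^bsub>univ_ring\<^esub> y) = \<iota> x \<otimes>\<^bsub>op_ring A\<^esub> \<iota> y"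
      using ring_hom_mult[OF h, of y x] by (simp add: univ_ring_def op_ring_def mult.commute)
    show "\<iota> (x \<oplus>\<^bsub>univ_ring\<^esub> y) = \<iota> x \<oplus>\<^bsub>op_ring A\<^esub> \<iota> y"
      using ring_hom_add[OF h, of x y] by (simp add: univ_ring_def op_ring_def)
    show "\<iota> x \<in> carrier (op_ring A)"
      using ring_hom_closed[OF h, of x] by (simp add: univ_ring_def op_ring_def)
    show "\<iota> \<one>\<^bsub>univ_ring\<^esub> = \<one>\<^bsub>op_ring A\<^esub>"
      using ring_hom_one[OF h] by (simp add: op_ring_def)
  qed
  then show ?thesis
    using ring_op_ring[OF A'] unfolding assoc_algebra_def by (simp add: op_ring_def comm[symmetric])
qed

lemma ring_enveloping_algebra:
  assumes "assoc_algebra \<iota> A"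
  shows "ring (enveloping_algebra \<iota> A)"
proof -
  have "ring (pair_ring A (op_ring A))"
    using assms by (intro pair_ring_is_ring ring_op_ring) (auto simp: assoc_algebra_def)
  then interpret ring "pair_ring A (op_ring A)" .
  show ?thesis unfolding enveloping_algebra_def tensor_algebra_def
    using genideal_ideal[OF tensor_relations_in_carrier[OF assms assoc_algebra_op[OF assms]]]
    by (rule ideal.quotient_is_ring)
qed

section \<open>The coordinate ring represents the functor of representations\<close>

lemma poly_mapping_sum_monomials:
  "(\<Sum>m\<in>Poly_Mapping.keys p. Poly_Mapping.single m (Poly_Mapping.lookup p m)) = p"
proof (rule poly_mapping_eqI)
  fix x
  show "Poly_Mapping.lookup (\<Sum>m\<in>Poly_Mapping.keys p. Poly_Mapping.single m (Poly_Mapping.lookup p m)) x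
      = Poly_Mapping.lookup p x"
    by (simp add: lookup_sum lookup_single when_def sum.delta' in_keys_iff)
qed

lemma mon_eval_superset:
  "finite S \<Longrightarrow> Poly_Mapping.keys m \<subseteq> S \<Longrightarrow> mon_eval t m = (\<Prod>v\<in>S. t v ^ Poly_Mapping.lookup m v)"
  unfolding mon_eval_def by (rule prod.mono_neutral_left) (auto simp: in_keys_iff)

lemma mon_eval_add: "mon_eval t (m + m') = mon_eval t m * mon_eval t m'"
proof -
  let ?S = "Poly_Mapping.keys m \<union> Poly_Mapping.keys m'"
  have "mon_eval t (m + m') = (\<Prod>v\<in>?S. t v ^ Poly_Mapping.lookup (m + m') v)"
    by (rule mon_eval_superset) (use keys_add[of m m'] in auto)
  also have "\<dots> = mon_eval t m * mon_eval t m'"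
    by (simp add: lookup_add power_add prod.distrib mon_eval_superset[of ?S])
  finally show ?thesis .
qed

lemma mon_eval_0 [simp]: "mon_eval t 0 = 1"
  by (simp add: mon_eval_def)

lemma mon_eval_single [simp]: "mon_eval t (Poly_Mapping.single v e) = t v ^ e"
  by (cases "e = 0") (simp_all add: mon_eval_def)

context
  fixes \<beta> :: "'k::comm_ring_1 \<Rightarrow> 'b::comm_ring_1"
  assumes \<beta>: "\<beta> \<in> ring_hom univ_ring univ_ring"
begin

lemma coeff_hom: "\<beta> (x + y) = \<beta> x + \<beta> y" "\<beta> (x * y) = \<beta> x * \<beta> y" "\<beta> 1 = 1" "\<beta> 0 = 0"
proof -
  show *: "\<beta> (x + y) = \<beta> x + \<beta> y" "\<beta> (x * y) = \<beta> x * \<beta> y" "\<beta> 1 = 1" for x y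
    using \<beta> by (auto simp: ring_hom_def univ_ring_def)
  show "\<beta> 0 = 0" using *(1)[of 0 0] by simp
qed

lemma mpoly_eval_superset:
  "finite S \<Longrightarrow> Poly_Mapping.keys p \<subseteq> S \<Longrightarrow>
   mpoly_eval \<beta> t p = (\<Sum>m\<in>S. \<beta> (Poly_Mapping.lookup p m) * mon_eval t m)"
  unfolding mpoly_eval_def
  by (rule sum.mono_neutral_left) (auto simp: in_keys_iff coeff_hom)

lemma mpoly_eval_add: "mpoly_eval \<beta> t (p + q) = mpoly_eval \<beta> t p + mpoly_eval \<beta> t q"
proof -
  let ?S = "Poly_Mapping.keys p \<union> Poly_Mapping.keys q"
  have "mpoly_eval \<beta> t (p + q) = (\<Sum>m\<in>?S. \<beta> (Poly_Mapping.lookup (p + q) m) * mon_eval t m)"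
    by (rule mpoly_eval_superset) (use keys_add[of p q] in auto)
  also have "\<dots> = mpoly_eval \<beta> t p + mpoly_eval \<beta> t q"
    by (simp add: lookup_add coeff_hom distrib_right sum.distrib mpoly_eval_superset[of ?S])
  finally show ?thesis .
qed

lemma mpoly_eval_0 [simp]: "mpoly_eval \<beta> t 0 = 0"
  by (simp add: mpoly_eval_def)

lemma mpoly_eval_single [simp]: "mpoly_eval \<beta> t (Poly_Mapping.single m c) = \<beta> c * mon_eval t m"
  by (cases "c = 0") (simp_all add: mpoly_eval_def coeff_hom)

lemma mpoly_eval_sum: "mpoly_eval \<beta> t (sum f S) = (\<Sum>i\<in>S. mpoly_eval \<beta> t (f i))"
  by (induction S rule: infinite_finite_induct) (simp_all add: mpoly_eval_add)

lemma mpoly_eval_mult: "mpoly_eval \<beta> t (p * q) = mpoly_eval \<beta> t p * mpoly_eval \<beta> t q"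
proof -
  have "mpoly_eval \<beta> t (p * q) = mpoly_eval \<beta> t
      ((\<Sum>m\<in>Poly_Mapping.keys p. Poly_Mapping.single m (Poly_Mapping.lookup p m)) *
       (\<Sum>m\<in>Poly_Mapping.keys q. Poly_Mapping.single m (Poly_Mapping.lookup q m)))"
    by (simp add: poly_mapping_sum_monomials)
  also have "\<dots> = mpoly_eval \<beta> t p * mpoly_eval \<beta> t q"
    by (simp add: sum_product mpoly_eval_sum mult_single coeff_hom mon_eval_add
        mpoly_eval_def[of \<beta> t p] mpoly_eval_def[of \<beta> t q] mult_ac)
  finally show ?thesis .
qed

lemma mpoly_eval_diff: "mpoly_eval \<beta> t (p - q) = mpoly_eval \<beta> t p - mpoly_eval \<beta> t q"
  using mpoly_eval_add[of t "p - q" q] by simp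

lemma mpoly_eval_mvar [simp]: "mpoly_eval \<beta> t (mvar v) = t v"
  by (simp add: mvar_def coeff_hom)

lemma mpoly_eval_mconst [simp]: "mpoly_eval \<beta> t (mconst c) = \<beta> c"
  by (simp add: mconst_def)

lemma mpoly_eval_ring_hom: "mpoly_eval \<beta> t \<in> ring_hom (mpoly_ring V) univ_ring"
  using mpoly_eval_single[of t 0 1]
  by (auto simp: ring_hom_def mpoly_ring_def univ_ring_def mpoly_eval_add mpoly_eval_mult coeff_hom)

end

lemma cring_univ_ring: "cring (univ_ring :: 'b::comm_ring_1 ring)"
proof (rule cringI)
  show "abelian_group (univ_ring :: 'b ring)"
    by (rule abelian_groupI) (auto simp: univ_ring_def add_ac intro: exI[of _ "- x" for x] left_minus)
qed (unfold_locales, auto simp: univ_ring_def algebra_simps)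

lemma mpoly_ring_closed:
  fixes p q :: "('v, 'k::comm_ring_1) mpoly"
  shows
  "mconst c \<in> carrier (mpoly_ring V)"
  "v \<in> V \<Longrightarrow> mvar v \<in> carrier (mpoly_ring V)"
  "p \<in> carrier (mpoly_ring V) \<Longrightarrow> q \<in> carrier (mpoly_ring V) \<Longrightarrow> p + q \<in> carrier (mpoly_ring V)"
  "p \<in> carrier (mpoly_ring V) \<Longrightarrow> q \<in> carrier (mpoly_ring V) \<Longrightarrow> p - q \<in> carrier (mpoly_ring V)"
  "p \<in> carrier (mpoly_ring V) \<Longrightarrow> - p \<in> carrier (mpoly_ring V)"
  "p \<in> carrier (mpoly_ring V) \<Longrightarrow> q \<in> carrier (mpoly_ring V) \<Longrightarrow> p * q \<in> carrier (mpoly_ring V)"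
proof -
  show "p + q \<in> carrier (mpoly_ring V)"
    if "p \<in> carrier (mpoly_ring V)" "q \<in> carrier (mpoly_ring V)" for p q :: "('v, 'k) mpoly"
    using that keys_add[of p q] by (auto simp: mpoly_ring_def)
  show "p - q \<in> carrier (mpoly_ring V)"
    if "p \<in> carrier (mpoly_ring V)" "q \<in> carrier (mpoly_ring V)" for p q :: "('v, 'k) mpoly"
    using that keys_diff[of p q] by (auto simp: mpoly_ring_def)
  show "p * q \<in> carrier (mpoly_ring V)"
    if "p \<in> carrier (mpoly_ring V)" "q \<in> carrier (mpoly_ring V)" for p q :: "('v, 'k) mpoly"
    unfolding mpoly_ring_def
  proof (clarsimp simp del: in_keys_iff)
    fix m v assume "m \<in> Poly_Mapping.keys (p * q)" "v \<in> Poly_Mapping.keys m"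
    then obtain a b where "m = a + b" "a \<in> Poly_Mapping.keys p" "b \<in> Poly_Mapping.keys q"
      using keys_mult[of p q] by blast
    moreover have "Poly_Mapping.keys a \<subseteq> V" "Poly_Mapping.keys b \<subseteq> V"
      using that calculation by (auto simp: mpoly_ring_def)
    ultimately show "v \<in> V" using keys_add[of a b] \<open>v \<in> _\<close> by blast
  qed
qed (auto simp: mpoly_ring_def mconst_def mvar_def)

lemma mconst_hom: "mconst (x + y) = mconst x + mconst y" "mconst (x * y) = mconst x * mconst y"
  "mconst 1 = 1" "mconst 0 = 0"
  by (simp_all add: mconst_def single_add mult_single)

lemma cring_mpoly_ring: "cring (mpoly_ring V :: ('v, 'k::comm_ring_1) mpoly ring)"
proof (rule cringI)
  let ?P = "mpoly_ring V :: ('v, 'k) mpoly ring"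
  note closed = mpoly_ring_closed
  have s: "mult ?P = (*)" "add ?P = (+)" "\<one>\<^bsub>?P\<^esub> = 1" "\<zero>\<^bsub>?P\<^esub> = 0" by (simp_all add: mpoly_ring_def)
  have c: "0 \<in> carrier ?P" "1 \<in> carrier ?P" by (simp_all add: mpoly_ring_def)
  show "abelian_group ?P"
  proof (rule abelian_groupI)
    fix x assume "x \<in> carrier ?P"
    then show "\<exists>y\<in>carrier ?P. y \<oplus>\<^bsub>?P\<^esub> x = \<zero>\<^bsub>?P\<^esub>"
      by (intro bexI[of _ "- x"]) (auto simp: s closed)
  qed (auto simp: s c closed add_ac)
  show "comm_monoid ?P"
    by (rule comm_monoidI) (auto simp: s c closed mult_ac)
qed (auto simp: mpoly_ring_def distrib_right)

lemma mpoly_ring_induct [consumes 1, case_names mconst mvar add mult]: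
  fixes p :: "('v, 'k::comm_ring_1) mpoly"
  assumes "p \<in> carrier (mpoly_ring V)"
    and const: "\<And>c. Q (mconst c)" and var: "\<And>v. v \<in> V \<Longrightarrow> Q (mvar v)"
    and add: "\<And>p q. p \<in> carrier (mpoly_ring V) \<Longrightarrow> q \<in> carrier (mpoly_ring V) \<Longrightarrow> Q p \<Longrightarrow> Q q \<Longrightarrow> Q (p + q)"
    and mult: "\<And>p q. p \<in> carrier (mpoly_ring V) \<Longrightarrow> q \<in> carrier (mpoly_ring V) \<Longrightarrow> Q p \<Longrightarrow> Q q \<Longrightarrow> Q (p * q)"
  shows "Q p"
proof -
  let ?C = "carrier (mpoly_ring V :: ('v, 'k) mpoly ring)"
  have pow: "mvar v ^ e \<in> ?C \<and> Q (mvar v ^ e)" if "v \<in> V" for v e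
  proof (induction e)
    case 0 then show ?case using const[of 1] mpoly_ring_closed(1)[of 1 V] by (simp add: mconst_hom)
  next
    case (Suc e)
    moreover have "mvar v \<in> ?C" using that by (rule mpoly_ring_closed)
    ultimately show ?case
      using mult[of "mvar v" "mvar v ^ e"] var[OF that] by (auto intro: mpoly_ring_closed)
  qed
  have single_pow: "Poly_Mapping.single (Poly_Mapping.single v e) (1::'k) = mvar v ^ e" for v e
  proof (induction e)
    case (Suc e)
    have "Poly_Mapping.single v (Suc e) = Poly_Mapping.single v 1 + Poly_Mapping.single v e"
      by (simp flip: single_add)
    moreover have "mvar v ^ Suc e = mvar v * Poly_Mapping.single (Poly_Mapping.single v e) (1::'k)"
      using Suc by simp
    ultimately show ?case by (simp add: mvar_def mult_single)
  qed simp
  have mon: "Poly_Mapping.single (\<Sum>v\<in>S. Poly_Mapping.single v (e v)) 1 \<in> ?C \<and>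
      Q (Poly_Mapping.single (\<Sum>v\<in>S. Poly_Mapping.single v (e v)) 1)" if "finite S" "S \<subseteq> V" for S e
    using that
  proof (induction S)
    case empty then show ?case using const[of 1] mpoly_ring_closed(1)[of 1 V] by (simp add: mconst_def)
  next
    case (insert v S)
    have "Poly_Mapping.single (\<Sum>v\<in>insert v S. Poly_Mapping.single v (e v)) (1::'k) =
        mvar v ^ e v * Poly_Mapping.single (\<Sum>v\<in>S. Poly_Mapping.single v (e v)) 1"
      using insert by (simp add: single_pow[symmetric] mult_single)
    then show ?case using insert pow[of v "e v"] by (auto intro: mult mpoly_ring_closed)
  qed
  have single: "Poly_Mapping.single m c \<in> ?C \<and> Q (Poly_Mapping.single m c)"
    if "Poly_Mapping.keys m \<subseteq> V" for m c
  proof -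
    have "Poly_Mapping.single m c = mconst c * Poly_Mapping.single
        (\<Sum>v\<in>Poly_Mapping.keys m. Poly_Mapping.single v (Poly_Mapping.lookup m v)) 1"
      by (simp add: mconst_def mult_single poly_mapping_sum_monomials)
    then show ?thesis
      using mon[of "Poly_Mapping.keys m" "Poly_Mapping.lookup m"] that
      by (auto intro: mult const mpoly_ring_closed)
  qed
  have "(\<Sum>m\<in>S. Poly_Mapping.single m (Poly_Mapping.lookup p m)) \<in> ?C \<and>
      Q (\<Sum>m\<in>S. Poly_Mapping.single m (Poly_Mapping.lookup p m))"
    if "finite S" "S \<subseteq> Poly_Mapping.keys p" for S
    using that
  proof (induction S)
    case empty then show ?case using const[of 0] mpoly_ring_closed(1)[of 0 V] by (simp add: mconst_hom)
  next
    case (insert m S)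
    moreover have "Poly_Mapping.keys m \<subseteq> V" using insert assms(1) by (auto simp: mpoly_ring_def)
    ultimately show ?case using single by (auto intro: add mpoly_ring_closed)
  qed
  from this[of "Poly_Mapping.keys p"] show ?thesis by (simp add: poly_mapping_sum_monomials)
qed

lemma rep_relations_in_carrier:
  fixes \<iota> :: "'k::field \<Rightarrow> 'a"
  assumes "assoc_algebra \<iota> A"
  shows "(rep_relations \<iota> A :: ('a \<times> 'n::finite \<times> 'n, 'k) mpoly set) \<subseteq> carrier (rep_poly_ring A)"
proof -
  interpret A: ring A using assms by (simp add: assoc_algebra_def)
  have i: "\<iota> c \<in> carrier A" for c
    using assms by (auto simp: assoc_algebra_def ring_hom_def univ_ring_def Pi_iff)
  have sum: "(\<Sum>l\<in>S. f l) \<in> carrier (mpoly_ring V)" if "\<And>l. f l \<in> carrier (mpoly_ring V)"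
    for f :: "'n \<Rightarrow> ('a \<times> 'n \<times> 'n, 'k) mpoly" and S V
    using that mpoly_ring_closed(1)[of 0 V]
    by (induction S rule: infinite_finite_induct) (auto simp: mconst_hom intro: mpoly_ring_closed)
  have v: "a \<in> carrier A \<Longrightarrow> mvar (a, i, j) \<in> carrier (rep_poly_ring A)" for a and i j :: 'n
    by (simp add: rep_poly_ring_def mpoly_ring_closed)
  have ifc: "(if i = j then mconst c else 0 :: ('a \<times> 'n \<times> 'n, 'k) mpoly) \<in> carrier (rep_poly_ring A)"
    for c and i j :: 'n
    by (simp add: rep_poly_ring_def mpoly_ring_closed) (simp add: mpoly_ring_def)
  have cl1: "p - q \<in> carrier (rep_poly_ring A)" "p * q \<in> carrier (rep_poly_ring A)"
    if "p \<in> carrier (rep_poly_ring A)" "q \<in> carrier (rep_poly_ring A)"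
    for p q :: "('a \<times> 'n \<times> 'n, 'k) mpoly"
    using that by (auto simp: rep_poly_ring_def intro: mpoly_ring_closed)
  have cl2: "(\<Sum>l\<in>UNIV. f l) \<in> carrier (rep_poly_ring A)"
    if "\<And>l. f l \<in> carrier (rep_poly_ring A)" for f :: "'n \<Rightarrow> ('a \<times> 'n \<times> 'n, 'k) mpoly"
    using sum[of f "carrier A \<times> UNIV"] that by (simp add: rep_poly_ring_def)
  note cl = v ifc cl1 cl2
  show ?thesis
    unfolding rep_relations_def
    by (intro Un_least subsetI; elim CollectE exE conjE; hypsubst;
        intro cl A.a_closed A.m_closed i; assumption)
qed

text \<open>
  \<open>rep_ring\<close> represents \<open>rep_functor\<close>: for every commutative algebra \<open>'b\<close>, homomorphisms from
  \<open>rep_ring\<close> to \<open>'b\<close> correspond to algebra homomorphisms from \<open>A\<close> to matrices over \<open>'b\<close>.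
\<close>

theorem rep_ring_represents:
  fixes \<iota> :: "'k::field \<Rightarrow> 'a" and \<beta> :: "'k \<Rightarrow> 'b::comm_ring_1"
  assumes A: "assoc_algebra \<iota> A" and \<beta>: "\<beta> \<in> ring_hom univ_ring univ_ring"
  shows "bij_betw (\<lambda>g. \<lambda>a\<in>carrier A. \<chi> i j. g (rep_coord \<iota> A a i j))
    {g \<in> ring_hom (rep_ring \<iota> A) univ_ring \<inter> extensional (carrier (rep_ring \<iota> A)).
       \<forall>c. g (rep_scalar \<iota> A c) = \<beta> c}
    (rep_functor \<iota> A \<beta> :: ('a \<Rightarrow> 'b^'n^'n) set)"
proof -
  let ?P = "rep_poly_ring A :: ('a \<times> 'n \<times> 'n, 'k) mpoly ring"
  let ?I = "rep_ideal \<iota> A :: ('a \<times> 'n \<times> 'n, 'k) mpoly set"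
  let ?R = "rep_ring \<iota> A :: ('a \<times> 'n \<times> 'n, 'k) mpoly set ring"
  let ?U = "univ_ring :: 'b ring"
  interpret A: ring A using A by (simp add: assoc_algebra_def)
  interpret P: cring ?P unfolding rep_poly_ring_def by (rule cring_mpoly_ring)
  interpret I: ideal ?I ?P
    unfolding rep_ideal_def by (rule P.genideal_ideal) (rule rep_relations_in_carrier[OF A])
  have Ps: "mult ?P = (*)" "add ?P = (+)" "\<one>\<^bsub>?P\<^esub> = 1" "\<zero>\<^bsub>?P\<^esub> = 0"
    by (simp_all add: rep_poly_ring_def mpoly_ring_def)
  have Us: "mult ?U = (*)" "add ?U = (+)" "\<one>\<^bsub>?U\<^esub> = 1" "\<zero>\<^bsub>?U\<^esub> = 0" "carrier ?U = UNIV"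
    by (simp_all add: univ_ring_def)
  let ?q = "\<lambda>p. ?I +>\<^bsub>?P\<^esub> p"
  have q: "?q \<in> ring_hom ?P ?R" unfolding rep_ring_def by (rule I.rcos_ring_hom)
  have \<iota>: "\<iota> c \<in> carrier A" for c
    using A by (auto simp: assoc_algebra_def ring_hom_def univ_ring_def Pi_iff)
  have varc: "a \<in> carrier A \<Longrightarrow> mvar (a, i, j) \<in> carrier ?P" for a i j
    by (simp add: rep_poly_ring_def mpoly_ring_closed)
  have constc: "mconst c \<in> carrier ?P" for c
    by (simp add: rep_poly_ring_def mpoly_ring_closed)
  have carR: "\<exists>p\<in>carrier ?P. C = ?q p" if "C \<in> carrier ?R" for C
    using that by (auto simp: rep_ring_def FactRing_def A_RCOSETS_def' )
  have rel: "?q p = ?q p'" if "p - p' \<in> rep_relations \<iota> A" "p \<in> carrier ?P" "p' \<in> carrier ?P" for p p'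
  proof -
    have "p - p' \<in> ?I"
      using that P.genideal_self[OF rep_relations_in_carrier[OF A]] by (auto simp: rep_ideal_def)
    then have "p \<in> ?q p'"
      by (auto simp: a_r_coset_def' Ps intro: bexI[of _ "p - p'"])
    then show ?thesis using I.a_repr_independence' that by metis
  qed
  show ?thesis
  proof (rule bij_betwI')
    fix g g' assume
      1: "g \<in> {g \<in> ring_hom ?R ?U \<inter> extensional (carrier ?R). \<forall>c. g (rep_scalar \<iota> A c) = \<beta> c}" and
      2: "g' \<in> {g \<in> ring_hom ?R ?U \<inter> extensional (carrier ?R). \<forall>c. g (rep_scalar \<iota> A c) = \<beta> c}"
    show "((\<lambda>a\<in>carrier A. \<chi> i j. g (rep_coord \<iota> A a i j)) =
        (\<lambda>a\<in>carrier A. \<chi> i j. g' (rep_coord \<iota> A a i j))) = (g = g')"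
    proof
      assume eq: "(\<lambda>a\<in>carrier A. \<chi> i j. g (rep_coord \<iota> A a i j)) =
        (\<lambda>a\<in>carrier A. \<chi> i j. g' (rep_coord \<iota> A a i j))"
      have v: "g (?q (mvar (a, i, j))) = g' (?q (mvar (a, i, j)))" if "a \<in> carrier A" for a i j
        using fun_cong[OF eq, of a] that by (simp add: vec_eq_iff rep_coord_def)
      have "g (?q p) = g' (?q p)" if "p \<in> carrier ?P" for p
        using that[unfolded rep_poly_ring_def]
      proof (induction p rule: mpoly_ring_induct)
        case (mconst c) then show ?case using 1 2 by (simp add: rep_scalar_def)
      next
        case (mvar x) then show ?case using v by (cases x) auto
      next
        case (add p p')
        then have "p \<in> carrier ?P" "p' \<in> carrier ?P" by (auto simp: rep_poly_ring_def)
        then show ?case using add 1 2 ring_hom_add[OF q, of p p'] ring_hom_closed[OF q]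
            ring_hom_add[of g ?R ?U "?q p" "?q p'"] ring_hom_add[of g' ?R ?U "?q p" "?q p'"]
          by (simp add: Ps Us)
      next
        case (mult p p')
        then have "p \<in> carrier ?P" "p' \<in> carrier ?P" by (auto simp: rep_poly_ring_def)
        then show ?case using mult 1 2 ring_hom_mult[OF q, of p p'] ring_hom_closed[OF q]
            ring_hom_mult[of g ?R ?U "?q p" "?q p'"] ring_hom_mult[of g' ?R ?U "?q p" "?q p'"]
          by (simp add: Ps Us)
      qed
      then show "g = g'"
        using 1 2 by (intro extensionalityI[of _ "carrier ?R"]) (auto dest!: carR)
    qed auto
  next
    fix g assume 1: "g \<in> {g \<in> ring_hom ?R ?U \<inter> extensional (carrier ?R). \<forall>c. g (rep_scalar \<iota> A c) = \<beta> c}"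
    define \<phi> where "\<phi> p = g (?q p)" for p
    have g: "g \<in> ring_hom ?R ?U" using 1 by simp
    have add: "\<phi> (p + p') = \<phi> p + \<phi> p'" if "p \<in> carrier ?P" "p' \<in> carrier ?P" for p p'
      using that ring_hom_add[OF q, of p p'] ring_hom_closed[OF q]
        ring_hom_add[OF g, of "?q p" "?q p'"] by (simp add: Ps Us \<phi>_def)
    have mult: "\<phi> (p * p') = \<phi> p * \<phi> p'" if "p \<in> carrier ?P" "p' \<in> carrier ?P" for p p'
      using that ring_hom_mult[OF q, of p p'] ring_hom_closed[OF q]
        ring_hom_mult[OF g, of "?q p" "?q p'"] by (simp add: Ps Us \<phi>_def)
    have const: "\<phi> (mconst c) = \<beta> c" for c using 1 by (simp add: \<phi>_def rep_scalar_def)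
    have z: "\<phi> 0 = 0" using const[of 0] coeff_hom(4)[OF \<beta>] by (simp add: mconst_hom)
    have closed: "p + p' \<in> carrier ?P" "p * p' \<in> carrier ?P" "p - p' \<in> carrier ?P"
      if "p \<in> carrier ?P" "p' \<in> carrier ?P" for p p'
      using that by (auto simp: rep_poly_ring_def intro: mpoly_ring_closed)
    have z0: "0 \<in> carrier ?P" using constc[of 0] by (simp add: mconst_hom)
    have sum: "\<phi> (\<Sum>l\<in>S. f l) = (\<Sum>l\<in>S. \<phi> (f l)) \<and> (\<Sum>l\<in>S. f l) \<in> carrier ?P"
      if "\<And>l. f l \<in> carrier ?P" for f :: "'n \<Rightarrow> _" and S
      by (induction S rule: infinite_finite_induct) (auto simp: z z0 add closed that)
    show "(\<lambda>a\<in>carrier A. \<chi> i j. g (rep_coord \<iota> A a i j)) \<in> rep_functor \<iota> A \<beta>"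
      unfolding rep_functor_def
    proof (intro CollectI conjI ballI allI)
      fix a b assume ab: "a \<in> carrier A" "b \<in> carrier A"
      have "\<phi> (mvar (a \<oplus>\<^bsub>A\<^esub> b, i, j)) = \<phi> (mvar (a, i, j) + mvar (b, i, j))" for i j
        unfolding \<phi>_def using ab
        by (intro arg_cong[of _ _ g] rel)
          (auto simp: rep_relations_def closed varc algebra_simps)
      then show "(\<lambda>a\<in>carrier A. \<chi> i j. g (rep_coord \<iota> A a i j)) (a \<oplus>\<^bsub>A\<^esub> b) =
          (\<lambda>a\<in>carrier A. \<chi> i j. g (rep_coord \<iota> A a i j)) a + (\<lambda>a\<in>carrier A. \<chi> i j. g (rep_coord \<iota> A a i j)) b"
        using ab by (simp add: vec_eq_iff rep_coord_def add varc flip: \<phi>_def)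
      have "\<phi> (mvar (a \<otimes>\<^bsub>A\<^esub> b, i, j)) = \<phi> (\<Sum>l\<in>UNIV. mvar (a, i, l) * mvar (b, l, j))" for i j
        unfolding \<phi>_def using ab sum[of "\<lambda>l. mvar (a, i, l) * mvar (b, l, j)" UNIV]
        by (intro arg_cong[of _ _ g] rel) (auto simp: rep_relations_def closed varc)
      also have "\<phi> (\<Sum>l\<in>UNIV. mvar (a, i, l) * mvar (b, l, j)) =
          (\<Sum>l\<in>UNIV. \<phi> (mvar (a, i, l)) * \<phi> (mvar (b, l, j)))" for i j
        using sum[of "\<lambda>l. mvar (a, i, l) * mvar (b, l, j)" UNIV] ab by (simp add: closed varc mult)
      finally show "(\<lambda>a\<in>carrier A. \<chi> i j. g (rep_coord \<iota> A a i j)) (a \<otimes>\<^bsub>A\<^esub> b) =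
          (\<lambda>a\<in>carrier A. \<chi> i j. g (rep_coord \<iota> A a i j)) a ** (\<lambda>a\<in>carrier A. \<chi> i j. g (rep_coord \<iota> A a i j)) b"
        using ab by (simp add: vec_eq_iff rep_coord_def matrix_matrix_mult_def flip: \<phi>_def)
    next
      fix c
      have "\<phi> (mvar (\<iota> c, i, j)) = \<phi> (if i = j then mconst c else 0)" for i j
        unfolding \<phi>_def
        by (intro arg_cong[of _ _ g] rel)
          (use constc z0 in \<open>auto simp: rep_relations_def closed varc \<iota>\<close>)
      then show "(\<lambda>a\<in>carrier A. \<chi> i j. g (rep_coord \<iota> A a i j)) (\<iota> c) = mat (\<beta> c)"
        by (simp add: vec_eq_iff rep_coord_def \<iota> mat_def z const flip: \<phi>_def)
    qed auto
  next
    fix \<rho> :: "'a \<Rightarrow> 'b^'n^'n" assume \<rho>: "\<rho> \<in> rep_functor \<iota> A \<beta>"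
    define e where "e = mpoly_eval \<beta> (\<lambda>(a, i, j). \<rho> a $ i $ j)"
    interpret U: cring ?U by (rule cring_univ_ring)
    have e: "e \<in> ring_hom ?P ?U" unfolding e_def rep_poly_ring_def by (rule mpoly_eval_ring_hom[OF \<beta>])
    interpret e: ring_hom_ring ?P ?U e by (intro ring_hom_ringI2 e P.ring_axioms U.ring_axioms)
    have "?I \<subseteq> a_kernel ?P ?U e" unfolding rep_ideal_def
    proof (rule P.genideal_minimal)
      show "ideal (a_kernel ?P ?U e) ?P" by (rule e.kernel_is_ideal)
      have if_eval: "e (if i = j then mconst c else 0) = (if i = j then \<beta> c else 0)" for c and i j :: 'n
        by (simp add: e_def mpoly_eval_mconst[OF \<beta>] mpoly_eval_0[OF \<beta>])
      have ediff: "e (p - p') = e p - e p'" and emult: "e (p * p') = e p * e p'"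
        and esum: "e (sum f UNIV) = (\<Sum>l\<in>UNIV. e (f l))" and evar: "e (mvar (a, i, j)) = \<rho> a $ i $ j"
        for p p' a i j and f :: "'n \<Rightarrow> _"
        by (simp_all add: e_def mpoly_eval_diff[OF \<beta>] mpoly_eval_mult[OF \<beta>] mpoly_eval_sum[OF \<beta>]
            mpoly_eval_mvar[OF \<beta>])
      have "e p = 0" if "p \<in> rep_relations \<iota> A" for p
        using that \<rho> unfolding rep_relations_def rep_functor_def
        by (elim UnE CollectE exE conjE)
          (simp_all add: if_eval ediff emult esum evar matrix_matrix_mult_def mat_def)
      then show "rep_relations \<iota> A \<subseteq> a_kernel ?P ?U e"
        using rep_relations_in_carrier[OF A] unfolding a_kernel_def' Us by blast
    qed
    then have ker: "e p = 0" if "p \<in> ?I" for p using that unfolding a_kernel_def' Us by blast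
    have val: "the_elem (e ` ?q p) = e p" if "p \<in> carrier ?P" for p
    proof -
      have "e ` ?q p = {e p}"
      proof -
        have "e (h + p) = e p" if "h \<in> ?I" for h
          using ker[OF that] by (simp add: e_def mpoly_eval_add[OF \<beta>])
        then have "(\<lambda>h. e (h + p)) ` ?I = (\<lambda>_. e p) ` ?I" by (intro image_cong) auto
        moreover have "?I \<noteq> {}" using I.zero_closed by blast
        moreover have "?q p = (\<lambda>h. h + p) ` ?I" unfolding a_r_coset_def' Ps by blast
        ultimately show ?thesis by (simp add: image_image image_constant_conv)
      qed
      then show ?thesis by simp
    qed
    define g where "g = (\<lambda>C\<in>carrier ?R. the_elem (e ` C))"
    have gq: "g (?q p) = e p" if "p \<in> carrier ?P" for p
      using val[OF that] ring_hom_closed[OF q that] by (simp add: g_def)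
    have "g \<in> ring_hom ?R ?U"
    proof (rule ring_hom_memI)
      fix C D assume "C \<in> carrier ?R" "D \<in> carrier ?R"
      then obtain p p' where p: "p \<in> carrier ?P" "C = ?q p" "p' \<in> carrier ?P" "D = ?q p'"
        using carR by meson
      have "g (C \<otimes>\<^bsub>?R\<^esub> D) = g (?q (p \<otimes>\<^bsub>?P\<^esub> p'))"
        unfolding p(2,4) ring_hom_mult[OF q p(1,3)] ..
      then show "g (C \<otimes>\<^bsub>?R\<^esub> D) = g C \<otimes>\<^bsub>?U\<^esub> g D"
        unfolding p(2,4) gq[OF p(1)] gq[OF p(3)] gq[OF P.m_closed[OF p(1,3)]] e.hom_mult[OF p(1,3)] .
      have "g (C \<oplus>\<^bsub>?R\<^esub> D) = g (?q (p \<oplus>\<^bsub>?P\<^esub> p'))"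
        unfolding p(2,4) ring_hom_add[OF q p(1,3)] ..
      then show "g (C \<oplus>\<^bsub>?R\<^esub> D) = g C \<oplus>\<^bsub>?U\<^esub> g D"
        unfolding p(2,4) gq[OF p(1)] gq[OF p(3)] gq[OF P.a_closed[OF p(1,3)]] e.hom_add[OF p(1,3)] .
    next
      show "g \<one>\<^bsub>?R\<^esub> = \<one>\<^bsub>?U\<^esub>"
        using ring_hom_one[OF q] gq[OF P.one_closed] e.hom_one by metis
    qed (simp add: Us)
    moreover have "g (rep_scalar \<iota> A c) = \<beta> c" for c
      by (simp add: rep_scalar_def gq constc e_def mpoly_eval_mconst[OF \<beta>])
    moreover have "\<rho> = (\<lambda>a\<in>carrier A. \<chi> i j. g (rep_coord \<iota> A a i j))"
    proof (rule extensionalityI[of _ "carrier A"])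
      fix a assume "a \<in> carrier A"
      then show "\<rho> a = (\<lambda>a\<in>carrier A. \<chi> i j. g (rep_coord \<iota> A a i j)) a"
        by (simp add: vec_eq_iff rep_coord_def gq varc e_def mpoly_eval_mvar[OF \<beta>])
    qed (use \<rho> in \<open>auto simp: rep_functor_def\<close>)
    ultimately show "\<exists>g\<in>{g \<in> ring_hom ?R ?U \<inter> extensional (carrier ?R). \<forall>c. g (rep_scalar \<iota> A c) = \<beta> c}.
        \<rho> = (\<lambda>a\<in>carrier A. \<chi> i j. g (rep_coord \<iota> A a i j))"
      by (intro bexI[of _ g]) (auto simp: g_def)
  qed
qed

lemma rep_of_module_in_rep_functor:
  fixes \<iota> :: "'k::field \<Rightarrow> 'a" and \<theta> :: "'k^'n \<Rightarrow> 'm"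
  assumes A: "assoc_algebra \<iota> A" and "left_module A M" and fr: "module_frame \<iota> M \<theta>"
  shows "rep_of_module A M \<theta> \<in> rep_functor \<iota> A id"
proof -
  interpret left_module A M by fact
  have \<iota>: "\<iota> c \<in> carrier A" for c
    using A by (auto simp: assoc_algebra_def ring_hom_def univ_ring_def Pi_iff)
  have comm: "\<iota> c \<otimes>\<^bsub>A\<^esub> a = a \<otimes>\<^bsub>A\<^esub> \<iota> c" if "a \<in> carrier A" for a c
    using A that by (auto simp: assoc_algebra_def)
  have bij: "bij_betw \<theta> UNIV (carrier M)" using fr by (simp add: module_frame_def)
  have \<theta>c: "\<theta> v \<in> carrier M" for v using bij by (auto simp: bij_betw_def)
  have \<theta>: "\<theta> (u + v) = \<theta> u \<oplus>\<^bsub>M\<^esub> \<theta> v" "\<theta> (c *s v) = \<iota> c \<odot>\<^bsub>M\<^esub> \<theta> v" for u v c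
    using fr by (auto simp: module_frame_def)
  define f where "f a v = inv_into UNIV \<theta> (a \<odot>\<^bsub>M\<^esub> \<theta> v)" for a v
  have f: "\<theta> (f a v) = a \<odot>\<^bsub>M\<^esub> \<theta> v" if "a \<in> carrier A" for a v
    unfolding f_def using bij that \<theta>c by (metis bij_betw_inv_into_right smult_closed)
  have inj: "\<theta> u = \<theta> v \<Longrightarrow> u = v" for u v using bij by (auto simp: bij_betw_def inj_on_def)
  have lin: "Vector_Spaces.linear (*s) (*s) (f a)" if "a \<in> carrier A" for a
  proof unfold_locales
    show "f a (u + v) = f a u + f a v" for u v
      by (rule inj) (simp add: f that \<theta> smult_r_distr \<theta>c)
    show "f a (c *s v) = c *s f a v" for c v
      by (rule inj) (simp add: f that \<theta> \<theta>c comm[OF that] \<iota> flip: smult_assoc)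
  qed
  show ?thesis
    unfolding rep_functor_def
  proof (intro CollectI conjI ballI allI)
    fix a b assume ab: "a \<in> carrier A" "b \<in> carrier A"
    have "f (a \<oplus>\<^bsub>A\<^esub> b) v = f a v + f b v" for v
      by (rule inj) (simp add: f ab \<theta> \<theta>c smult_l_distr)
    then show "rep_of_module A M \<theta> (a \<oplus>\<^bsub>A\<^esub> b) = rep_of_module A M \<theta> a + rep_of_module A M \<theta> b"
      using ab by (simp add: rep_of_module_def matrix_def vec_eq_iff flip: f_def)
    have "f (a \<otimes>\<^bsub>A\<^esub> b) v = f a (f b v)" for v
      by (rule inj) (simp add: f ab \<theta>c smult_assoc)
    then have "f (a \<otimes>\<^bsub>A\<^esub> b) = f a \<circ> f b" by auto
    then show "rep_of_module A M \<theta> (a \<otimes>\<^bsub>A\<^esub> b) = rep_of_module A M \<theta> a ** rep_of_module A M \<theta> b"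
      using ab matrix_compose_gen[OF lin lin] by (simp add: rep_of_module_def f_def[abs_def])
  next
    fix c
    have "f (\<iota> c) v = c *s v" for v by (rule inj) (simp add: f \<iota> \<theta>)
    then show "rep_of_module A M \<theta> (\<iota> c) = mat (id c)"
      by (simp add: rep_of_module_def \<iota> matrix_def vec_eq_iff mat_def axis_def flip: f_def)
  qed (simp add: rep_of_module_def)
qed

end

theory Submission
  imports Defs
begin

text \<open>
  Write the representation scheme near the given point, moved to the origin, as the closed subscheme
  of affine space defined by an ideal \<open>I\<close>, and choose \<open>f\<^sub>1, \<dots>, f\<^sub>c\<close> in \<open>I\<close> whose differentials at the
  origin form a basis of those of \<open>I\<close>. Let \<open>m\<close> be the ideal of the origin. By induction on \<open>p\<close>, \<open>I\<close> is
  contained in \<open>Q = (f) + m\<^sup>p\<close>: otherwise some \<open>F\<close> in \<open>I \<inter> m\<^sup>2\<close> survives modulo \<open>(f) + m\<^sup>p\<^sup>+\<^sup>1\<close>, so a linear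
  functional \<open>l\<close> that vanishes there has \<open>l F = 1\<close>. The obstruction to lifting the generic representation
  from \<open>k[T]/Q\<close> to the quotient by the kernel of \<open>l\<close> on \<open>Q\<close> is a Hochschild two-cocycle of \<open>A\<close> with values in
  the endomorphisms of \<open>M\<close>; since the second extension group vanishes, it is a coboundary and the lift
  exists. The lift changes the coordinates by elements of \<open>Q\<close>, hence changes \<open>F\<close> only by an element of
  \<open>m Q\<close>, and must kill \<open>F\<close>, a contradiction. Krull's intersection theorem then gives \<open>g\<close> with \<open>g(0) = 1\<close> and
  \<open>g I \<subseteq> (f)\<close>, so that \<open>f\<^sub>1, \<dots>, f\<^sub>c\<close> define the scheme where \<open>g\<close> is invertible.
\<close>

text \<open>Passing to a functional \<open>l\<close> replaces the kernel of the small extension by a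
  line on which \<open>m\<close> acts by zero. In a product with an element of \<open>Q\<close>,
  \<open>l\<close> sees only the value of the other factor at the origin, where the generic
  representation is the given one; so the obstruction has entries in the field and is a cocycle for
  the given action. The induction must know that \<open>I\<close> lies in \<open>Q\<close> before it
  passes to the next \<open>p\<close>: only then do the generic matrices multiply correctly up to
  elements of \<open>Q\<close>, and \<open>m Q\<close> lies in \<open>(f)\<close> plus the next
  power of \<open>m\<close>, where \<open>l\<close> vanishes. The absence of linear terms in
  \<open>F\<close> is decisive: each of its monomials is a product of two elements of
  \<open>m\<close>, so moving the variables within \<open>Q\<close> moves \<open>F\<close> only
  within \<open>m Q\<close>. The \<open>f\<close> generate \<open>I\<close> only near the origin, so
  \<open>g\<close> has to be inverted, by one further variable \<open>y\<close> and the equation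
  \<open>g y = 1\<close>. The coordinate ring is presented with a generator for every matrix entry
  of every element of \<open>A\<close>; finite generation of \<open>A\<close> supplies a chart with
  finitely many variables, where the basis theorem is available.\<close>

abbreviation lookup :: "('a \<Rightarrow>\<^sub>0 'b) \<Rightarrow> 'a \<Rightarrow> 'b::zero" where
  "lookup \<equiv> Poly_Mapping.lookup"

abbreviation keys :: "('a \<Rightarrow>\<^sub>0 'b::zero) \<Rightarrow> 'a set" where
  "keys \<equiv> Poly_Mapping.keys"

abbreviation single :: "'a \<Rightarrow> 'b \<Rightarrow> 'a \<Rightarrow>\<^sub>0 'b::zero" where
  "single \<equiv> Poly_Mapping.single"

section \<open>Noetherian subrings\<close>

text \<open>A commutative ring is a module over itself: \<open>idl.subspace\<close> means ideal and
  \<open>idl.span Z\<close> is the ideal generated by \<open>Z\<close>, so the library's calculus of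
  spans applies to ideals.\<close>

global_interpretation idl: Modules.module "(*) :: 'a::comm_ring_1 \<Rightarrow> 'a \<Rightarrow> 'a"
  by unfold_locales (auto simp: algebra_simps)

declare idl.scale_scale [simp del] \<comment> \<open>oriented against \<open>mult.assoc\<close>\<close>

text \<open>Polynomial rings in different sets of variables live in one type. With infinitely many
  variables that type is not Noetherian over a field, so the theory is relative to a carrier
  set.\<close>

definition is_subring :: "'a::comm_ring_1 set \<Rightarrow> bool" where
  "is_subring C \<longleftrightarrow> 1 \<in> C \<and> (\<forall>x\<in>C. \<forall>y\<in>C. x - y \<in> C \<and> x * y \<in> C)"

lemma is_subringD:
  assumes "is_subring C"
  shows "1 \<in> C" "0 \<in> C" "x \<in> C \<Longrightarrow> y \<in> C \<Longrightarrow> x - y \<in> C" "x \<in> C \<Longrightarrow> - x \<in> C"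
    "x \<in> C \<Longrightarrow> y \<in> C \<Longrightarrow> x + y \<in> C" "x \<in> C \<Longrightarrow> y \<in> C \<Longrightarrow> x * y \<in> C"
proof -
  show 1: "1 \<in> C" and 2: "x \<in> C \<Longrightarrow> y \<in> C \<Longrightarrow> x - y \<in> C"
    and "x \<in> C \<Longrightarrow> y \<in> C \<Longrightarrow> x * y \<in> C" for x y using assms by (auto simp: is_subring_def)
  show 3: "0 \<in> C" using 2[OF 1 1] by simp
  show 4: "x \<in> C \<Longrightarrow> - x \<in> C" for x using 2[OF 3, of x] by simp
  show "x \<in> C \<Longrightarrow> y \<in> C \<Longrightarrow> x + y \<in> C" using 2[of x "- y"] 4[of y] by simp
qed

lemma is_subring_sum:
  assumes "is_subring C" "\<And>i. i \<in> S \<Longrightarrow> f i \<in> C"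
  shows "sum f S \<in> C"
  using assms(2) by (induction S rule: infinite_finite_induct) (auto intro: is_subringD[OF assms(1)])

lemma is_subring_power: "is_subring C \<Longrightarrow> x \<in> C \<Longrightarrow> x ^ n \<in> C"
  by (induction n) (simp_all add: is_subringD)

text \<open>Unlike \<open>idl.span\<close>, whose coefficients range over the whole type, these
  combinations have coefficients in \<open>C\<close>: for \<open>Z\<close> inside a subring
  \<open>C\<close> this is the ideal of \<open>C\<close> generated by \<open>Z\<close>.\<close>

inductive_set ispan :: "'a::comm_ring_1 set \<Rightarrow> 'a set \<Rightarrow> 'a set" for C Z where
  zero: "0 \<in> ispan C Z"
| step: "q \<in> ispan C Z \<Longrightarrow> u \<in> C \<Longrightarrow> x \<in> Z \<Longrightarrow> q + u * x \<in> ispan C Z"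

lemma ispan_add: "p \<in> ispan C Z \<Longrightarrow> q \<in> ispan C Z \<Longrightarrow> p + q \<in> ispan C Z"
proof (induction p rule: ispan.induct)
  case (step p u x)
  then have "(p + q) + u * x \<in> ispan C Z" by (intro ispan.step) auto
  then show ?case by (simp add: add_ac)
qed simp

lemma ispan_scale:
  assumes C: "is_subring C" and "q \<in> ispan C Z" and u: "u \<in> C"
  shows "u * q \<in> ispan C Z"
  using assms(2)
proof (induction q rule: ispan.induct)
  case zero
  then show ?case by (simp add: ispan.zero)
next
  case (step q v x)
  have "u * q + (u * v) * x \<in> ispan C Z"
    by (rule ispan.step[OF step.IH is_subringD(6)[OF C u step.hyps(2)] step.hyps(3)])
  then show ?case by (simp add: distrib_left mult.assoc)
qed

lemma ispan_base: "is_subring C \<Longrightarrow> x \<in> Z \<Longrightarrow> x \<in> ispan C Z"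
  using ispan.step[OF ispan.zero, of 1 C x Z] by (auto dest: is_subringD(1))

lemma ispan_minimal:
  assumes "is_subring C" "Z \<subseteq> ispan C Y"
  shows "ispan C Z \<subseteq> ispan C Y"
proof
  fix q assume "q \<in> ispan C Z"
  then show "q \<in> ispan C Y"
    by (induction q rule: ispan.induct) (use assms in \<open>auto intro: ispan.zero ispan_add ispan_scale\<close>)
qed

lemma ispan_mono: "is_subring C \<Longrightarrow> Z \<subseteq> Y \<Longrightarrow> ispan C Z \<subseteq> ispan C Y"
  by (rule ispan_minimal) (auto intro: ispan_base)

lemma ispan_finite_support: "q \<in> ispan C Z \<Longrightarrow> \<exists>Y. finite Y \<and> Y \<subseteq> Z \<and> q \<in> ispan C Y"
proof (induction q rule: ispan.induct)
  case zero
  then show ?case by (intro exI[of _ "{}"]) (auto intro: ispan.zero)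
next
  case (step q u x)
  then obtain Y where "finite Y" "Y \<subseteq> Z" "q \<in> ispan C Y" by blast
  moreover have "q \<in> ispan C (insert x Y)" if "q \<in> ispan C Y" for q
    using that by (induction q rule: ispan.induct) (auto intro: ispan.intros)
  ultimately show ?case using step by (intro exI[of _ "insert x Y"]) (auto intro: ispan.step)
qed

lemma ispan_sequence:
  assumes C: "is_subring C" and "q \<in> ispan C (P ` {..<n::nat})"
  shows "\<exists>u. (\<forall>i<n. u i \<in> C) \<and> q = (\<Sum>i<n. u i * P i)"
  using assms(2)
proof (induction q rule: ispan.induct)
  case zero
  then show ?case by (intro exI[of _ "\<lambda>_. 0"]) (auto intro: is_subringD[OF C])
next
  case (step q v x)
  then obtain u j where u: "\<forall>i<n. u i \<in> C" "q = (\<Sum>i<n. u i * P i)" and j: "j < n" "x = P j" by blast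
  have "(\<Sum>i<n. (u(j := u j + v)) i * P i) = (\<Sum>i<n. u i * P i + (if i = j then v * P j else 0))"
    by (rule sum.cong) (auto simp: algebra_simps)
  then have "q + v * x = (\<Sum>i<n. (u(j := u j + v)) i * P i)"
    using u j by (simp add: sum.distrib)
  then show ?case using u step j by (intro exI[of _ "u(j := u j + v)"]) (auto intro: is_subringD[OF C])
qed

text \<open>The ascending chain condition, phrased for sequences: some term is a combination of its
  predecessors. This is the form that the basis theorem and Krull's theorem consume
  directly.\<close>

definition noetherian :: "'a::comm_ring_1 set \<Rightarrow> bool" where
  "noetherian C \<longleftrightarrow> (\<forall>P::nat \<Rightarrow> 'a. (\<forall>n. P n \<in> C) \<longrightarrow> (\<exists>n. P n \<in> ispan C (P ` {..<n})))"

lemma noetherian_image: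
  assumes "noetherian C" and "\<And>x y. \<phi> (x + y) = \<phi> x + \<phi> y" "\<And>x y. \<phi> (x * y) = \<phi> x * \<phi> y"
  shows "noetherian (\<phi> ` C)"
  unfolding noetherian_def
proof (intro allI impI)
  fix P :: "nat \<Rightarrow> _" assume "\<forall>n. P n \<in> \<phi> ` C"
  then have "\<forall>n. \<exists>q. q \<in> C \<and> \<phi> q = P n" by (metis imageE)
  then obtain Q where Q: "\<And>n. Q n \<in> C" "\<And>n. \<phi> (Q n) = P n" by metis
  then obtain n where "Q n \<in> ispan C (Q ` {..<n})" using assms(1) unfolding noetherian_def by blast
  moreover have "\<phi> q \<in> ispan (\<phi> ` C) (P ` {..<n})" if "q \<in> ispan C (Q ` {..<n})" for q
    using that
  proof (induction q rule: ispan.induct)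
    case zero
    have "\<phi> 0 = 0" using assms(2)[of 0 0] by simp
    then show ?case by (simp add: ispan.zero)
  next
    case (step q u x)
    then show ?case by (auto simp: assms Q intro!: ispan.step)
  qed
  ultimately show "\<exists>n. P n \<in> ispan (\<phi> ` C) (P ` {..<n})" using Q(2) by metis
qed

lemma noetherian_field:
  assumes "\<And>x. x \<in> C \<Longrightarrow> x \<noteq> 0 \<Longrightarrow> \<exists>y\<in>C. y * x = 1" and C: "is_subring C"
  shows "noetherian C"
  unfolding noetherian_def
proof (intro allI impI)
  fix P :: "nat \<Rightarrow> 'a" assume P: "\<forall>n. P n \<in> C"
  show "\<exists>n. P n \<in> ispan C (P ` {..<n})"
  proof (cases "P 0 = 0")
    case True
    then show ?thesis by (intro exI[of _ 0]) (simp add: ispan.zero)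
  next
    case False
    then obtain y where y: "y \<in> C" "y * P 0 = 1" using assms(1) P by blast
    have "0 + (P 1 * y) * P 0 \<in> ispan C (P ` {..<1})"
      by (rule ispan.step) (use y P in \<open>auto intro: ispan.zero is_subringD[OF C]\<close>)
    then show ?thesis using y by (intro exI[of _ 1]) (simp add: mult.assoc)
  qed
qed

lemma choose_new_elements:
  assumes new: "\<And>F. finite F \<Longrightarrow> F \<subseteq> I \<Longrightarrow> \<exists>q\<in>I. R F q"
  shows "\<exists>f :: nat \<Rightarrow> 'a. \<forall>n. f n \<in> I \<and> R (f ` {..<n}) (f n)"
proof -
  \<comment> \<open>The implication makes a choice possible for every \<open>f\<close>, as
    \<open>dependent_wf_choice\<close> requires; its premise is recovered afterwards by strong
    induction.\<close>
  define Q where "Q f n q \<longleftrightarrow> (\<forall>m<n. f m \<in> I) \<longrightarrow> q \<in> I \<and> R (f ` {..<n}) q" for f :: "nat \<Rightarrow> 'a" and n q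
  have "\<exists>f. \<forall>n. Q f n (f n)"
  proof (rule dependent_wf_choice[of less_than])
    fix f g :: "nat \<Rightarrow> 'a" and n r assume "\<And>z. (z, n) \<in> less_than \<Longrightarrow> f z = g z"
    then have "f ` {..<n} = g ` {..<n}" and "(\<forall>m<n. f m \<in> I) = (\<forall>m<n. g m \<in> I)" by auto
    then show "Q f n r = Q g n r" unfolding Q_def by simp
  next
    fix n and f :: "nat \<Rightarrow> 'a"
    show "\<exists>r. Q f n r"
    proof (cases "\<forall>m<n. f m \<in> I")
      case True
      then have "f ` {..<n} \<subseteq> I" by auto
      from new[OF _ this] show ?thesis by (auto simp: Q_def)
    next
      case False
      then show ?thesis unfolding Q_def by blast
    qed
  qed simp
  then obtain f where f: "\<And>n. Q f n (f n)" by blast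
  have fI: "f n \<in> I" for n by (induction n rule: less_induct) (use f in \<open>simp add: Q_def\<close>)
  moreover have "R (f ` {..<n}) (f n)" for n using f[of n] fI by (simp add: Q_def)
  ultimately show ?thesis by blast
qed

section \<open>Hilbert's basis theorem\<close>

lemma is_subring_poly:
  assumes C: "is_subring C"
  shows "is_subring {p. \<forall>i. Polynomial.coeff p i \<in> C}"
  unfolding is_subring_def
  by (auto simp: coeff_mult coeff_1 intro!: is_subring_sum[OF C] intro: is_subringD[OF C])

text \<open>From a bad sequence pick \<open>f n\<close> of least degree outside the ideal generated
  by its predecessors. Some leading coefficient is a combination of the earlier ones, and cancelling
  it leaves an element of smaller degree that is still outside, against minimality.\<close>

theorem hilbert_basis:
  fixes C :: "'a::comm_ring_1 set"
  assumes C: "is_subring C" and noeth: "noetherian C"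
  shows "noetherian {p. \<forall>i. Polynomial.coeff p i \<in> C}"
proof (rule ccontr)
  define D where "D = {p. \<forall>i. Polynomial.coeff p i \<in> C}"
  have D: "is_subring D" unfolding D_def by (rule is_subring_poly[OF C])
  assume "\<not> noetherian {p. \<forall>i. Polynomial.coeff p i \<in> C}"
  then obtain P :: "nat \<Rightarrow> 'a poly" where P: "\<And>n. P n \<in> D" "\<And>n. P n \<notin> ispan D (P ` {..<n})"
    unfolding noetherian_def D_def[symmetric] by blast
  define I where "I = ispan D (range P)"
  \<comment> \<open>A finite subset of \<open>I\<close> involves only finitely many terms of the bad
    sequence, hence misses a later one: \<open>I\<close> is not finitely generated.\<close>
  have "\<exists>q. q \<in> I - ispan D F" if F: "finite F" "F \<subseteq> I" for F
  proof -
    have "\<forall>q\<in>F. \<exists>m. q \<in> ispan D (P ` {..<m})"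
    proof
      fix q assume "q \<in> F"
      then have "q \<in> ispan D (range P)" using F(2) by (auto simp: I_def)
      from ispan_finite_support[OF this]
      obtain Y where Y: "finite Y" "Y \<subseteq> range P" "q \<in> ispan D Y" by iprover
      then obtain S where S: "finite S" "Y = P ` S" by (meson finite_subset_image)
      then obtain m where "S \<subseteq> {..<m}" by (metis finite_nat_iff_bounded)
      then have "Y \<subseteq> P ` {..<m}" using S by blast
      then show "\<exists>m. q \<in> ispan D (P ` {..<m})" using Y(3) ispan_mono[OF D] by blast
    qed
    then obtain m where m: "\<And>q. q \<in> F \<Longrightarrow> q \<in> ispan D (P ` {..<m q})" by metis
    define M where "M = Max (insert 0 (m ` F))"
    have "F \<subseteq> ispan D (P ` {..<M})"
    proof
      fix q assume q: "q \<in> F"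
      then have "m q \<le> M" using F unfolding M_def by (intro Max_ge) auto
      then have "P ` {..<m q} \<subseteq> P ` {..<M}" by auto
      then show "q \<in> ispan D (P ` {..<M})" using m[OF q] ispan_mono[OF D] by blast
    qed
    then have "ispan D F \<subseteq> ispan D (P ` {..<M})" by (rule ispan_minimal[OF D])
    then have "P M \<notin> ispan D F" using P(2)[of M] by blast
    moreover have "P M \<in> I" unfolding I_def by (rule ispan_base[OF D]) simp
    ultimately show ?thesis by blast
  qed
  note ne = this
  have new: "\<exists>q\<in>I. q \<notin> ispan D F \<and> (\<forall>r\<in>I - ispan D F. Polynomial.degree q \<le> Polynomial.degree r)"
    if F: "finite F" "F \<subseteq> I" for F
  proof -
    obtain q where "q \<in> I - ispan D F" using ne[OF F] by iprover
    from ex_has_least_nat[of "\<lambda>q. q \<in> I - ispan D F", OF this, of Polynomial.degree]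
    show ?thesis by auto
  qed
  have "\<exists>f::nat \<Rightarrow> 'a poly. \<forall>n. f n \<in> I \<and> f n \<notin> ispan D (f ` {..<n}) \<and>
      (\<forall>r\<in>I - ispan D (f ` {..<n}). Polynomial.degree (f n) \<le> Polynomial.degree r)"
    by (rule choose_new_elements[where R = "\<lambda>F q. q \<notin> ispan D F \<and>
      (\<forall>r\<in>I - ispan D F. Polynomial.degree q \<le> Polynomial.degree r)"]) (rule new)
  then obtain f :: "nat \<Rightarrow> 'a poly" where f0: "\<forall>n. f n \<in> I \<and> f n \<notin> ispan D (f ` {..<n}) \<and>
      (\<forall>r\<in>I - ispan D (f ` {..<n}). Polynomial.degree (f n) \<le> Polynomial.degree r)" ..
  have fI: "f n \<in> I" and f: "f n \<notin> ispan D (f ` {..<n})"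
    "\<And>r. r \<in> I \<Longrightarrow> r \<notin> ispan D (f ` {..<n}) \<Longrightarrow> Polynomial.degree (f n) \<le> Polynomial.degree r" for n
    using f0[rule_format, of n] by simp_all
  have "I \<subseteq> D"
  proof
    fix q assume "q \<in> I"
    then show "q \<in> D" unfolding I_def
      by (induction q rule: ispan.induct) (use P(1) in \<open>auto intro: is_subringD[OF D]\<close>)
  qed
  then have "\<And>n. Polynomial.lead_coeff (f n) \<in> C" using fI by (auto simp: D_def)
  then obtain n where "Polynomial.lead_coeff (f n) \<in> ispan C ((\<lambda>i. Polynomial.lead_coeff (f i)) ` {..<n})"
    using noeth[unfolded noetherian_def, rule_format, of "\<lambda>i. Polynomial.lead_coeff (f i)"] by auto
  from ispan_sequence[OF C this] obtain u where u: "\<And>i. i < n \<Longrightarrow> u i \<in> C"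
    "Polynomial.lead_coeff (f n) = (\<Sum>i<n. u i * Polynomial.lead_coeff (f i))" by auto
  \<comment> \<open>\<open>f n\<close> also lies outside the smaller ideal, so it was a candidate
    when \<open>f i\<close> was chosen. This makes the exponent differences below genuine.\<close>
  have mono: "Polynomial.degree (f i) \<le> Polynomial.degree (f n)" if "i < n" for i
  proof (rule f(2)[OF fI])
    show "f n \<notin> ispan D (f ` {..<i})"
      using f(1)[of n] that ispan_mono[OF D, of "f ` {..<i}" "f ` {..<n}"] by fastforce
  qed
  \<comment> \<open>The monomials shift every \<open>f i\<close> up to the degree of
    \<open>f n\<close>, so that \<open>s\<close> has the same coefficient as \<open>f n\<close> in
    that degree.\<close>
  define s where "s = (\<Sum>i<n. Polynomial.monom (u i) (Polynomial.degree (f n) - Polynomial.degree (f i)) * f i)"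
  have mD: "Polynomial.monom c d \<in> D" if "c \<in> C" for c d using that by (auto simp: D_def intro: is_subringD[OF C])
  have sp: "s \<in> ispan D (f ` {..<n})"
  proof -
    have "(\<Sum>i\<in>S. Polynomial.monom (u i) (Polynomial.degree (f n) - Polynomial.degree (f i)) * f i) \<in> ispan D (f ` {..<n})"
      if "finite S" "S \<subseteq> {..<n}" for S
      using that
    proof (induction S)
      case (insert i S)
      then have "Polynomial.monom (u i) (Polynomial.degree (f n) - Polynomial.degree (f i)) * f i \<in> ispan D (f ` {..<n})"
        by (intro ispan_scale[OF D] ispan_base[OF D] mD u) auto
      then show ?case using insert by (auto intro: ispan_add)
    qed (simp add: ispan.zero)
    then show ?thesis unfolding s_def by simp
  qed
  have neg: "-1 \<in> D" by (rule is_subringD(4)[OF D is_subringD(1)[OF D]])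
  have sI: "s \<in> I"
    using sp ispan_minimal[OF D, of "f ` {..<n}" "range P"] fI unfolding I_def by blast
  have hI: "f n - s \<in> I"
    using ispan_add[OF fI[of n, unfolded I_def] ispan_scale[OF D sI[unfolded I_def] neg]] by (simp add: I_def)
  have h: "f n - s \<notin> ispan D (f ` {..<n})"
    using f(1)[of n] ispan_add[OF _ sp, of "f n - s"] by auto
  have "Polynomial.degree s \<le> Polynomial.degree (f n)" unfolding s_def
  proof (rule degree_sum_le)
    fix i assume "i \<in> {..<n}"
    then show "Polynomial.degree (Polynomial.monom (u i) (Polynomial.degree (f n) - Polynomial.degree (f i)) * f i) \<le> Polynomial.degree (f n)"
      using mono[of i] degree_mult_le[of "Polynomial.monom (u i) (Polynomial.degree (f n) - Polynomial.degree (f i))" "f i"]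
        degree_monom_le[of "u i" "Polynomial.degree (f n) - Polynomial.degree (f i)"] by simp
  qed simp
  then have deg: "Polynomial.degree (f n - s) \<le> Polynomial.degree (f n)" by (simp add: degree_diff_le)
  have "Polynomial.coeff s (Polynomial.degree (f n)) = (\<Sum>i<n. u i * Polynomial.lead_coeff (f i))"
    unfolding s_def coeff_sum by (rule sum.cong) (use mono in \<open>auto simp: coeff_monom_mult\<close>)
  then have "Polynomial.coeff (f n - s) (Polynomial.degree (f n)) = 0" using u(2) by simp
  then have "f n - s = 0 \<or> Polynomial.degree (f n - s) < Polynomial.degree (f n)"
    using deg eq_zero_or_degree_less by blast
  then show False using h f(2)[OF hI h] by (auto simp: ispan.zero)
qed

section \<open>Polynomial substitutions\<close>

abbreviation polys :: "'v set \<Rightarrow> ('v, 'k::comm_ring_1) mpoly set" where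
  "polys V \<equiv> carrier (mpoly_ring V)"

lemma in_polys_UNIV [simp]: "p \<in> polys UNIV"
  by (simp add: mpoly_ring_def)

lemma polys_mono: "V \<subseteq> W \<Longrightarrow> polys V \<subseteq> polys W"
  by (auto simp: mpoly_ring_def)

lemma is_subring_polys: "is_subring (polys V)"
  unfolding is_subring_def using mpoly_ring_closed(1)[of 1 V]
  by (auto simp: mconst_hom intro: mpoly_ring_closed)

lemmas polys_closed = mpoly_ring_closed is_subringD[OF is_subring_polys]
  is_subring_sum[OF is_subring_polys] is_subring_power[OF is_subring_polys]

lemma mconst_uminus: "mconst (- c) = - mconst c"
  by (simp add: mconst_def single_uminus)

lemma mconst_ring_hom: "mconst \<in> ring_hom univ_ring univ_ring"
  by (auto simp: ring_hom_def univ_ring_def mconst_hom)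

definition subst :: "('v \<Rightarrow> ('w, 'k) mpoly) \<Rightarrow> ('v, 'k::comm_ring_1) mpoly \<Rightarrow> ('w, 'k) mpoly" where
  "subst = mpoly_eval mconst"

lemma subst_simps [simp]:
  "subst t (p + q) = subst t p + subst t q" "subst t (p * q) = subst t p * subst t q"
  "subst t (p - q) = subst t p - subst t q" "subst t (mvar v) = t v" "subst t (mconst c) = mconst c"
  "subst t 0 = 0" "subst t (sum h S) = (\<Sum>i\<in>S. subst t (h i))"
  unfolding subst_def
  by (simp_all add: mpoly_eval_add[OF mconst_ring_hom] mpoly_eval_mult[OF mconst_ring_hom]
      mpoly_eval_diff[OF mconst_ring_hom] mpoly_eval_mvar[OF mconst_ring_hom]
      mpoly_eval_0[OF mconst_ring_hom] mpoly_eval_sum[OF mconst_ring_hom]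
      mpoly_eval_mconst[OF mconst_ring_hom])

lemma subst_1 [simp]: "subst t 1 = 1"
  using subst_simps(5)[of t 1] by (simp only: mconst_hom)

lemma subst_in_polys:
  assumes "p \<in> polys V" "\<And>v. v \<in> V \<Longrightarrow> t v \<in> polys W"
  shows "subst t p \<in> polys W"
  using assms(1) by (induction p rule: mpoly_ring_induct) (auto simp: assms(2) intro: polys_closed)

lemma subst_cong:
  assumes "p \<in> polys V" "\<And>v. v \<in> V \<Longrightarrow> t v = s v"
  shows "subst t p = subst s p"
  using assms(1) by (induction p rule: mpoly_ring_induct) (auto simp: assms(2))

lemma subst_mvar_id [simp]: "subst mvar p = p"
proof -
  have "p \<in> polys UNIV" by simp
  then show ?thesis by (induction p rule: mpoly_ring_induct) auto
qed

lemma subst_id_on: "p \<in> polys V \<Longrightarrow> (\<And>v. v \<in> V \<Longrightarrow> t v = mvar v) \<Longrightarrow> subst t p = p"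
  using subst_cong[of p V t mvar] by simp

lemma subst_subst: "subst s (subst t p) = subst (\<lambda>v. subst s (t v)) p"
proof -
  have "p \<in> polys UNIV" by simp
  then show ?thesis by (induction p rule: mpoly_ring_induct) auto
qed

lemma hom_idl_span:
  assumes "\<And>x y. \<phi> (x + y) = \<phi> x + \<phi> y" "\<And>x y. \<phi> (x * y) = \<phi> x * \<phi> y" "q \<in> idl.span Z"
  shows "\<phi> q \<in> idl.span (\<phi> ` Z)"
  using assms(3)
proof (induction q rule: idl.span_induct_alt)
  case base
  have "\<phi> 0 = 0" using assms(1)[of 0 0] by simp
  then show ?case by (simp add: idl.span_zero)
next
  case (step c x y)
  then show ?case by (auto simp: assms intro: idl.span_add idl.span_scale idl.span_base)
qed

lemmas subst_idl_span = hom_idl_span[of "subst t" for t, OF subst_simps(1,2)]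

text \<open>Killing the variables outside \<open>V\<close> is a retraction onto the polynomials in \<open>V\<close>; it turns a
  combination with arbitrary coefficients into one with coefficients in the subring.\<close>

lemma idl_span_polys:
  assumes Z: "Z \<subseteq> polys V" and "q \<in> idl.span Z" "q \<in> polys V"
  shows "q \<in> ispan (polys V) Z"
proof -
  define r :: "('a, 'b) mpoly \<Rightarrow> ('a, 'b) mpoly" where "r = subst (\<lambda>v. if v \<in> V then mvar v else 0)"
  have r: "r p \<in> polys V" for p
    unfolding r_def by (rule subst_in_polys[of _ UNIV]) (auto intro: polys_closed)
  have id: "r p = p" if "p \<in> polys V" for p
    unfolding r_def using that by (rule subst_id_on) simp
  have "r q \<in> ispan (polys V) Z"
    using assms(2)
  proof (induction q rule: idl.span_induct_alt)
    case base
    then show ?case by (simp add: r_def ispan.zero)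
  next
    case (step c x y)
    have "r y + r c * x \<in> ispan (polys V) Z" by (rule ispan.step[OF step(2) r step(1)])
    moreover have "r (c * x + y) = r y + r c * x"
      using id[of x] step(1) Z by (auto simp: r_def)
    ultimately show ?case by simp
  qed
  then show ?thesis using id assms by simp
qed

text \<open>Connects the ideals of ring records with \<open>idl.span\<close>. The inclusion from
  right to left has content: a combination may use variables outside \<open>V\<close>, which the
  retraction behind \<open>idl_span_polys\<close> removes.\<close>

lemma genideal_mpoly_ring:
  fixes Z :: "('a, 'b::comm_ring_1) mpoly set"
  assumes "Z \<subseteq> polys V"
  shows "genideal (mpoly_ring V) Z = idl.span Z \<inter> polys V"
proof
  interpret P: cring "mpoly_ring V :: ('a, 'b) mpoly ring" by (rule cring_mpoly_ring)
  have s: "mult (mpoly_ring V) = (*)" "add (mpoly_ring V) = (+)" "\<zero>\<^bsub>mpoly_ring V\<^esub> = 0"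
    by (simp_all add: mpoly_ring_def)
  have "ideal (idl.span Z \<inter> polys V) (mpoly_ring V :: ('a, 'b) mpoly ring)"
  proof (rule idealI)
    show "subgroup (idl.span Z \<inter> polys V) (add_monoid (mpoly_ring V :: ('a, 'b) mpoly ring))"
    proof (rule group.subgroupI)
      show "group (add_monoid (mpoly_ring V :: ('a, 'b) mpoly ring))" by (rule P.add.is_group)
      show "idl.span Z \<inter> polys V \<noteq> {}" using idl.span_zero polys_closed(8) by blast
      fix a :: "('a, 'b) mpoly" assume a: "a \<in> idl.span Z \<inter> polys V"
      then have "\<ominus>\<^bsub>mpoly_ring V\<^esub> a = - a"
        by (intro P.minus_equality) (auto simp: s intro: polys_closed)
      then show "inv\<^bsub>add_monoid (mpoly_ring V)\<^esub> a \<in> idl.span Z \<inter> polys V"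
        using a by (simp add: a_inv_def idl.span_neg polys_closed)
    qed (auto simp: s intro: idl.span_add polys_closed)
  next
    fix a x :: "('a, 'b) mpoly"
    assume "a \<in> idl.span Z \<inter> polys V" "x \<in> polys V"
    then have "x * a \<in> idl.span Z \<inter> polys V" by (auto intro: idl.span_scale polys_closed)
    then show "x \<otimes>\<^bsub>mpoly_ring V\<^esub> a \<in> idl.span Z \<inter> polys V"
      "a \<otimes>\<^bsub>mpoly_ring V\<^esub> x \<in> idl.span Z \<inter> polys V" by (simp_all add: s mult.commute)
  qed (rule P.ring_axioms)
  then show "genideal (mpoly_ring V) Z \<subseteq> idl.span Z \<inter> polys V"
    using assms by (intro P.genideal_minimal) (auto intro: idl.span_base)
  interpret I: ideal "genideal (mpoly_ring V) Z" "mpoly_ring V :: ('a, 'b) mpoly ring"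
    using assms by (rule P.genideal_ideal)
  show "idl.span Z \<inter> polys V \<subseteq> genideal (mpoly_ring V) Z"
  proof
    fix q assume "q \<in> idl.span Z \<inter> polys V"
    then have "q \<in> ispan (polys V) Z" using idl_span_polys[OF assms] by blast
    then show "q \<in> genideal (mpoly_ring V) Z"
    proof (induction q rule: ispan.induct)
      case zero
      then show ?case using I.zero_closed by (simp add: s)
    next
      case (step q u x)
      then show ?case
        using I.a_closed[of q "u * x"] I.I_l_closed[of x u] P.genideal_self[OF assms] by (auto simp: s)
    qed
  qed
qed

text \<open>Evaluation at the new variable maps the univariate polynomials over
  \<open>polys V\<close> onto \<open>polys (insert v V)\<close>, and homomorphic images inherit the
  chain condition; surjectivity is enough for the induction step.\<close>

lemma noetherian_polys:
  assumes "finite V"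
  shows "noetherian (polys V :: ('v, 'k::field) mpoly set)"
  using assms
proof (induction V)
  case empty
  have c: "\<exists>c. p = mconst c" if "p \<in> polys {}" for p :: "('v, 'k) mpoly"
    using that
  proof (induction p rule: mpoly_ring_induct)
    case (add p q)
    then show ?case by (auto simp flip: mconst_hom)
  next
    case (mult p q)
    then show ?case by (auto simp flip: mconst_hom)
  qed auto
  show ?case
  proof (rule noetherian_field[OF _ is_subring_polys])
    fix x :: "('v, 'k) mpoly" assume x: "x \<in> polys {}" "x \<noteq> 0"
    then obtain a where a: "x = mconst a" using c by blast
    with x have "a \<noteq> 0" by (auto simp: mconst_hom)
    then have "mconst (1 / a) * x = 1" by (simp add: a mconst_hom flip: mconst_hom(2))
    then show "\<exists>y\<in>polys {}. y * x = 1" using mpoly_ring_closed(1) by blast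
  qed
next
  case (insert v V)
  define D :: "('v, 'k) mpoly poly set" where "D = {p. \<forall>i. Polynomial.coeff p i \<in> polys V}"
  define \<phi> :: "('v, 'k) mpoly poly \<Rightarrow> ('v, 'k) mpoly" where "\<phi> p = poly p (mvar v)" for p
  have D: "is_subring D" unfolding D_def by (rule is_subring_poly[OF is_subring_polys])
  have "noetherian (\<phi> ` D)"
    by (rule noetherian_image) (auto simp: D_def \<phi>_def hilbert_basis[OF is_subring_polys insert.IH])
  moreover have "\<phi> ` D = polys (insert v V)"
  proof (intro equalityI subsetI)
    fix q assume "q \<in> \<phi> ` D"
    then obtain p where p: "\<And>i. Polynomial.coeff p i \<in> polys V" "q = poly p (mvar v)"
      by (auto simp: D_def \<phi>_def)
    have "Polynomial.coeff p i \<in> polys (insert v V)" for i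
      using p(1) polys_mono[of V "insert v V"] by blast
    then show "q \<in> polys (insert v V)" unfolding p(2) poly_altdef
      by (auto intro!: polys_closed)
  next
    fix q :: "('v, 'k) mpoly" assume "q \<in> polys (insert v V)"
    then show "q \<in> \<phi> ` D"
    proof (induction q rule: mpoly_ring_induct)
      case (mconst c)
      then show ?case
        by (intro image_eqI[of _ _ "[:mconst c:]"]) (auto simp: \<phi>_def D_def coeff_pCons split: nat.split intro: polys_closed)
    next
      case (mvar u)
      show ?case
      proof (cases "u = v")
        case True
        then show ?thesis
          by (intro image_eqI[of _ _ "[:0, 1:]"]) (auto simp: \<phi>_def D_def coeff_pCons split: nat.split intro: polys_closed)
      next
        case False
        then show ?thesis using mvar
          by (intro image_eqI[of _ _ "[:mvar u:]"]) (auto simp: \<phi>_def D_def coeff_pCons split: nat.split intro: polys_closed)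
      qed
    next
      case (add p q)
      then obtain p' q' where "p' \<in> D" "q' \<in> D" "p = \<phi> p'" "q = \<phi> q'" by blast
      then show ?case by (intro image_eqI[of _ _ "p' + q'"]) (auto simp: \<phi>_def intro: is_subringD[OF D])
    next
      case (mult p q)
      then obtain p' q' where "p' \<in> D" "q' \<in> D" "p = \<phi> p'" "q = \<phi> q'" by blast
      then show ?case by (intro image_eqI[of _ _ "p' * q'"]) (auto simp: \<phi>_def intro: is_subringD[OF D])
    qed
  qed
  ultimately show ?case by simp
qed

text \<open>Otherwise one could adjoin an element not yet generated again and again, which gives a
  sequence violating the chain condition.\<close>

lemma noetherian_finite_subset:
  assumes C: "is_subring C" "noetherian C" and I: "I \<subseteq> C"
  shows "\<exists>G. finite G \<and> G \<subseteq> I \<and> I \<subseteq> ispan C G"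
proof (rule ccontr)
  assume "\<not> ?thesis"
  then have new: "\<exists>q\<in>I. q \<notin> ispan C G" if "finite G" "G \<subseteq> I" for G
    using that by blast
  have "\<exists>P::nat \<Rightarrow> 'a. \<forall>n. P n \<in> I \<and> P n \<notin> ispan C (P ` {..<n})"
    by (rule choose_new_elements[where R = "\<lambda>G q. q \<notin> ispan C G"]) (rule new)
  then obtain P :: "nat \<Rightarrow> 'a" where "\<forall>n. P n \<in> I \<and> P n \<notin> ispan C (P ` {..<n})" ..
  then show False using C(2) I unfolding noetherian_def by blast
qed

section \<open>The order of vanishing at the origin\<close>

definition mdeg :: "('v \<Rightarrow>\<^sub>0 nat) \<Rightarrow> nat" where
  "mdeg m = (\<Sum>v\<in>keys m. lookup m v)"

lemma mdeg_superset:
  "finite S \<Longrightarrow> keys m \<subseteq> S \<Longrightarrow> mdeg m = (\<Sum>v\<in>S. lookup m v)"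
  unfolding mdeg_def by (rule sum.mono_neutral_left) (auto simp: in_keys_iff)

lemma mdeg_add [simp]: "mdeg (m + m') = mdeg m + mdeg m'"
proof -
  let ?S = "keys m \<union> keys m'"
  have "mdeg (m + m') = (\<Sum>v\<in>?S. lookup (m + m') v)"
    by (rule mdeg_superset) (use keys_add[of m m'] in auto)
  then show ?thesis by (simp add: lookup_add sum.distrib mdeg_superset[of ?S])
qed

lemma mdeg_0 [simp]: "mdeg 0 = 0"
  by (simp add: mdeg_def)

lemma mdeg_single [simp]: "mdeg (single v e) = e"
  by (cases "e = 0") (simp_all add: mdeg_def)

lemma mdeg_eq_0_iff [simp]: "mdeg m = 0 \<longleftrightarrow> m = 0"
proof
  assume "mdeg m = 0"
  then have "lookup m v = 0" for v
    by (cases "v \<in> keys m") (auto simp: mdeg_def in_keys_iff)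
  then show "m = 0" by (intro poly_mapping_eqI) simp
qed simp

lemma split_off_variable:
  assumes "v \<in> keys m"
  shows "m = (m - single v 1) + single v (1::nat)"
  using assms by (intro poly_mapping_eqI) (auto simp: lookup_add lookup_minus lookup_single in_keys_iff when_def)

lemma single_eq_mconst_mult: "single m c = mconst c * single m 1"
  by (simp add: mconst_def mult_single)

lemma mpoly_expansion:
  "p = (\<Sum>m\<in>keys p. mconst (lookup p m) * single m 1)"
  using poly_mapping_sum_monomials[of p] by (simp flip: single_eq_mconst_mult)

text \<open>The power with exponent \<open>d\<close> of the ideal of the origin, described by its
  monomials.\<close>

definition ordge :: "nat \<Rightarrow> ('v, 'k::comm_ring_1) mpoly set" where
  "ordge d = {p. \<forall>m\<in>keys p. d \<le> mdeg m}"

lemma ordge_0 [simp]: "ordge 0 = UNIV"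
  by (simp add: ordge_def)

lemma ordge_antimono: "d \<le> e \<Longrightarrow> ordge e \<subseteq> ordge d"
  by (auto simp: ordge_def)

lemma ordge_mult:
  assumes "p \<in> ordge d" "q \<in> ordge e"
  shows "p * q \<in> ordge (d + e)"
  unfolding ordge_def
proof (intro CollectI ballI)
  fix m assume "m \<in> keys (p * q)"
  then obtain a b where "m = a + b" "a \<in> keys p" "b \<in> keys q"
    using keys_mult[of p q] by blast
  then show "d + e \<le> mdeg m" using assms by (auto simp: ordge_def intro: add_mono)
qed

lemma subspace_ordge: "idl.subspace (ordge d)"
proof (rule idl.subspaceI)
  show "p + q \<in> ordge d" if "p \<in> ordge d" "q \<in> ordge d" for p q :: "('a, 'b) mpoly"
    using that keys_add[of p q] by (auto simp: ordge_def)
  show "c * p \<in> ordge d" if "p \<in> ordge d" for c p :: "('a, 'b) mpoly"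
    using ordge_mult[of c 0 p d] that by simp
qed (simp add: ordge_def)

lemmas ordge_closed = idl.subspace_0[OF subspace_ordge] idl.subspace_add[OF subspace_ordge]
  idl.subspace_scale[OF subspace_ordge] idl.subspace_diff[OF subspace_ordge]
  idl.subspace_sum[OF subspace_ordge] idl.subspace_neg[OF subspace_ordge]

lemma single_in_ordge: "d \<le> mdeg m \<Longrightarrow> single m c \<in> ordge d"
  by (simp add: ordge_def)

lemma mvar_in_ordge [simp]: "mvar v \<in> ordge (Suc 0)"
  by (simp add: mvar_def single_in_ordge)

lemma in_ordge_1_iff: "p \<in> ordge (Suc 0) \<longleftrightarrow> lookup p 0 = 0"
proof -
  have "Suc 0 \<le> mdeg m \<longleftrightarrow> m \<noteq> 0" for m :: "'a \<Rightarrow>\<^sub>0 nat"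
    by (simp add: Suc_le_eq neq0_conv[symmetric] del: neq0_conv)
  then show ?thesis unfolding ordge_def by (auto simp: in_keys_iff)
qed

lemma id_ring_hom: "id \<in> ring_hom univ_ring univ_ring"
  by (auto simp: ring_hom_def)

lemma mpoly_eval_zero: "mpoly_eval id (\<lambda>_. 0) p = lookup p 0"
  for p :: "('v, 'k::comm_ring_1) mpoly"
proof -
  have "mon_eval (\<lambda>_. 0 :: 'k) m = (if m = 0 then 1 else 0)" for m :: "'v \<Rightarrow>\<^sub>0 nat"
  proof (cases "m = 0")
    case False
    then obtain v where v: "v \<in> keys m" by fastforce
    then have "(0 :: 'k) ^ lookup m v = 0" by (simp add: in_keys_iff zero_power)
    then have "mon_eval (\<lambda>_. 0 :: 'k) m = 0" unfolding mon_eval_def by (intro prod_zero bexI[OF _ v]) auto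
    then show ?thesis using False by simp
  qed simp
  note mon = this
  have "mpoly_eval id (\<lambda>_. 0) p = (\<Sum>m\<in>keys p. if m = 0 then lookup p m else 0)"
    unfolding mpoly_eval_def id_apply by (rule sum.cong) (simp_all only: mon split: if_split, auto)
  then show ?thesis by (simp add: in_keys_iff)
qed

lemma lookup_0_mult: "lookup (p * q) 0 = lookup p 0 * lookup q 0"
  for p q :: "('v, 'k::comm_ring_1) mpoly"
  using mpoly_eval_mult[OF id_ring_hom, of "\<lambda>_. 0" p q] by (simp add: mpoly_eval_zero)

lemma lookup_0_mconst [simp]: "lookup (mconst c) 0 = c"
  by (simp add: mconst_def)

lemma mon_eval_in_ordge:
  fixes t :: "'v \<Rightarrow> ('w, 'k::comm_ring_1) mpoly"
  assumes "\<And>v. t v \<in> ordge (Suc 0)"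
  shows "mon_eval t m \<in> ordge (mdeg m)"
proof -
  have pow: "t v ^ e \<in> ordge e" for v e
    by (induction e) (use ordge_mult[OF assms] in auto)
  have "(\<Prod>v\<in>S. t v ^ e v) \<in> ordge (\<Sum>v\<in>S. e v)" for S e
    by (induction S rule: infinite_finite_induct) (use ordge_mult[OF pow] in auto)
  then show ?thesis unfolding mon_eval_def mdeg_def .
qed

lemma subst_in_ordge:
  assumes "\<And>v. t v \<in> ordge (Suc 0)" "p \<in> ordge d"
  shows "subst t p \<in> ordge d"
  unfolding subst_def mpoly_eval_def
proof (intro ordge_closed)
  fix m assume "m \<in> keys p"
  then have "d \<le> mdeg m" using assms(2) by (auto simp: ordge_def)
  then show "mon_eval t m \<in> ordge d"
    using ordge_antimono mon_eval_in_ordge[of t m, OF assms(1)] by blast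
qed

section \<open>Krull's intersection theorem\<close>

text \<open>After Perdry: write the element as a form of degree \<open>p\<close> in new variables for every \<open>p\<close>; the
  basis theorem expresses one of these forms through the previous ones. The map
  \<open>rees_map\<close> replaces the new variable \<open>N + j\<close> by \<open>T\<^sub>j y\<close>, so that forms of degree \<open>p\<close> become multiples
  of \<open>y\<^sup>p\<close>.\<close>

definition rees_map :: "nat \<Rightarrow> (nat, 'k::comm_ring_1) mpoly \<Rightarrow> (nat, 'k) mpoly poly" where
  "rees_map N = mpoly_eval (\<lambda>c. [:mconst c:]) (\<lambda>j. if j < N then [:mvar j:] else [:0, mvar (j - N):])"

lemma const_poly_ring_hom: "(\<lambda>c. [:mconst c:]) \<in> ring_hom univ_ring univ_ring"
  by (auto simp: ring_hom_def univ_ring_def mconst_hom)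

lemma rees_map_simps [simp]:
  "rees_map N (p + q) = rees_map N p + rees_map N q" "rees_map N (p * q) = rees_map N p * rees_map N q"
  "rees_map N (mvar j) = (if j < N then [:mvar j:] else [:0, mvar (j - N):])"
  "rees_map N (mconst c) = [:mconst c:]" "rees_map N 0 = 0" "rees_map N (sum h S) = (\<Sum>i\<in>S. rees_map N (h i))"
  unfolding rees_map_def
  by (simp_all add: mpoly_eval_add[OF const_poly_ring_hom] mpoly_eval_mult[OF const_poly_ring_hom]
      mpoly_eval_mvar[OF const_poly_ring_hom] mpoly_eval_0[OF const_poly_ring_hom]
      mpoly_eval_sum[OF const_poly_ring_hom] mpoly_eval_mconst[OF const_poly_ring_hom])

text \<open>The image of \<open>rees_map\<close> lies in the Rees algebra of the ideal of the
  origin: the coefficient of the power \<open>d\<close> of the grading variable has order at least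
  \<open>d\<close>.\<close>

lemma coeff_rees_map: "Polynomial.coeff (rees_map N p) d \<in> ordge d"
proof -
  have "p \<in> polys UNIV" by simp
  then show ?thesis
  proof (induction p arbitrary: d rule: mpoly_ring_induct)
    case (mconst c)
    then show ?case by (cases d) (auto simp: coeff_pCons ordge_closed split: nat.split)
  next
    case (mvar v)
    then show ?case by (auto simp: coeff_pCons ordge_closed split: nat.split)
  next
    case (add p q)
    then show ?case by (auto intro: ordge_closed)
  next
    case (mult p q)
    show ?case unfolding rees_map_simps coeff_mult
    proof (rule ordge_closed)
      fix i assume "i \<in> {..d}"
      then show "Polynomial.coeff (rees_map N p) i * Polynomial.coeff (rees_map N q) (d - i) \<in> ordge d"
        using ordge_mult[OF mult(3)[of i] mult(4)[of "d - i"]] by simp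
    qed
  qed
qed

lemma rees_map_id: "p \<in> polys {..<N} \<Longrightarrow> rees_map N p = [:p:]"
  by (induction p rule: mpoly_ring_induct) (auto simp: mult.commute)

text \<open>A monomial of degree at least \<open>p\<close> contains \<open>p\<close> variables,
  counted with multiplicity. Replacing each such \<open>mvar j\<close> by the new variable
  \<open>mvar (N + j)\<close> produces the required power of the grading variable.\<close>

lemma rees_map_onto_monomial:
  assumes "keys m \<subseteq> {..<N}" "p \<le> mdeg m"
  shows "\<exists>P\<in>polys {..<2*N}. rees_map N P = Polynomial.monom (single m (1::'k::comm_ring_1)) p"
  using assms
proof (induction p arbitrary: m)
  case 0
  then have "(single m 1 :: (nat, 'k) mpoly) \<in> polys {..<N}" by (simp add: mpoly_ring_def)
  then show ?case using polys_mono[of "{..<N}" "{..<2*N}"]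
    by (intro bexI[of _ "single m 1"]) (auto simp: rees_map_id monom_0)
next
  case (Suc p)
  then have "keys m \<noteq> {}" by (auto simp: mdeg_def)
  then obtain j where j: "j \<in> keys m" by blast
  define m' where "m' = m - single j 1"
  have m: "m = m' + single j 1" unfolding m'_def by (rule split_off_variable[OF j])
  have "keys m' \<subseteq> keys m"
    by (auto simp: m'_def in_keys_iff lookup_minus)
  moreover have "p \<le> mdeg m'" using Suc.prems(2) by (simp add: m)
  ultimately obtain P where P: "P \<in> polys {..<2*N}"
    "rees_map N P = Polynomial.monom (single m' (1::'k)) p" using Suc.IH Suc.prems by blast
  have "j < N" using j Suc.prems by auto
  then have "P * mvar (N + j) \<in> polys {..<2*N}" using P by (auto intro!: polys_closed)
  moreover have "[:0, mvar j:] = Polynomial.monom (mvar j :: (nat, 'k) mpoly) 1"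
    by (simp add: monom_Suc monom_0)
  then have "rees_map N (P * mvar (N + j)) = Polynomial.monom (single m (1::'k)) (Suc p)"
    by (simp add: P mult_monom) (simp add: m mvar_def mult_single)
  ultimately show ?case by blast
qed

lemma rees_map_onto:
  assumes "F \<in> polys {..<N}" "F \<in> ordge p"
  shows "\<exists>P\<in>polys {..<2*N}. rees_map N P = Polynomial.monom F p"
proof -
  have "\<forall>m\<in>keys F. \<exists>P\<in>polys {..<2*N}. rees_map N P = Polynomial.monom (single m (1::'a)) p"
    using assms by (intro ballI rees_map_onto_monomial) (auto simp: mpoly_ring_def ordge_def)
  then obtain P where P: "\<And>m. m \<in> keys F \<Longrightarrow> P m \<in> polys {..<2*N}"
    "\<And>m. m \<in> keys F \<Longrightarrow> rees_map N (P m) = Polynomial.monom (single m (1::'a)) p"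
    by metis
  have "rees_map N (\<Sum>m\<in>keys F. mconst (lookup F m) * P m) =
      Polynomial.monom (\<Sum>m\<in>keys F. mconst (lookup F m) * single m 1) p"
    by (simp add: P smult_monom monom_sum)
  then show ?thesis using P(1) mpoly_expansion[of F]
    by (intro bexI[of _ "\<Sum>m\<in>keys F. mconst (lookup F m) * P m"])
      (auto intro: polys_closed)
qed

theorem krull_intersection:
  fixes F :: "(nat, 'k::field) mpoly"
  assumes F: "F \<in> polys {..<N}" and Z: "Z \<subseteq> polys {..<N}"
    and ord: "\<And>p. \<exists>u\<in>idl.span Z. F - u \<in> ordge p"
  shows "\<exists>g\<in>polys {..<N}. lookup g 0 = 1 \<and> g * F \<in> idl.span Z"
proof -
  \<comment> \<open>The combinations supplied by \<open>ord\<close> may involve variables beyond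
    \<open>N\<close>. This retraction removes them, fixes \<open>F\<close> and \<open>Z\<close>, and
    does not lower the order of vanishing.\<close>
  define r :: "(nat, 'k) mpoly \<Rightarrow> (nat, 'k) mpoly" where "r = subst (\<lambda>v. if v < N then mvar v else 0)"
  have r: "r p \<in> polys {..<N}" for p
    unfolding r_def by (rule subst_in_polys[of _ UNIV]) (auto intro: polys_closed)
  have r_id: "r p = p" if "p \<in> polys {..<N}" for p
    unfolding r_def using that by (rule subst_id_on) simp
  have "r ` Z = Z" using r_id Z by force
  have "\<exists>v P. v \<in> idl.span Z \<and> P \<in> polys {..<2*N} \<and> rees_map N P = Polynomial.monom (F - v) p" for p
  proof -
    obtain u where u: "u \<in> idl.span Z" "F - u \<in> ordge p" using ord by blast
    have "r u \<in> idl.span Z"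
      using subst_idl_span[OF u(1), of "\<lambda>v. if v < N then mvar v else 0"] \<open>r ` Z = Z\<close> by (simp add: r_def)
    moreover have "r (F - u) \<in> ordge p"
      unfolding r_def by (rule subst_in_ordge[OF _ u(2)]) (auto simp: ordge_closed)
    moreover have "r (F - u) = F - r u" using r_id[OF F] by (simp add: r_def)
    ultimately show ?thesis using rees_map_onto[of "F - r u" N p] r F by (metis polys_closed(4))
  qed
  then obtain v P where v: "\<And>p. v p \<in> idl.span Z" and P: "\<And>p. P p \<in> polys {..<2*N}"
    "\<And>p. rees_map N (P p) = Polynomial.monom (F - v p) p" by metis
  obtain n where "P n \<in> ispan (polys {..<2*N}) (P ` {..<n})"
    using noetherian_polys[of "{..<2*N}", where ?'k = 'k] P(1) unfolding noetherian_def by blast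
  from ispan_sequence[OF is_subring_polys this] obtain u where
    u: "P n = (\<Sum>i<n. u i * P i)" by blast
  \<comment> \<open>Comparing coefficients of the power \<open>n\<close> of the grading variable in
    \<open>P n = (\<Sum>i<n. u i * P i)\<close> leaves one coefficient of each \<open>u i\<close>.
    Its degree \<open>n - i\<close> is positive, so it vanishes at the origin; this is what makes
    the resulting factor \<open>1 - (\<Sum>i<n. q i)\<close> equal to 1 there.\<close>
  define q where "q i = Polynomial.coeff (rees_map N (u i)) (n - i)" for i
  have q: "q i \<in> ordge (Suc 0)" if "i < n" for i
    unfolding q_def by (rule subsetD[OF ordge_antimono coeff_rees_map]) (use that in simp)
  have "F - v n = Polynomial.coeff (rees_map N (P n)) n" by (simp add: P)
  also have "\<dots> = (\<Sum>i<n. Polynomial.coeff (Polynomial.monom (F - v i) i * rees_map N (u i)) n)"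
    by (simp add: u coeff_sum P mult.commute)
  also have "\<dots> = (\<Sum>i<n. (F - v i) * q i)"
    by (rule sum.cong) (auto simp: coeff_monom_mult q_def)
  finally have "F - (\<Sum>i<n. q i * F) = v n - (\<Sum>i<n. q i * v i)"
    by (simp add: algebra_simps sum_subtractf)
  moreover have "v n - (\<Sum>i<n. q i * v i) \<in> idl.span Z"
    by (intro idl.span_diff idl.span_sum idl.span_scale v)
  ultimately have g: "(1 - (\<Sum>i<n. q i)) * F \<in> idl.span Z"
    by (simp add: left_diff_distrib sum_distrib_right)
  have "(\<Sum>i<n. q i) \<in> ordge (Suc 0)" using q by (auto intro: ordge_closed)
  then have q1: "r (\<Sum>i<n. q i) \<in> ordge (Suc 0)"
    unfolding r_def by (rule subst_in_ordge[rotated]) (auto simp: ordge_closed)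
  have "r ((1 - (\<Sum>i<n. q i)) * F) \<in> idl.span Z"
    using subst_idl_span[OF g, of "\<lambda>v. if v < N then mvar v else 0"] \<open>r ` Z = Z\<close> by (simp add: r_def)
  moreover have "r ((1 - (\<Sum>i<n. q i)) * F) = (1 - r (\<Sum>i<n. q i)) * F"
    using r_id[OF F] by (simp add: r_def)
  ultimately show ?thesis using q1 r
    by (intro bexI[of _ "1 - r (\<Sum>i<n. q i)"]) (auto simp: lookup_minus in_ordge_1_iff intro: polys_closed)
qed

section \<open>Linear functionals and projections\<close>

lemma (in Vector_Spaces.vector_space) separating_functional:
  assumes W: "subspace W" and x: "x \<notin> W"
  obtains f where "Vector_Spaces.linear scale (*) f" "\<And>w. w \<in> W \<Longrightarrow> f w = 0" "f x = 1"
proof -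
  interpret vector_space_pair scale "(*) :: 'a \<Rightarrow> 'a \<Rightarrow> 'a"
    by unfold_locales (auto simp: algebra_simps)
  obtain B where B: "B \<subseteq> W" "independent B" "W \<subseteq> span B"
    using maximal_independent_subset by blast
  have span: "span B = W" using B W span_minimal by blast
  then have "independent (insert x B)" using B x by (simp add: independent_insertI)
  then obtain f where f: "Vector_Spaces.linear scale (*) f"
    "\<And>b. b \<in> insert x B \<Longrightarrow> f b = (if b = x then 1 else 0)"
    using linear_independent_extend[of "insert x B" "\<lambda>b. if b = x then 1 else 0"] by blast
  interpret f: Vector_Spaces.linear scale "(*)" f by fact
  have "f w = 0" if "w \<in> W" for w
    using that unfolding span[symmetric]
  proof (induction w rule: span_induct_alt)
    case (step c b w)
    then show ?case using f(2)[of b] x B(1) by (auto simp: f.add f.scale)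
  qed (simp add: f.zero)
  then show ?thesis using that f by simp
qed

text \<open>Extend a basis of \<open>W\<close> to the whole space and kill the part in
  \<open>W\<close>. The map \<open>f\<close> chooses representatives modulo \<open>W\<close>
  linearly, which later lifts the generic representation linearly.\<close>

lemma (in Vector_Spaces.vector_space) projection_along:
  assumes W: "subspace W"
  obtains f where "Vector_Spaces.linear scale scale f" "\<And>w. w \<in> W \<Longrightarrow> f w = 0" "\<And>x. x - f x \<in> W"
proof -
  interpret vector_space_pair scale scale ..
  obtain B where B: "B \<subseteq> W" "independent B" "W \<subseteq> span B"
    using maximal_independent_subset by blast
  have span: "span B = W" using B W span_minimal by blast
  obtain B' where B': "B \<subseteq> B'" "independent B'" "UNIV \<subseteq> span B'"
    by (rule maximal_independent_subset_extend[OF _ B(2), of UNIV]) auto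
  from linear_independent_extend[OF B'(2), of "\<lambda>b. if b \<in> B then 0 else b"]
  obtain f where f: "Vector_Spaces.linear scale scale f" "\<forall>b\<in>B'. f b = (if b \<in> B then 0 else b)"
    by (elim exE conjE)
  interpret f: Vector_Spaces.linear scale scale f by fact
  have "f w = 0" if "w \<in> W" for w
    using that unfolding span[symmetric]
  proof (induction w rule: span_induct_alt)
    case (step c b w)
    then have "f b = 0" using f(2) B'(1) by auto
    with step show ?case by (simp add: f.add f.scale)
  qed (simp add: f.zero)
  moreover have "x - f x \<in> W" for x
  proof -
    have "x \<in> span B'" using B'(3) by blast
    then show ?thesis
    proof (induction x rule: span_induct_alt)
      case base
      then show ?case using W by (simp add: f.zero subspace_0)
    next
      case (step c b x)
      have "b - f b \<in> W" using f(2) step(1) B(1) W by (auto simp: subspace_0)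
      then have "scale c (b - f b) + (x - f x) \<in> W" using W step by (intro subspace_add subspace_scale)
      then show ?case by (simp add: f.add f.scale algebra_simps)
    qed
  qed
  ultimately show ?thesis using that f(1) by blast
qed

lemma vector_space_mpoly: "Vector_Spaces.vector_space (\<lambda>c p. mconst c * p :: ('v, 'k::field) mpoly)"
  by unfold_locales (simp_all add: mconst_hom algebra_simps)

section \<open>A lifting criterion for smoothness\<close>

lemma subst_congruent:
  assumes "idl.subspace Q" "\<And>v. t v - mvar v \<in> Q"
  shows "subst t p - p \<in> Q"
proof -
  have "p \<in> polys UNIV" by simp
  then show ?thesis
  proof (induction p rule: mpoly_ring_induct)
    case (mconst c)
    then show ?case using assms by (simp add: idl.subspace_0)
  next
    case (add p q)
    then have "(subst t p - p) + (subst t q - q) \<in> Q" using assms(1) by (intro idl.subspace_add)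
    then show ?case by (simp add: algebra_simps)
  next
    case (mult p q)
    then have "subst t q * (subst t p - p) + p * (subst t q - q) \<in> Q"
      using assms(1) by (intro idl.subspace_add idl.subspace_scale)
    then show ?case by (simp add: algebra_simps)
  qed (simp add: assms)
qed

text \<open>The lifting hypothesis says that a point of the closed subscheme defined by \<open>I\<close> with values in
  the local algebra \<open>k[T]/Q\<close> lifts along the small extension whose kernel is \<open>Q/(Q \<inter> ker l)\<close>, a line.\<close>

theorem smooth_equations:
  fixes I :: "(nat, 'k::field) mpoly set"
  assumes I: "I \<subseteq> polys {..<N}" "0 \<in> I" "\<And>p q. p \<in> I \<Longrightarrow> q \<in> I \<Longrightarrow> p + q \<in> I"
      "\<And>u p. u \<in> polys {..<N} \<Longrightarrow> p \<in> I \<Longrightarrow> u * p \<in> I"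
    and I1: "I \<subseteq> ordge (Suc 0)"
    and lift: "\<And>Q (l :: (nat, 'k) mpoly \<Rightarrow> 'k) F. idl.subspace Q \<Longrightarrow> I \<subseteq> Q \<Longrightarrow> Q \<subseteq> ordge (Suc 0) \<Longrightarrow>
      (\<And>p q. l (p + q) = l p + l q) \<Longrightarrow> (\<And>c p. l (mconst c * p) = c * l p) \<Longrightarrow>
      (\<And>u v. u \<in> ordge (Suc 0) \<Longrightarrow> v \<in> Q \<Longrightarrow> l (u * v) = 0) \<Longrightarrow> F \<in> I \<Longrightarrow> l F = 1 \<Longrightarrow>
      \<exists>t. (\<forall>j. t j - mvar j \<in> Q) \<and> (\<forall>G\<in>I. l (subst t G) = 0)"
  obtains c f g where "\<And>i. i < c \<Longrightarrow> f i \<in> I"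
    "\<And>w. (\<forall>j<N. (\<Sum>i<c. w i * lookup (f i) (single j 1)) = 0) \<Longrightarrow> (\<forall>i<c. w i = 0)"
    "g \<in> polys {..<N}" "lookup g 0 = 1" "\<And>F. F \<in> I \<Longrightarrow> g * F \<in> idl.span (f ` {..<c::nat})"
proof -
  interpret V: Vector_Spaces.vector_space "\<lambda>c p. mconst c * p :: (nat, 'k) mpoly" by (rule vector_space_mpoly)
  note V.scale_scale [simp del]
  \<comment> \<open>The differential at the origin, kept as a linear form inside the polynomials so
    that differentials and equations share one vector space.\<close>
  define lin :: "(nat, 'k) mpoly \<Rightarrow> (nat, 'k) mpoly" where
    "lin F = (\<Sum>j<N. mconst (lookup F (single j 1)) * mvar j)" for F
  have lookup_mconst_mult: "lookup (mconst c * p) m = c * lookup p m" for c m and p :: "(nat, 'k) mpoly"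
  proof -
    have "mconst c * p = Poly_Mapping.map ((*) c) p" by (simp add: mconst_def mult_map_scale_conv_mult)
    then show ?thesis by (simp add: Poly_Mapping.map.rep_eq when_def)
  qed
  have lin_add: "lin (p + q) = lin p + lin q" for p q
    by (simp add: lin_def lookup_add mconst_hom algebra_simps sum.distrib)
  have lin_scale: "lin (mconst c * p) = mconst c * lin p" for c p
    by (simp add: lin_def lookup_mconst_mult mconst_hom sum_distrib_left mult.assoc)
  have lin_sum: "lin (\<Sum>i\<in>S. mconst (w i) * h i) = (\<Sum>i\<in>S. mconst (w i) * lin (h i))" for S w and h :: "nat \<Rightarrow> _"
  proof (induction S rule: infinite_finite_induct)
    case (insert x S)
    then show ?case by (simp add: lin_add lin_scale)
  qed (simp_all add: lin_def mconst_hom)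
  have lookup_lin: "lookup (lin p) (single j 1) = lookup p (single j 1)"
    if "j < N" for p j
  proof -
    have "single i (1::nat) = single j 1 \<longleftrightarrow> i = j" for i
      by (metis lookup_single_eq lookup_single_not_eq zero_neq_one)
    then have "lookup (lin p) (single j 1) =
        (\<Sum>i<N. if i = j then lookup p (single j 1) else 0)"
      unfolding lin_def lookup_sum
      by (intro sum.cong) (auto simp: lookup_mconst_mult mvar_def lookup_single when_def)
    then show ?thesis using that by simp
  qed
  obtain B where B: "B \<subseteq> lin ` I" "V.independent B" "lin ` I \<subseteq> V.span B"
    using V.maximal_independent_subset by blast
  have "lin ` I \<subseteq> V.span (mvar ` {..<N})"
    unfolding lin_def by (intro image_subsetI V.span_sum[OF V.span_scale[OF V.span_base]]) auto
  then have "finite B" using B V.independent_span_bound[of "mvar ` {..<N}" B] by auto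
  define c where "c = card B"
  obtain e where e: "bij_betw e {..<c} B"
    using ex_bij_betw_nat_finite[OF \<open>finite B\<close>] by (auto simp: c_def atLeast0LessThan)
  have "\<forall>i\<in>{..<c}. \<exists>p\<in>I. lin p = e i"
  proof
    fix i assume "i \<in> {..<c}"
    then have "e i \<in> lin ` I" using e B(1) by (auto simp: bij_betw_def)
    then show "\<exists>p\<in>I. lin p = e i" by (metis imageE)
  qed
  then obtain f where f: "\<And>i. i < c \<Longrightarrow> f i \<in> I" "\<And>i. i < c \<Longrightarrow> lin (f i) = e i" by (metis lessThan_iff)
  have indep: "\<forall>i<c. w i = 0"
    if w: "\<forall>j<N. (\<Sum>i<c. w i * lookup (f i) (single j 1)) = 0" for w
  proof -
    define s where "s = (\<Sum>i<c. mconst (w i) * f i)"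
    have "lin s = 0" using w by (simp add: lin_def s_def lookup_sum lookup_mconst_mult mconst_hom)
    then have "(\<Sum>i<c. mconst (w i) * e i) = 0"
      using lin_sum[of w f "{..<c}"] f(2) by (simp add: s_def)
    moreover have "(\<Sum>i<c. mconst (w i) * e i) = (\<Sum>b\<in>B. mconst (w (inv_into {..<c} e b)) * b)"
      unfolding sum.reindex_bij_betw[OF e, symmetric]
      using e by (intro sum.cong) (auto simp: bij_betw_def)
    ultimately have "(\<Sum>b\<in>B. mconst (w (inv_into {..<c} e b)) * b) = 0" by simp
    then have "V.dependent B" if "\<exists>b\<in>B. w (inv_into {..<c} e b) \<noteq> 0"
      unfolding V.dependent_finite[OF \<open>finite B\<close>]
      using that by (intro exI[of _ "\<lambda>b. w (inv_into {..<c} e b)"] conjI)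
    then have "w (inv_into {..<c} e b) = 0" if "b \<in> B" for b using that B(2) by blast
    moreover have "e i \<in> B" "inv_into {..<c} e (e i) = i" if "i < c" for i
      using e that by (auto simp: bij_betw_def)
    ultimately show ?thesis by metis
  qed
  have diff: "p - q \<in> I" if "p \<in> I" "q \<in> I" for p q
    using I(3)[OF that(1) I(4)[of "mconst (-1)", OF _ that(2)]]
    by (simp add: mconst_uminus mconst_hom polys_closed)
  \<comment> \<open>The differential of \<open>F\<close> is a combination of those of the
    \<open>f i\<close>; subtracting the same combination of the \<open>f i\<close> themselves leaves
    an element of \<open>I\<close> without linear terms.\<close>
  have reduce: "\<exists>s. s \<in> idl.span (f ` {..<c}) \<and> F - s \<in> I \<and> F - s \<in> ordge 2" if F: "F \<in> I" for F
  proof -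
    have "lin F \<in> V.span B" using B(3) F by blast
    then obtain u where "lin F = (\<Sum>b\<in>B. mconst (u b) * b)"
      using V.span_finite[OF \<open>finite B\<close>] by auto
    also have "\<dots> = (\<Sum>i<c. mconst (u (e i)) * lin (f i))"
      unfolding sum.reindex_bij_betw[OF e, symmetric] using f(2) by (intro sum.cong) auto
    finally have u: "lin F = (\<Sum>i<c. mconst (u (e i)) * lin (f i))" .
    define s where "s = (\<Sum>i<c. mconst (u (e i)) * f i)"
    have "(\<Sum>i\<in>S. mconst (u (e i)) * f i) \<in> I" if "S \<subseteq> {..<c}" for S
      using finite_subset[OF that] that by (induction S) (auto intro!: I polys_closed f)
    then have sI: "s \<in> I" by (simp add: s_def)
    have "lin (F - s) = 0"
      using lin_sum[of "\<lambda>i. u (e i)" f "{..<c}"] u lin_add[of "F - s" s] by (simp add: s_def)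
    have FsI: "F - s \<in> I" using diff F sI .
    have "F - s \<in> ordge 2" unfolding ordge_def
    proof (intro CollectI ballI)
      fix m assume m: "m \<in> keys (F - s)"
      have m1: "1 \<le> mdeg m" using FsI I1 m by (auto simp: ordge_def)
      have "mdeg m \<noteq> 1"
      proof
        assume 1: "mdeg m = 1"
        then have "keys m \<noteq> {}" by (auto simp: mdeg_def)
        then obtain j where j: "j \<in> keys m" by blast
        have eq: "m = (m - single j 1) + single j 1" by (rule split_off_variable[OF j])
        then have "mdeg m = mdeg (m - single j 1) + 1" by (metis mdeg_add mdeg_single)
        then have "m - single j 1 = 0" using 1 mdeg_eq_0_iff by auto
        then have mj: "m = single j 1" using eq by simp
        have "j < N" using j m FsI I(1) by (auto simp: mpoly_ring_def)
        from lookup_lin[OF this, of "F - s"] show False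
          using \<open>lin (F - s) = 0\<close> m mj by (simp add: in_keys_iff)
      qed
      then show "2 \<le> mdeg m" using m1 by linarith
    qed
    moreover have "s \<in> idl.span (f ` {..<c})" unfolding s_def
      by (intro idl.span_sum[OF idl.span_scale[OF idl.span_base]]) auto
    ultimately show ?thesis using FsI by blast
  qed
  \<comment> \<open>The ideal \<open>(f)\<close> plus the \<open>p\<close>-th power of the ideal of
    the origin.\<close>
  define Q where "Q p = {u + v |u v. u \<in> idl.span (f ` {..<c}) \<and> v \<in> ordge p}" for p
  have Q_eq: "Q p = idl.span (f ` {..<c} \<union> ordge p)" for p
  proof -
    have "idl.span (ordge p) = (ordge p :: (nat, 'k) mpoly set)"
      using idl.span_minimal[OF subset_refl subspace_ordge] idl.span_superset by blast
    then show ?thesis unfolding Q_def idl.span_Un by (simp only:)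
  qed
  have Q: "idl.subspace (Q p)" for p by (simp add: Q_eq)
  have span_ord: "idl.span (f ` {..<c}) \<subseteq> ordge (Suc 0)"
    using f(1) I1 by (intro idl.span_minimal subspace_ordge) auto
  have QI: "q \<in> Q p" if "q \<in> idl.span (f ` {..<c}) \<or> q \<in> ordge p" for p q
    unfolding Q_def using that ordge_closed(1) idl.span_zero by (metis (mono_tags, lifting) add.left_neutral add.right_neutral mem_Collect_eq)
  have main: "I \<subseteq> Q p" if "1 \<le> p" for p
    using that
  proof (induction p rule: dec_induct)
    case base
    show ?case using I1 QI by auto
  next
    case (step p)
    show ?case
    proof (rule ccontr)
      assume "\<not> I \<subseteq> Q (Suc p)"
      then obtain F0 where F0: "F0 \<in> I" "F0 \<notin> Q (Suc p)" by blast
      obtain s where s: "s \<in> idl.span (f ` {..<c})" "F0 - s \<in> I" "F0 - s \<in> ordge 2" using reduce[OF F0(1)] by blast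
      define F where "F = F0 - s"
      have F: "F \<in> I" "F \<in> ordge 2" using s by (auto simp: F_def)
      have "F \<notin> Q (Suc p)"
      proof
        assume "F \<in> Q (Suc p)"
        then have "F + s \<in> Q (Suc p)" using Q QI s(1) by (intro idl.subspace_add) auto
        then show False using F0 by (simp add: F_def)
      qed
      moreover have "V.subspace (Q (Suc p))"
        using Q[of "Suc p"] by (auto simp: V.subspace_def idl.subspace_def)
      ultimately obtain l where l: "Vector_Spaces.linear (\<lambda>c p. mconst c * p) (*) l"
        "\<And>w. w \<in> Q (Suc p) \<Longrightarrow> l w = 0" "l F = 1"
        using V.separating_functional by blast
      interpret l: Vector_Spaces.linear "\<lambda>c p. mconst c * p" "(*)" l by fact
      have Qp1: "Q p \<subseteq> ordge (Suc 0)"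
        using step(1) span_ord ordge_antimono[of "Suc 0" p] by (auto simp: Q_def intro!: ordge_closed)
      \<comment> \<open>Multiplication by a polynomial vanishing at the origin keeps the
        \<open>(f)\<close> part in \<open>(f)\<close> and raises the order of the rest, so the
        product lies in \<open>Q (Suc p)\<close>.\<close>
      have van: "l (u * v) = 0" if "u \<in> ordge (Suc 0)" "v \<in> Q p" for u v
      proof -
        from that(2) obtain a b where "v = a + b" "a \<in> idl.span (f ` {..<c})" "b \<in> ordge p"
          by (auto simp: Q_def)
        moreover have "u * a \<in> idl.span (f ` {..<c})" "u * b \<in> ordge (Suc p)"
          using ordge_mult[OF that(1), of b p] calculation by (auto intro: idl.span_scale)
        ultimately have "u * v \<in> Q (Suc p)" by (auto simp: Q_def algebra_simps)
        then show ?thesis by (rule l(2))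
      qed
      obtain t where t: "\<And>j. t j - mvar j \<in> Q p" "\<And>G. G \<in> I \<Longrightarrow> l (subst t G) = 0"
        using lift[OF Q step(3) Qp1 l.add l.scale van F(1) l(3)] by blast
      have t1: "subst t q - q \<in> Q p" for q by (rule subst_congruent[OF Q t(1)])
      \<comment> \<open>Split the monomial as \<open>A * mvar j\<close>. Since its degree is at
        least 2, \<open>A\<close> vanishes at the origin, and the difference is a sum of two
        products of an element vanishing there with an element of \<open>Q p\<close>.\<close>
      have "l (subst t (single m 1) - single m 1) = 0" if "2 \<le> mdeg m" for m
      proof -
        from that have "keys m \<noteq> {}" by (auto simp: mdeg_def)
        then obtain j where j: "j \<in> keys m" by blast
        define a where "a = m - single j 1"
        have m: "m = a + single j 1" unfolding a_def by (rule split_off_variable[OF j])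
        define A where "A = (single a 1 :: (nat, 'k) mpoly)"
        have sm: "single m 1 = A * mvar j" by (simp add: A_def m mvar_def mult_single)
        have A1: "A \<in> ordge (Suc 0)" unfolding A_def using that m by (intro single_in_ordge) simp
        have tj: "t j \<in> ordge (Suc 0)"
          using ordge_closed(2)[OF mvar_in_ordge[of j] subsetD[OF Qp1 t(1)[of j]]] by simp
        have "subst t (single m 1) - single m 1 = t j * (subst t A - A) + A * (t j - mvar j)"
          by (simp add: sm algebra_simps)
        then show ?thesis using van[OF tj t1] van[OF A1 t(1)] by (simp add: l.add)
      qed
      then have "l (\<Sum>m\<in>keys F. mconst (lookup F m) *
          (subst t (single m 1) - single m 1)) = 0"
        using F(2) by (auto simp: l.sum l.scale ordge_def intro!: sum.neutral)
      also have "(\<Sum>m\<in>keys F. mconst (lookup F m) *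
          (subst t (single m 1) - single m 1)) = subst t F - F"
      proof -
        define E where "E = (\<Sum>m\<in>keys F. mconst (lookup F m) * single m 1)"
        have "E = F" unfolding E_def by (rule mpoly_expansion[symmetric])
        moreover have "(\<Sum>m\<in>keys F. mconst (lookup F m) *
          (subst t (single m 1) - single m 1)) = subst t E - E"
          by (simp add: E_def right_diff_distrib sum_subtractf)
        ultimately show ?thesis by simp
      qed
      finally show False using t(2)[OF F(1)] l(3) by (simp add: l.diff)
    qed
  qed
  have fN: "f ` {..<c} \<subseteq> polys {..<N}" using f(1) I(1) by auto
  have "\<exists>g\<in>polys {..<N}. lookup g 0 = 1 \<and> g * F \<in> idl.span (f ` {..<c})" if F: "F \<in> I" for F
  proof (rule krull_intersection[OF _ fN])
    show "F \<in> polys {..<N}" using F I(1) by blast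
    show "\<exists>u\<in>idl.span (f ` {..<c}). F - u \<in> ordge p" for p
    proof -
      have "F \<in> Q (Suc p)" using main[of "Suc p"] F by auto
      then obtain u v where "F = u + v" "u \<in> idl.span (f ` {..<c})" "v \<in> ordge (Suc p)" by (auto simp: Q_def)
      then show ?thesis using ordge_antimono[of p "Suc p"] by (intro bexI[of _ u]) auto
    qed
  qed
  then obtain g where g: "\<And>F. F \<in> I \<Longrightarrow> g F \<in> polys {..<N}" "\<And>F. F \<in> I \<Longrightarrow> lookup (g F) 0 = 1"
    "\<And>F. F \<in> I \<Longrightarrow> g F * F \<in> idl.span (f ` {..<c})" by metis
  \<comment> \<open>Krull's theorem gives a multiplier for each element separately; the product of
    the multipliers of finitely many generators of \<open>I\<close> serves for all of
    \<open>I\<close>.\<close>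
  obtain G where G: "finite G" "G \<subseteq> I" "I \<subseteq> ispan (polys {..<N}) G"
    using noetherian_finite_subset[OF is_subring_polys noetherian_polys I(1)] by blast
  have prod: "prod g S \<in> polys {..<N} \<and> lookup (prod g S) 0 = 1" if "S \<subseteq> I" for S
    using that by (induction S rule: infinite_finite_induct) (auto simp: g lookup_0_mult intro: polys_closed)
  have "prod g G * F \<in> idl.span (f ` {..<c})" if "F \<in> ispan (polys {..<N}) G" for F
    using that
  proof (induction F rule: ispan.induct)
    case zero
    then show ?case by (simp add: idl.span_zero)
  next
    case (step q u x)
    have "prod g G * (q + u * x) = prod g G * q + (u * prod g (G - {x})) * (g x * x)"
      using prod.remove[OF G(1) step(3), of g] by (simp add: algebra_simps)
    then show ?case
      using idl.span_add[OF step.IH idl.span_scale[OF g(3)[OF subsetD[OF G(2) step(3)]]]] by (simp only:)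
  qed
  then show ?thesis using that[of c f "prod g G"] f(1) indep prod[OF G(2)] G(3) by blast
qed

section \<open>Smoothness from local equations\<close>

abbreviation peval :: "('v \<Rightarrow> 'k) \<Rightarrow> ('v, 'k::comm_ring_1) mpoly \<Rightarrow> 'k" where
  "peval \<equiv> mpoly_eval id"

lemmas peval_add = mpoly_eval_add[OF id_ring_hom]
  and peval_mult = mpoly_eval_mult[OF id_ring_hom]
  and peval_diff = mpoly_eval_diff[OF id_ring_hom]
  and peval_mvar = mpoly_eval_mvar[OF id_ring_hom]
  and peval_mconst = trans[OF mpoly_eval_mconst[OF id_ring_hom] id_apply]
  and peval_0 = mpoly_eval_0[OF id_ring_hom]

lemma mpoly_eval_subst: "peval t (subst s p) = peval (\<lambda>v. peval t (s v)) p"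
proof -
  have "p \<in> polys UNIV" by simp
  then show ?thesis
    by (induction p rule: mpoly_ring_induct)
      (simp_all only: subst_simps peval_add peval_mult peval_mvar peval_mconst)
qed

lemma mpoly_eval_cong:
  assumes "p \<in> polys V" "\<And>v. v \<in> V \<Longrightarrow> t v = s v"
  shows "peval t p = peval s p"
  using assms(1)
  by (induction p rule: mpoly_ring_induct)
    (simp_all only: assms(2) peval_add peval_mult peval_mvar peval_mconst)

lemma subspace_kernel_mpoly_eval: "idl.subspace {p. peval t p = 0}"
  by (rule idl.subspaceI) (auto simp only: peval_0 peval_add peval_mult mem_Collect_eq mult_zero_right add_0)

section \<open>Partial derivatives and their values at a point\<close>

lemma mpoly_eval_deriv:
  "mpoly_eval id t (mpoly_deriv v p) = (\<Sum>m\<in>keys p.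
     of_nat (lookup m v) * lookup p m * mon_eval t (m - single v 1))"
  unfolding mpoly_deriv_def mpoly_eval_sum[OF id_ring_hom]
  by (simp add: mpoly_eval_single[OF id_ring_hom])

lemma mpoly_eval_deriv_superset:
  assumes "finite S" "keys p \<subseteq> S"
  shows "mpoly_eval id t (mpoly_deriv v p) = (\<Sum>m\<in>S.
     of_nat (lookup m v) * lookup p m * mon_eval t (m - single v 1))"
  unfolding mpoly_eval_deriv
  by (rule sum.mono_neutral_left) (use assms in \<open>auto simp: in_keys_iff\<close>)

lemma mpoly_eval_deriv_diff:
  "mpoly_eval id t (mpoly_deriv v (p - q)) = mpoly_eval id t (mpoly_deriv v p) - mpoly_eval id t (mpoly_deriv v q)"
proof -
  let ?S = "keys p \<union> keys q"
  have "keys (p - q) \<subseteq> ?S" by (auto simp: in_keys_iff lookup_minus)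
  then show ?thesis
    by (simp add: mpoly_eval_deriv_superset[of ?S] lookup_minus algebra_simps sum_subtractf)
qed

text \<open>Only a monomial equal to the variable itself survives differentiation and evaluation at
  zero. The point is prescribed only on the variables of \<open>p\<close>, because it will take the
  value 1 at an auxiliary variable.\<close>

lemma mpoly_eval_deriv_origin:
  assumes p: "p \<in> polys V" and v: "v \<in> V" and t: "\<And>u. u \<in> V \<Longrightarrow> t u = 0"
  shows "mpoly_eval id t (mpoly_deriv v p) = lookup p (single v 1)"
proof -
  let ?e = "single v (1::nat)"
  have "of_nat (lookup m v) * lookup p m * mon_eval t (m - ?e) =
      (if m = ?e then lookup p ?e else 0)" if m: "m \<in> keys p" for m
  proof (cases "v \<in> keys m")
    case True
    note eq = split_off_variable[OF this]
    show ?thesis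
    proof (cases "m - ?e = 0")
      case True
      then show ?thesis using eq by (simp add: mon_eval_def)
    next
      case False
      then obtain u where u: "u \<in> keys (m - ?e)" by fastforce
      then have "u \<in> keys m" by (auto simp: in_keys_iff lookup_minus)
      then have "t u = 0" using p m t by (auto simp: mpoly_ring_def)
      then have "t u ^ lookup (m - ?e) u = 0" using u by (simp add: in_keys_iff zero_power)
      then have "mon_eval t (m - ?e) = 0" unfolding mon_eval_def by (intro prod_zero bexI[OF _ u]) auto
      moreover have "m \<noteq> ?e" using False by auto
      ultimately show ?thesis by simp
    qed
  next
    case False
    then have "m \<noteq> ?e" by auto
    with False show ?thesis by (simp add: in_keys_iff)
  qed
  then have "mpoly_eval id t (mpoly_deriv v p) =
      (\<Sum>m\<in>keys p. if m = ?e then lookup p ?e else 0)"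
    unfolding mpoly_eval_deriv by (intro sum.cong) auto
  then show ?thesis by (simp add: in_keys_iff)
qed

lemma mpoly_eval_deriv_absent:
  assumes "p \<in> polys V" "v \<notin> V"
  shows "mpoly_eval id t (mpoly_deriv v p) = 0"
  unfolding mpoly_eval_deriv
proof (intro sum.neutral ballI)
  fix m assume "m \<in> keys p"
  then have "v \<notin> keys m" using assms by (auto simp: mpoly_ring_def)
  then have "lookup m v = 0" by (simp add: in_keys_iff)
  then show "of_nat (lookup m v) * lookup p m * mon_eval t (m - single v 1) = 0"
    by simp
qed

lemma mpoly_eval_deriv_mult_new_variable:
  assumes "p \<in> polys V" "v \<notin> V"
  shows "mpoly_eval id t (mpoly_deriv v (p * mvar v)) = mpoly_eval id t p"
proof -
  let ?e = "single v (1::nat)"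
  have lookup: "lookup (p * mvar v) (m + ?e) = lookup p m" for m
  proof -
    have "p * mvar v = (\<Sum>k\<in>keys p. single (k + ?e) (lookup p k))"
      by (subst poly_mapping_sum_monomials[of p, symmetric])
        (simp add: sum_distrib_right mvar_def mult_single)
    then show ?thesis
      by (auto simp: lookup_sum lookup_single when_def in_keys_iff intro!: sum.neutral)
  qed
  have "keys (p * mvar v) \<subseteq> (\<lambda>m. m + ?e) ` keys p"
    using keys_mult[of p "mvar v"] by (auto simp: mvar_def split: if_splits)
  then have "mpoly_eval id t (mpoly_deriv v (p * mvar v)) = (\<Sum>m\<in>(\<lambda>m. m + ?e) ` keys p.
      of_nat (lookup m v) * lookup (p * mvar v) m * mon_eval t (m - ?e))"
    by (intro mpoly_eval_deriv_superset) auto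
  also have "\<dots> = (\<Sum>m\<in>keys p. lookup p m * mon_eval t m)"
  proof (subst sum.reindex)
    show "inj_on (\<lambda>m. m + ?e) (keys p)" by (auto simp: inj_on_def)
    have "lookup m v = 0" if "m \<in> keys p" for m
    proof -
      have "v \<notin> keys m" using that assms by (auto simp: mpoly_ring_def)
      then show ?thesis by (simp add: in_keys_iff)
    qed
    then show "sum ((\<lambda>m. of_nat (lookup m v) * lookup (p * mvar v) m *
        mon_eval t (m - ?e)) \<circ> (\<lambda>m. m + ?e)) (keys p) =
        (\<Sum>m\<in>keys p. lookup p m * mon_eval t m)"
      by (intro sum.cong) (auto simp: lookup[unfolded One_nat_def] lookup_add)
  qed
  finally show ?thesis by (simp add: mpoly_eval_def)
qed

text \<open>Compare the coefficients of the powers of the new variable \<open>y\<close> in \<open>a = \<Sum> u\<^sub>i f\<^sub>i + w (g y - 1)\<close>: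
  modulo the span of the \<open>f\<^sub>i\<close>, the coefficients of \<open>w\<close> are \<open>- g\<^sup>i a\<close>, and almost all of them are \<open>0\<close>.\<close>

lemma clear_denominators:
  fixes a g :: "(nat, 'k::comm_ring_1) mpoly"
  assumes Z: "Z \<subseteq> polys {..<N}" and g: "g \<in> polys {..<N}" and a: "a \<in> polys {..<N}"
    and in_span: "a \<in> idl.span (insert (g * mvar N - 1) Z)"
  shows "\<exists>k. g ^ k * a \<in> idl.span Z"
proof -
  \<comment> \<open>Reads a polynomial as a univariate polynomial in the new variable. The span
    allows coefficients in all variables of the type, so \<open>\<Gamma>\<close> is defined on all
    of them; those beyond \<open>N\<close> are sent to the new variable too.\<close>
  define \<Gamma> where "\<Gamma> = mpoly_eval (\<lambda>c. [:mconst c:]) (\<lambda>j. if j < N then [:mvar j :: (nat, 'k) mpoly:] else [:0, 1:])"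
  note h = const_poly_ring_hom
  have \<Gamma>: "\<Gamma> (p + q) = \<Gamma> p + \<Gamma> q" "\<Gamma> (p * q) = \<Gamma> p * \<Gamma> q" "\<Gamma> (p - q) = \<Gamma> p - \<Gamma> q"
    "\<Gamma> (mvar j) = (if j < N then [:mvar j:] else [:0, 1:])" "\<Gamma> (mconst c) = [:mconst c:]" for p q j c
    by (simp_all add: \<Gamma>_def mpoly_eval_add[OF h] mpoly_eval_mult[OF h] mpoly_eval_diff[OF h]
        mpoly_eval_mvar[OF h] mpoly_eval_mconst[OF h])
  have \<Gamma>_const: "\<Gamma> p = [:p:]" if "p \<in> polys {..<N}" for p
    using that by (induction p rule: mpoly_ring_induct) (auto simp: \<Gamma> mult.commute)
  have "\<Gamma> 1 = 1" using \<Gamma>(5)[of 1] by (simp add: mconst_hom one_pCons)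
  then have "\<Gamma> (g * mvar N - 1) = [:-1, g:]" by (simp add: \<Gamma> \<Gamma>_const[OF g] one_pCons)
  then have "[:a:] \<in> idl.span (insert [:-1, g:] (\<Gamma> ` Z))"
    using hom_idl_span[of \<Gamma>, OF \<Gamma>(1,2) in_span] \<Gamma>_const[OF a] by simp
  then obtain w where w: "[:a:] - w * [:-1, g:] \<in> idl.span (\<Gamma> ` Z)" by (auto simp: idl.span_insert)
  have coeff: "Polynomial.coeff q i \<in> idl.span Z" if "q \<in> idl.span (\<Gamma> ` Z)" for q i
    using that
  proof (induction q rule: idl.span_induct_alt)
    case base
    then show ?case by (simp add: idl.span_zero)
  next
    case (step c x q)
    then obtain z where z: "z \<in> Z" "x = [:z:]" using \<Gamma>_const Z by blast
    have "Polynomial.coeff (c * x) i = Polynomial.coeff c i * z" unfolding z(2) by (simp add: mult.commute)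
    then show ?case
      using idl.span_add[OF idl.span_scale[OF idl.span_base[OF z(1)], of "Polynomial.coeff c i"] step.IH]
      by simp
  qed
  have "Polynomial.coeff w i + g ^ i * a \<in> idl.span Z" for i
  proof (induction i)
    case 0
    show ?case using coeff[OF w, of 0] by (simp add: add.commute coeff_mult)
  next
    case (Suc i)
    have "Polynomial.coeff ([:a:] - w * [:-1, g:]) (Suc i) = Polynomial.coeff w (Suc i) - g * Polynomial.coeff w i"
      by (simp add: coeff_pCons mult.commute[of w])
    then have "g * (Polynomial.coeff w i + g ^ i * a) + (Polynomial.coeff w (Suc i) - g * Polynomial.coeff w i) \<in> idl.span Z"
      using idl.span_add[OF idl.span_scale[OF Suc] coeff[OF w, of "Suc i"]] by (simp only:)
    then show ?case by (simp add: algebra_simps)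
  qed
  from this[of "Suc (Polynomial.degree w)"] have "g ^ Suc (Polynomial.degree w) * a \<in> idl.span Z"
    by (simp add: coeff_eq_0)
  then show ?thesis by blast
qed

section \<open>Quotients of polynomial rings by ideals\<close>

lemma mpoly_ring_simps:
  "x \<otimes>\<^bsub>mpoly_ring V\<^esub> y = x * y" "x \<oplus>\<^bsub>mpoly_ring V\<^esub> y = x + y" "\<one>\<^bsub>mpoly_ring V\<^esub> = 1" "\<zero>\<^bsub>mpoly_ring V\<^esub> = 0"
  by (simp_all add: mpoly_ring_def)

context
  fixes V :: "'v set" and J :: "('v, 'k::comm_ring_1) mpoly set"
  assumes J: "ideal J (mpoly_ring V)"
begin

interpretation J: ideal J "mpoly_ring V" by (rule J)

lemma mem_coset_mpoly_ring: "q \<in> J +>\<^bsub>mpoly_ring V\<^esub> p \<longleftrightarrow> (\<exists>h\<in>J. q = h + p)"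
  by (auto simp: a_r_coset_def' mpoly_ring_simps)

lemma coset_mpoly_ring_eq_iff:
  assumes "p \<in> polys V" "q \<in> polys V"
  shows "J +>\<^bsub>mpoly_ring V\<^esub> p = J +>\<^bsub>mpoly_ring V\<^esub> q \<longleftrightarrow> p - q \<in> J"
proof
  assume "J +>\<^bsub>mpoly_ring V\<^esub> p = J +>\<^bsub>mpoly_ring V\<^esub> q"
  then have "p \<in> J +>\<^bsub>mpoly_ring V\<^esub> q" using J.a_rcos_self[OF assms(1)] by simp
  then show "p - q \<in> J" by (auto simp: mem_coset_mpoly_ring)
next
  assume "p - q \<in> J"
  then have "p \<in> J +>\<^bsub>mpoly_ring V\<^esub> q" by (auto simp: mem_coset_mpoly_ring intro: bexI[of _ "p - q"])
  then show "J +>\<^bsub>mpoly_ring V\<^esub> p = J +>\<^bsub>mpoly_ring V\<^esub> q" using J.a_repr_independence' assms by metis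
qed

lemma coset_mpoly_ring_self: "p \<in> polys V \<Longrightarrow> p \<in> J +>\<^bsub>mpoly_ring V\<^esub> p"
  by (rule J.a_rcos_self)

lemma carrier_Quot_mpoly_ring: "carrier (mpoly_ring V Quot J) = (\<lambda>p. J +>\<^bsub>mpoly_ring V\<^esub> p) ` polys V"
  by (auto simp: FactRing_def A_RCOSETS_def')

lemma Quot_mpoly_ring_simps:
  assumes "p \<in> polys V" "q \<in> polys V"
  shows "(J +>\<^bsub>mpoly_ring V\<^esub> p) \<otimes>\<^bsub>mpoly_ring V Quot J\<^esub> (J +>\<^bsub>mpoly_ring V\<^esub> q) = J +>\<^bsub>mpoly_ring V\<^esub> (p * q)"
    "(J +>\<^bsub>mpoly_ring V\<^esub> p) \<oplus>\<^bsub>mpoly_ring V Quot J\<^esub> (J +>\<^bsub>mpoly_ring V\<^esub> q) = J +>\<^bsub>mpoly_ring V\<^esub> (p + q)"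
  using ring_hom_mult[OF J.rcos_ring_hom assms] ring_hom_add[OF J.rcos_ring_hom assms]
  by (simp_all add: mpoly_ring_simps)

lemma Quot_mpoly_ring_units:
  "\<one>\<^bsub>mpoly_ring V Quot J\<^esub> = J +>\<^bsub>mpoly_ring V\<^esub> 1" "\<zero>\<^bsub>mpoly_ring V Quot J\<^esub> = J +>\<^bsub>mpoly_ring V\<^esub> 0"
proof -
  show "\<one>\<^bsub>mpoly_ring V Quot J\<^esub> = J +>\<^bsub>mpoly_ring V\<^esub> 1"
    using ring_hom_one[OF J.rcos_ring_hom] by (simp add: mpoly_ring_simps)
  interpret ring_hom_ring "mpoly_ring V" "mpoly_ring V Quot J" "(+>\<^bsub>mpoly_ring V\<^esub>) J"
    by (rule J.rcos_ring_hom_ring)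
  show "\<zero>\<^bsub>mpoly_ring V Quot J\<^esub> = J +>\<^bsub>mpoly_ring V\<^esub> 0"
    using hom_zero by (simp add: mpoly_ring_simps)
qed

lemma Quot_mpoly_ring_pow:
  assumes p: "p \<in> polys V"
  shows "(J +>\<^bsub>mpoly_ring V\<^esub> p) [^]\<^bsub>mpoly_ring V Quot J\<^esub> (k::nat) = J +>\<^bsub>mpoly_ring V\<^esub> (p ^ k)"
proof (induction k)
  case 0
  then show ?case by (simp add: Quot_mpoly_ring_units(1))
next
  case (Suc k)
  then show ?case using p
    by (simp add: Quot_mpoly_ring_simps polys_closed mult.commute)
qed

end

text \<open>The substitutions \<open>s\<close> and \<open>u\<close> are inverse to each other modulo
  \<open>I\<close> and \<open>Rel\<close>, so both presentations define the same ring. On inverting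
  \<open>g\<close>, the ideal \<open>I\<close> becomes the one generated by the \<open>f i\<close>.
  The neighbourhood is where the pullback of \<open>g\<close> along \<open>u\<close> is invertible,
  and the variable \<open>mvar N\<close> plays the inverse of \<open>g\<close>, which adds one
  variable and one equation.\<close>

theorem smooth_point_of_equations:
  fixes V :: "'v set" and Rel :: "('v, 'k::field) mpoly set" and s :: "'v \<Rightarrow> (nat, 'k) mpoly"
    and u :: "nat \<Rightarrow> ('v, 'k) mpoly" and pt :: "'v \<Rightarrow> 'k" and f :: "nat \<Rightarrow> (nat, 'k) mpoly"
  assumes Rel: "Rel \<subseteq> polys V" and I: "I \<subseteq> polys {..<N}" "I \<subseteq> ordge (Suc 0)"
    and s: "\<And>v. v \<in> V \<Longrightarrow> s v \<in> polys {..<N}" and u: "\<And>j. j < N \<Longrightarrow> u j \<in> polys V"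
    and sRel: "\<And>r. r \<in> Rel \<Longrightarrow> subst s r \<in> idl.span I"
    and uI: "\<And>q. q \<in> I \<Longrightarrow> subst u q \<in> idl.span Rel"
    and su: "\<And>j. j < N \<Longrightarrow> subst s (u j) - mvar j \<in> idl.span I"
    and us: "\<And>v. v \<in> V \<Longrightarrow> subst u (s v) - mvar v \<in> idl.span Rel"
    and pt: "\<And>v. v \<in> V \<Longrightarrow> lookup (s v) 0 = pt v"
    and f: "\<And>i. i < c \<Longrightarrow> f i \<in> I"
    and indep: "\<And>w. (\<forall>j<N. (\<Sum>i<c. w i * lookup (f i) (single j 1)) = 0) \<Longrightarrow>
      (\<forall>i<c. w i = 0)"
    and g: "g \<in> polys {..<N}" "lookup g 0 = 1"
      "\<And>F. F \<in> I \<Longrightarrow> g * F \<in> idl.span (f ` {..<c})"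
  defines "J0 \<equiv> genideal (mpoly_ring V) Rel"
  shows "smooth_point (\<lambda>a. J0 +>\<^bsub>mpoly_ring V\<^esub> mconst a) (mpoly_ring V Quot J0)
    (\<lambda>C. the_elem (mpoly_eval id pt ` C))"
proof -
  let ?P = "mpoly_ring V :: ('v, 'k) mpoly ring"
  let ?Q = "mpoly_ring {..<Suc N} :: (nat, 'k) mpoly ring"
  interpret P: cring ?P by (rule cring_mpoly_ring)
  interpret Q: cring ?Q by (rule cring_mpoly_ring)
  have J0: "J0 = idl.span Rel \<inter> polys V" unfolding J0_def by (rule genideal_mpoly_ring[OF Rel])
  have J0_ideal: "ideal J0 ?P" unfolding J0_def by (rule P.genideal_ideal[OF Rel])
  define fs where "fs i = (if i < c then f i else g * mvar N - 1)" for i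
  define F where "F = fs ` {..<Suc c}"
  have F_eq: "F = insert (g * mvar N - 1) (f ` {..<c})"
    by (auto simp: F_def fs_def lessThan_Suc)
  have polys_Suc: "p \<in> polys {..<Suc N}" if "p \<in> polys {..<N}" for p :: "(nat, 'k) mpoly"
    using that polys_mono[of "{..<N}" "{..<Suc N}"] by auto
  have fN: "f i \<in> polys {..<N}" if "i < c" for i using f[OF that] I by blast
  have fs: "fs i \<in> polys {..<Suc N}" if "i < Suc c" for i
    using that g by (auto simp: fs_def intro!: polys_closed intro: polys_Suc fN)
  then have F: "F \<subseteq> polys {..<Suc N}" by (auto simp: F_def)
  define J where "J = genideal ?Q F"
  have J: "J = idl.span F \<inter> polys {..<Suc N}" unfolding J_def by (rule genideal_mpoly_ring[OF F])
  have J_ideal: "ideal J ?Q" unfolding J_def by (rule Q.genideal_ideal[OF F])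
  have span_F: "idl.span I \<subseteq> idl.span F"
  proof (rule idl.span_minimal)
    show "I \<subseteq> idl.span F"
    proof
      fix q assume q: "q \<in> I"
      have gq: "g * q \<in> idl.span F" using g(3)[OF q] idl.span_mono[of "f ` {..<c}" F] by (auto simp: F_eq)
      have "g * mvar N - 1 \<in> idl.span F" by (rule idl.span_base) (simp add: F_eq)
      \<comment> \<open>This difference equals \<open>q\<close>: inverting \<open>g\<close> puts
        \<open>q\<close> into the ideal as soon as \<open>g * q\<close> is there.\<close>
      then have "mvar N * (g * q) - q * (g * mvar N - 1) \<in> idl.span F"
        by (rule idl.span_diff[OF idl.span_scale[OF gq] idl.span_scale])
      then show "q \<in> idl.span F" by (simp add: algebra_simps)
    qed
  qed simp
  have s_polys: "subst s p \<in> polys {..<N}" if "p \<in> polys V" for p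
    by (rule subst_in_polys[OF that s])
  have u_polys: "subst u q \<in> polys V" if "q \<in> polys {..<N}" for q
    by (rule subst_in_polys[OF that]) (simp add: u)
  have s_span: "subst s p \<in> idl.span I" if "p \<in> idl.span Rel" for p
    using subst_idl_span[OF that, of s] idl.span_minimal[of "subst s ` Rel" "idl.span I"] sRel by auto
  have u_span: "subst u q \<in> idl.span Rel" if "q \<in> idl.span I" for q
    using subst_idl_span[OF that, of u] idl.span_minimal[of "subst u ` I" "idl.span Rel"] uI by auto
  have us': "subst u (subst s p) - p \<in> idl.span Rel" if p: "p \<in> polys V" for p
  proof -
    have "subst u (subst s p) = subst (\<lambda>v. if v \<in> V then subst u (s v) else mvar v) p"
      unfolding subst_subst by (rule subst_cong[OF p]) simp
    then show ?thesis
      using subst_congruent[OF idl.subspace_span[of Rel], of "\<lambda>v. if v \<in> V then subst u (s v) else mvar v" p] us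
      by (simp add: idl.span_zero)
  qed
  have su': "subst s (subst u q) - q \<in> idl.span I" if q: "q \<in> polys {..<N}" for q
  proof -
    have "subst s (subst u q) = subst (\<lambda>j. if j < N then subst s (u j) else mvar j) q"
      unfolding subst_subst by (rule subst_cong[OF q]) simp
    then show ?thesis
      using subst_congruent[OF idl.subspace_span[of I], of "\<lambda>j. if j < N then subst s (u j) else mvar j" q] su
      by (simp add: idl.span_zero)
  qed

  \<comment> \<open>The localization map and the corresponding points\<close>
  let ?R = "?P Quot J0" and ?S = "?Q Quot J"
  define \<pi> where "\<pi> p = J0 +>\<^bsub>?P\<^esub> p" for p
  define \<kappa> where "\<kappa> q = J +>\<^bsub>?Q\<^esub> q" for q
  note \<pi>_simps = Quot_mpoly_ring_simps[OF J0_ideal, folded \<pi>_def]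
    and \<kappa>_simps = Quot_mpoly_ring_simps[OF J_ideal, folded \<kappa>_def]
  note \<pi>_units = Quot_mpoly_ring_units[OF J0_ideal, folded \<pi>_def]
    and \<kappa>_units = Quot_mpoly_ring_units[OF J_ideal, folded \<kappa>_def]
  note \<pi>_eq = coset_mpoly_ring_eq_iff[OF J0_ideal, folded \<pi>_def]
    and \<kappa>_eq = coset_mpoly_ring_eq_iff[OF J_ideal, folded \<kappa>_def]
  note \<pi>_pow = Quot_mpoly_ring_pow[OF J0_ideal, folded \<pi>_def]
    and \<kappa>_pow = Quot_mpoly_ring_pow[OF J_ideal, folded \<kappa>_def]
  have car_\<pi>: "carrier (?R) = \<pi> ` polys V"
    unfolding \<pi>_def by (rule carrier_Quot_mpoly_ring[OF J0_ideal])
  have car_\<kappa>: "carrier (?S) = \<kappa> ` polys {..<Suc N}"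
    unfolding \<kappa>_def by (rule carrier_Quot_mpoly_ring[OF J_ideal])
  \<comment> \<open>An arbitrary representative of the coset is substituted; the next step shows
    independence of it, since \<open>s\<close> sends \<open>Rel\<close> into the ideal of
    \<open>I\<close> and this lies in the ideal of \<open>F\<close>.\<close>
  define l where "l C = \<kappa> (subst s (SOME p. p \<in> C))" for C
  have l: "l (\<pi> p) = \<kappa> (subst s p)" if p: "p \<in> polys V" for p
  proof -
    define q where "q = (SOME q. q \<in> \<pi> p)"
    have "p \<in> \<pi> p" unfolding \<pi>_def by (rule coset_mpoly_ring_self[OF J0_ideal p])
    then have "q \<in> \<pi> p" unfolding q_def by (rule someI)
    then obtain h where h: "h \<in> J0" "q = h + p" by (auto simp: \<pi>_def mem_coset_mpoly_ring[OF J0_ideal])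
    then have q: "q \<in> polys V" using p by (auto simp: J0 intro: polys_closed)
    have hh: "h \<in> idl.span Rel" "h \<in> polys V" using h(1) by (simp_all add: J0)
    have "subst s h \<in> J"
      using s_span[OF hh(1)] span_F polys_Suc[OF s_polys[OF hh(2)]] by (auto simp: J)
    then have "subst s q - subst s p \<in> J" using h(2) by simp
    then show ?thesis using s_polys[OF q] s_polys[OF p] by (simp add: l_def q_def[symmetric] \<kappa>_eq polys_Suc)
  qed
  have l_u: "l (\<pi> (subst u q)) = \<kappa> q" if q: "q \<in> polys {..<N}" for q
  proof -
    have "subst s (subst u q) - q \<in> J"
      using su'[OF q] span_F s_polys[OF u_polys[OF q]] q by (auto simp: J intro!: polys_closed intro: polys_Suc)
    then show ?thesis using s_polys[OF u_polys[OF q]] q by (simp add: l u_polys \<kappa>_eq polys_Suc)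
  qed
  have peval_s: "peval pt p = lookup (subst s p) 0" if "p \<in> polys V" for p
    unfolding mpoly_eval_zero[symmetric] mpoly_eval_subst
    by (rule mpoly_eval_cong[OF that]) (simp add: mpoly_eval_zero pt)
  have span_I_ord: "idl.span I \<subseteq> ordge (Suc 0)"
    by (rule idl.span_minimal[OF I(2) subspace_ordge])
  have point: "the_elem (peval pt ` \<pi> p) = peval pt p" if p: "p \<in> polys V" for p
  proof -
    have "peval pt q = peval pt p" if "q \<in> \<pi> p" for q
    proof -
      obtain h where h: "h \<in> J0" "q = h + p"
        using \<open>q \<in> \<pi> p\<close> by (auto simp: \<pi>_def mem_coset_mpoly_ring[OF J0_ideal])
      have "subst s h \<in> ordge (Suc 0)" using h(1) s_span span_I_ord by (auto simp: J0)
      then have "peval pt h = 0" using h(1) by (simp add: peval_s J0 in_ordge_1_iff)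
      then show ?thesis unfolding h(2) by (simp only: peval_add add_0)
    qed
    moreover have "p \<in> \<pi> p" unfolding \<pi>_def by (rule coset_mpoly_ring_self[OF J0_ideal p])
    ultimately have "peval pt ` \<pi> p = {peval pt p}" by blast
    then show ?thesis by simp
  qed
  \<comment> \<open>The point above the origin: since \<open>g\<close> is 1 there, its inverse
    \<open>mvar N\<close> must take the value 1.\<close>
  define t where "t j = (if j = N then 1 else 0 :: 'k)" for j
  have eval_t: "peval t p = lookup p 0" if "p \<in> polys {..<N}" for p
    unfolding mpoly_eval_zero[symmetric] by (rule mpoly_eval_cong[OF that]) (simp add: t_def)
  have eval_new: "peval t (g * mvar N - 1) = 0"
  proof -
    have "peval t 1 = 1" using peval_mconst[of t 1] by (simp only: mconst_hom)
    moreover have "peval t g = 1" using eval_t[OF g(1)] g(2) by simp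
    moreover have "t N = 1" by (simp add: t_def)
    ultimately show ?thesis by (simp only: peval_diff peval_mult peval_mvar mult_1 diff_self)
  qed
  have eval_fs: "peval t (fs i) = 0" if "i < Suc c" for i
  proof (cases "i < c")
    case True
    then show ?thesis using eval_t[OF fN[OF True]] f[OF True] I(2) by (auto simp: fs_def in_ordge_1_iff)
  next
    case False
    then show ?thesis using eval_new by (simp add: fs_def)
  qed
  have eval_J: "peval t q = 0" if "q \<in> J" for q
  proof -
    have "idl.span F \<subseteq> {p. peval t p = 0}"
      by (rule idl.span_minimal[OF _ subspace_kernel_mpoly_eval]) (use eval_fs in \<open>auto simp: F_def\<close>)
    then show ?thesis using that by (auto simp: J)
  qed
  define h where "h = \<pi> (subst u g)"
  have l_h: "l h = \<kappa> g" unfolding h_def by (rule l_u[OF g(1)])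
  have new_J: "g * mvar N - 1 \<in> idl.span F" by (rule idl.span_base) (simp add: F_eq)
  have loc: "localization_away (?R) h (?S) l"
    unfolding localization_away_def
  proof (intro conjI ballI impI)
    show "l \<in> ring_hom (?R) (?S)"
    proof (rule ring_hom_memI)
      fix C D assume "C \<in> carrier (?R)" "D \<in> carrier (?R)"
      then obtain p q where p: "p \<in> polys V" "C = \<pi> p" and q: "q \<in> polys V" "D = \<pi> q" by (auto simp: car_\<pi>)
      show "l (C \<otimes>\<^bsub>?R\<^esub> D) = l C \<otimes>\<^bsub>?S\<^esub> l D"
        using p q s_polys by (simp add: \<pi>_simps \<kappa>_simps l polys_closed polys_Suc)
      show "l (C \<oplus>\<^bsub>?R\<^esub> D) = l C \<oplus>\<^bsub>?S\<^esub> l D"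
        using p q s_polys by (simp add: \<pi>_simps \<kappa>_simps l polys_closed polys_Suc)
    next
      fix C assume "C \<in> carrier (?R)"
      then show "l C \<in> carrier (?S)" using s_polys by (auto simp: car_\<pi> car_\<kappa> l polys_Suc)
    next
      show "l \<one>\<^bsub>?R\<^esub> = \<one>\<^bsub>?S\<^esub>" by (simp add: \<pi>_units \<kappa>_units l polys_closed)
    qed
    have mN: "(mvar N :: (nat, 'k) mpoly) \<in> polys {..<Suc N}" by (simp add: polys_closed)
    have gS: "g \<in> polys {..<Suc N}" by (rule polys_Suc[OF g(1)])
    have "\<kappa> (g * mvar N) = \<kappa> 1"
      using new_J gS mN by (simp add: \<kappa>_eq J polys_closed)
    then have "\<kappa> g \<otimes>\<^bsub>?S\<^esub> \<kappa> (mvar N) = \<one>\<^bsub>?S\<^esub>"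
      "\<kappa> (mvar N) \<otimes>\<^bsub>?S\<^esub> \<kappa> g = \<one>\<^bsub>?S\<^esub>"
      using gS mN by (simp_all add: \<kappa>_simps \<kappa>_units mult.commute)
    then show "l h \<in> Units (?S)"
      unfolding l_h Units_def using gS mN by (auto simp: car_\<kappa>)
  next
    fix C assume "C \<in> carrier (?S)"
    then obtain q where q: "q \<in> polys {..<Suc N}" "C = \<kappa> q" by (auto simp: car_\<kappa>)
    \<comment> \<open>Multiplying by a power of \<open>g\<close> absorbs every occurrence of
      \<open>mvar N\<close>, so each element of the larger quotient becomes a polynomial in the old
      variables. For sums the two fractions are brought to a common denominator.\<close>
    have "\<exists>a\<in>polys {..<N}. \<exists>k. q * g ^ k - a \<in> idl.span F"
      using q(1)
    proof (induction q rule: mpoly_ring_induct)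
      case (mconst a)
      then show ?case by (intro bexI[of _ "mconst a"] exI[of _ 0]) (auto simp: idl.span_zero intro: polys_closed)
    next
      case (mvar v)
      show ?case
      proof (cases "v < N")
        case True
        then show ?thesis by (intro bexI[of _ "mvar v"] exI[of _ 0]) (auto simp: idl.span_zero intro: polys_closed)
      next
        case False
        then have "v = N" using mvar by simp
        then show ?thesis using new_J
          by (intro bexI[of _ 1] exI[of _ 1]) (auto simp: mult.commute intro: polys_closed)
      qed
    next
      case (add p q)
      then obtain a b i j where a: "a \<in> polys {..<N}" "p * g ^ i - a \<in> idl.span F"
        and b: "b \<in> polys {..<N}" "q * g ^ j - b \<in> idl.span F" by blast
      have "g ^ j * (p * g ^ i - a) + g ^ i * (q * g ^ j - b) \<in> idl.span F"
        using a b by (intro idl.span_add idl.span_scale)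
      moreover have "g ^ j * (p * g ^ i - a) + g ^ i * (q * g ^ j - b) =
          (p + q) * g ^ (i + j) - (g ^ j * a + g ^ i * b)"
        by (simp add: algebra_simps power_add)
      ultimately have "(p + q) * g ^ (i + j) - (g ^ j * a + g ^ i * b) \<in> idl.span F" by simp
      moreover have "g ^ j * a + g ^ i * b \<in> polys {..<N}" using a b g(1) by (intro polys_closed)
      ultimately show ?case by blast
    next
      case (mult p q)
      then obtain a b i j where a: "a \<in> polys {..<N}" "p * g ^ i - a \<in> idl.span F"
        and b: "b \<in> polys {..<N}" "q * g ^ j - b \<in> idl.span F" by blast
      have "(q * g ^ j) * (p * g ^ i - a) + a * (q * g ^ j - b) \<in> idl.span F"
        using a b by (intro idl.span_add idl.span_scale)
      moreover have "(q * g ^ j) * (p * g ^ i - a) + a * (q * g ^ j - b) = (p * q) * g ^ (i + j) - a * b"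
        by (simp add: algebra_simps power_add)
      ultimately have "(p * q) * g ^ (i + j) - a * b \<in> idl.span F" by simp
      moreover have "a * b \<in> polys {..<N}" using a b by (intro polys_closed)
      ultimately show ?case by blast
    qed
    then obtain a k where a: "a \<in> polys {..<N}" "q * g ^ k - a \<in> idl.span F" by blast
    have gk: "g ^ k \<in> polys {..<Suc N}" by (rule is_subring_power[OF is_subring_polys, OF polys_Suc[OF g(1)]])
    have qgk: "q * g ^ k \<in> polys {..<Suc N}" by (rule mpoly_ring_closed(6)[OF q(1) gk])
    have "C \<otimes>\<^bsub>?S\<^esub> l h [^]\<^bsub>?S\<^esub> k = \<kappa> (q * g ^ k)"
      using q gk by (simp add: l_h \<kappa>_pow polys_Suc g \<kappa>_simps)
    also have "\<dots> = \<kappa> a"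
    proof -
      have "q * g ^ k - a \<in> polys {..<Suc N}" by (rule mpoly_ring_closed(4)[OF qgk polys_Suc[OF a(1)]])
      then show ?thesis using a qgk by (simp add: \<kappa>_eq polys_Suc J)
    qed
    also have "\<dots> = l (\<pi> (subst u a))" using l_u[OF a(1)] by simp
    finally show "\<exists>r\<in>carrier (?R). \<exists>m. C \<otimes>\<^bsub>?S\<^esub> l h [^]\<^bsub>?S\<^esub> (m::nat) = l r"
      using u_polys[OF a(1)] by (auto simp: car_\<pi>)
  next
    fix r assume "r \<in> carrier (?R)" and zero: "l r = \<zero>\<^bsub>?S\<^esub>"
    then obtain p where p: "p \<in> polys V" "r = \<pi> p" by (auto simp: car_\<pi>)
    have sp: "subst s p \<in> polys {..<N}" by (rule s_polys[OF p(1)])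
    have "(0 :: (nat, 'k) mpoly) \<in> polys {..<Suc N}" by (rule polys_closed)
    then have "subst s p \<in> J" using zero sp unfolding p(2) l[OF p(1)] \<kappa>_units(2) by (simp add: \<kappa>_eq polys_Suc)
    then have "subst s p \<in> idl.span (insert (g * mvar N - 1) (f ` {..<c}))" by (simp add: J F_eq)
    \<comment> \<open>Eliminating the new variable gives a relation in the old variables. Pulled
      back along \<open>u\<close>, it shows that a power of the pullback of \<open>g\<close> kills
      \<open>p\<close> modulo \<open>Rel\<close>.\<close>
    then obtain k where k: "g ^ k * subst s p \<in> idl.span (f ` {..<c})"
      using clear_denominators[OF _ g(1) sp, of "f ` {..<c}"] fN by auto
    have "idl.span (f ` {..<c}) \<subseteq> idl.span I" using f by (intro idl.span_mono) auto
    then have "subst u (g ^ k * subst s p) \<in> idl.span Rel" using k u_span by blast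
    moreover have "subst u (g ^ k) = subst u g ^ k" by (induction k) simp_all
    ultimately have "subst u g ^ k * subst u (subst s p) \<in> idl.span Rel" by simp
    then have "subst u g ^ k * subst u (subst s p) - subst u g ^ k * (subst u (subst s p) - p) \<in> idl.span Rel"
      by (rule idl.span_diff[OF _ idl.span_scale[OF us'[OF p(1)]]])
    then have m: "subst u g ^ k * p \<in> idl.span Rel" by (simp add: algebra_simps)
    have ugk: "subst u g ^ k \<in> polys V" by (rule is_subring_power[OF is_subring_polys, OF u_polys[OF g(1)]])
    have ugkp: "subst u g ^ k * p \<in> polys V" by (rule mpoly_ring_closed(6)[OF ugk p(1)])
    have "(0 :: ('v, 'k) mpoly) \<in> polys V" by (rule polys_closed)
    then have "h [^]\<^bsub>?R\<^esub> k \<otimes>\<^bsub>?R\<^esub> r = \<zero>\<^bsub>?R\<^esub>"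
      unfolding h_def p(2) \<pi>_pow[OF u_polys[OF g(1)]] \<pi>_simps(1)[OF ugk p(1)] \<pi>_units(2)
      using m ugkp by (simp add: \<pi>_eq J0)
    then show "\<exists>m::nat. h [^]\<^bsub>?R\<^esub> m \<otimes>\<^bsub>?R\<^esub> r = \<zero>\<^bsub>?R\<^esub>" by blast
  qed
  have jac: "\<forall>i<Suc c. w i = 0"
    if w: "\<forall>j<Suc N. (\<Sum>i<Suc c. w i * peval t (mpoly_deriv j (fs i))) = 0" for w
  proof -
    \<comment> \<open>The Jacobian is block triangular: the column of \<open>mvar N\<close> is zero
      in the rows of the \<open>f i\<close>, and in the row of \<open>g * mvar N - 1\<close> it is
      the value of \<open>g\<close> at the origin, which is 1. So the last coefficient of a row
      relation vanishes, and the other columns show the linear parts of the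
      \<open>f i\<close>.\<close>
    have deriv_1: "peval t (mpoly_deriv N 1) = 0"
      by (rule mpoly_eval_deriv_absent[of 1 "{..<N}"]) (auto intro: polys_closed)
    have "peval t (mpoly_deriv N (g * mvar N)) = 1"
      using mpoly_eval_deriv_mult_new_variable[OF g(1), of N t] eval_t[OF g(1)] g(2) by simp
    then have last: "peval t (mpoly_deriv N (fs c)) = 1"
      unfolding fs_def mpoly_eval_deriv_diff deriv_1 by (simp add: fs_def mpoly_eval_deriv_diff deriv_1)
    have old: "peval t (mpoly_deriv N (fs i)) = 0" if "i < c" for i
      using mpoly_eval_deriv_absent[OF fN[OF that], of N t] that by (simp add: fs_def)
    have "(\<Sum>i<c. w i * peval t (mpoly_deriv N (fs i))) = 0"
      by (rule sum.neutral) (simp add: old)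
    then have wc: "w c = 0" using w[rule_format, of N] last by (simp del: One_nat_def)
    have "(\<Sum>i<c. w i * lookup (f i) (single j 1)) = 0" if "j < N" for j
    proof -
      have "(\<Sum>i<c. w i * peval t (mpoly_deriv j (fs i))) = 0"
        using w[rule_format, of j] that wc by simp
      moreover have "peval t (mpoly_deriv j (fs i)) = lookup (f i) (single j 1)"
        if "i < c" for i
        using mpoly_eval_deriv_origin[OF fN[OF that], of j t] \<open>j < N\<close> that by (simp add: fs_def t_def)
      ultimately show ?thesis by simp
    qed
    then show ?thesis using indep[of w] wc by (auto simp: less_Suc_eq)
  qed
  have h_car: "h \<in> carrier (?R)" unfolding h_def car_\<pi> using u_polys[OF g(1)] by blast
  have x_h: "the_elem (peval pt ` h) \<noteq> 0"
  proof -
    have "the_elem (peval pt ` h) = lookup (subst s (subst u g)) 0"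
      unfolding h_def by (simp only: point[OF u_polys[OF g(1)]] peval_s[OF u_polys[OF g(1)]])
    moreover have "lookup (subst s (subst u g) - g) 0 = 0"
      using su'[OF g(1)] span_I_ord by (auto simp flip: in_ordge_1_iff)
    ultimately show ?thesis using g(2) by (simp add: lookup_minus)
  qed
  have l_const: "l (\<pi> (mconst a)) = \<kappa> (mconst a)" for a by (simp add: l polys_closed)
  have points: "the_elem (peval pt ` r) = peval t p" if "r \<in> carrier (?R)" "p \<in> l r" for r p
  proof -
    from that(1) obtain q where q: "q \<in> polys V" "r = \<pi> q" by (auto simp: car_\<pi>)
    from that(2) obtain j where j: "j \<in> J" "p = j + subst s q"
      unfolding q(2) l[OF q(1)] \<kappa>_def by (auto simp: mem_coset_mpoly_ring[OF J_ideal])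
    have "peval t p = peval t (subst s q)" unfolding j(2) by (simp only: peval_add eval_J[OF j(1)] add_0)
    also have "\<dots> = peval pt q" using eval_t[OF s_polys[OF q(1)]] peval_s[OF q(1)] by simp
    finally show ?thesis unfolding q(2) using point[OF q(1)] by simp
  qed
  show ?thesis
    unfolding smooth_point_def Let_def \<pi>_def[symmetric]
  proof (rule bexI[OF _ h_car], rule conjI, rule x_h, rule exI[of _ "Suc N"], rule exI[of _ "Suc c"],
      rule exI[of _ fs], rule exI[of _ t], rule exI[of _ l], intro conjI)
    show "localization_away (?R) h (?Q Quot (genideal ?Q (fs ` {..<Suc c}))) l"
      using loc unfolding J_def F_def .
    show "\<forall>a. l (\<pi> (mconst a)) = genideal ?Q (fs ` {..<Suc c}) +>\<^bsub>?Q\<^esub> mconst a"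
      using l_const unfolding \<kappa>_def J_def F_def by blast
    show "\<forall>i<Suc c. fs i \<in> polys {..<Suc N}" using fs by blast
    show "\<forall>i<Suc c. peval t (fs i) = 0" using eval_fs by blast
    show "\<forall>r\<in>carrier (?R). \<forall>p\<in>l r. the_elem (peval pt ` r) = peval t p" using points by blast
    show "\<forall>w. (\<forall>j<Suc N. (\<Sum>i<Suc c. w i * peval t (mpoly_deriv j (fs i))) = 0) \<longrightarrow> (\<forall>i<Suc c. w i = 0)"
      using jac by blast
  qed
qed

section \<open>Maps from the second syzygy\<close>

context left_module
begin

lemma smult_l_null [simp]: "x \<in> carrier M \<Longrightarrow> \<zero> \<odot>\<^bsub>M\<^esub> x = \<zero>\<^bsub>M\<^esub>"
proof -
  assume x: "x \<in> carrier M"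
  have "\<zero> \<odot>\<^bsub>M\<^esub> x \<oplus>\<^bsub>M\<^esub> \<zero> \<odot>\<^bsub>M\<^esub> x = \<zero> \<odot>\<^bsub>M\<^esub> x"
    using smult_l_distr[of \<zero> \<zero> x] x by simp
  then show ?thesis using x by (metis M.add.r_cancel_one R.zero_closed smult_closed)
qed

lemma smult_r_null [simp]: "a \<in> carrier R \<Longrightarrow> a \<odot>\<^bsub>M\<^esub> \<zero>\<^bsub>M\<^esub> = \<zero>\<^bsub>M\<^esub>"
proof -
  assume a: "a \<in> carrier R"
  have "a \<odot>\<^bsub>M\<^esub> \<zero>\<^bsub>M\<^esub> \<oplus>\<^bsub>M\<^esub> a \<odot>\<^bsub>M\<^esub> \<zero>\<^bsub>M\<^esub> = a \<odot>\<^bsub>M\<^esub> \<zero>\<^bsub>M\<^esub>"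
    using smult_r_distr[of a "\<zero>\<^bsub>M\<^esub>" "\<zero>\<^bsub>M\<^esub>"] a by simp
  then show ?thesis using a by (metis M.add.r_cancel_one M.zero_closed smult_closed)
qed

lemma finsum_smult:
  "finite S \<Longrightarrow> a \<in> carrier R \<Longrightarrow> h \<in> S \<rightarrow> carrier M \<Longrightarrow>
    a \<odot>\<^bsub>M\<^esub> finsum M h S = finsum M (\<lambda>x. a \<odot>\<^bsub>M\<^esub> h x) S"
  by (induction S rule: finite_induct) (auto simp: smult_r_distr Pi_iff)

end

section \<open>Free modules and the standard free cover\<close>

lemma (in abelian_monoid) finsum_additive:
  assumes "finite S" "h \<in> S \<rightarrow> carrier G" "\<phi> \<zero> = (0::'c::comm_monoid_add)"
    "\<And>x y. x \<in> carrier G \<Longrightarrow> y \<in> carrier G \<Longrightarrow> \<phi> (x \<oplus> y) = \<phi> x + \<phi> y"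
  shows "\<phi> (finsum G h S) = (\<Sum>x\<in>S. \<phi> (h x))"
  using assms(1,2) by (induction S rule: finite_induct) (auto simp: assms(3,4) Pi_iff)

lemma free_module_simps [simp]:
  "f \<in> carrier (free_module R B) \<longleftrightarrow>
     (\<forall>x. f x \<in> carrier R) \<and> finite {x. f x \<noteq> \<zero>\<^bsub>R\<^esub>} \<and> {x. f x \<noteq> \<zero>\<^bsub>R\<^esub>} \<subseteq> B"
  "f \<oplus>\<^bsub>free_module R B\<^esub> g = (\<lambda>x. f x \<oplus>\<^bsub>R\<^esub> g x)"
  "\<zero>\<^bsub>free_module R B\<^esub> = (\<lambda>_. \<zero>\<^bsub>R\<^esub>)"
  "a \<odot>\<^bsub>free_module R B\<^esub> f = (\<lambda>x. a \<otimes>\<^bsub>R\<^esub> f x)"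
  by (auto simp: free_module_def)

lemma left_module_free_module:
  fixes R (structure)
  assumes "ring R"
  shows "left_module R (free_module R B)"
proof -
  interpret ring R by fact
  have fin: "finite {x. f x \<oplus> g x \<noteq> \<zero>} \<and> {x. f x \<oplus> g x \<noteq> \<zero>} \<subseteq> B"
    if "f \<in> carrier (free_module R B)" "g \<in> carrier (free_module R B)" for f g
  proof -
    have "{x. f x \<oplus> g x \<noteq> \<zero>} \<subseteq> {x. f x \<noteq> \<zero>} \<union> {x. g x \<noteq> \<zero>}" using that by auto
    moreover have "finite ({x. f x \<noteq> \<zero>} \<union> {x. g x \<noteq> \<zero>})" using that by auto
    moreover have "{x. f x \<noteq> \<zero>} \<union> {x. g x \<noteq> \<zero>} \<subseteq> B" using that by auto
    ultimately show ?thesis by (meson finite_subset order_trans)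
  qed
  have fin': "finite {x. a \<otimes> f x \<noteq> \<zero>} \<and> {x. a \<otimes> f x \<noteq> \<zero>} \<subseteq> B"
    if "a \<in> carrier R" "f \<in> carrier (free_module R B)" for a f
  proof -
    have "{x. a \<otimes> f x \<noteq> \<zero>} \<subseteq> {x. f x \<noteq> \<zero>}" using that by auto
    then show ?thesis using that by (auto intro: finite_subset)
  qed
  interpret F: abelian_group "free_module R B"
  proof (rule abelian_groupI)
    fix f assume f: "f \<in> carrier (free_module R B)"
    have "\<ominus> y = \<zero> \<longleftrightarrow> y = \<zero>" if "y \<in> carrier R" for y
      using that by (metis minus_minus minus_zero)
    then have "{x. \<ominus> f x \<noteq> \<zero>} = {x. f x \<noteq> \<zero>}" using f by auto
    then show "\<exists>g\<in>carrier (free_module R B). g \<oplus>\<^bsub>free_module R B\<^esub> f = \<zero>\<^bsub>free_module R B\<^esub>"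
      using f by (intro bexI[of _ "\<lambda>x. \<ominus> f x"]) (auto simp: l_neg)
  next
    fix f g assume "f \<in> carrier (free_module R B)" "g \<in> carrier (free_module R B)"
    then show "f \<oplus>\<^bsub>free_module R B\<^esub> g \<in> carrier (free_module R B)" using fin[of f g] by auto
  qed (auto simp: a_ac)
  show ?thesis
  proof unfold_locales
    fix a f assume "a \<in> carrier R" "f \<in> carrier (free_module R B)"
    then show "a \<odot>\<^bsub>free_module R B\<^esub> f \<in> carrier (free_module R B)" using fin'[of a f] by auto
  qed (auto simp: l_distr r_distr m_assoc)
qed

definition delta :: "('r, 's) ring_scheme \<Rightarrow> 'x \<Rightarrow> 'x \<Rightarrow> 'r" where
  "delta R x = (\<lambda>y. if y = x then \<one>\<^bsub>R\<^esub> else \<zero>\<^bsub>R\<^esub>)"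

lemma delta_in_free_module:
  fixes R (structure)
  assumes "ring R" "x \<in> B"
  shows "delta R x \<in> carrier (free_module R B)"
proof -
  interpret ring R by fact
  have "{y. delta R x y \<noteq> \<zero>} \<subseteq> {x}" by (auto simp: delta_def)
  then show ?thesis using assms(2) by (auto simp: delta_def intro: finite_subset)
qed

lemma free_cover_superset:
  assumes "left_module R M" "f \<in> carrier (free_module R B)"
    "finite S" "S \<subseteq> carrier M" "{x. f x \<noteq> \<zero>\<^bsub>R\<^esub>} \<subseteq> S"
  shows "free_cover R M B f = finsum M (\<lambda>x. f x \<odot>\<^bsub>M\<^esub> x) S"
proof -
  interpret left_module R M by fact
  have "finsum M (\<lambda>x. f x \<odot>\<^bsub>M\<^esub> x) {x. f x \<noteq> \<zero>\<^bsub>R\<^esub>} = finsum M (\<lambda>x. f x \<odot>\<^bsub>M\<^esub> x) S"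
    by (rule M.add.finprod_mono_neutral_cong_left) (use assms in auto)
  then show ?thesis using assms(2) by (simp add: free_cover_def)
qed

lemma free_cover_delta:
  assumes "left_module R M" "B \<subseteq> carrier M" "x \<in> B"
  shows "free_cover R M B (delta R x) = x"
proof -
  interpret left_module R M by fact
  have "x \<in> carrier M" using assms by auto
  moreover have "free_cover R M B (delta R x) = finsum M (\<lambda>y. delta R x y \<odot>\<^bsub>M\<^esub> y) {x}"
    using assms calculation R.ring_axioms
    by (intro free_cover_superset delta_in_free_module) (auto simp: delta_def)
  ultimately show ?thesis by (simp add: delta_def)
qed

lemma free_cover_lin_maps:
  fixes R (structure)
  assumes "left_module R M" and B: "B \<subseteq> carrier M"
  shows "free_cover R M B \<in> lin_maps R (free_module R B) M"
proof -
  interpret left_module R M by fact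
  interpret F: left_module R "free_module R B" by (rule left_module_free_module[OF R.ring_axioms])
  have sup: "free_cover R M B f = finsum M (\<lambda>x. f x \<odot>\<^bsub>M\<^esub> x) S"
    if "f \<in> carrier (free_module R B)" "finite S" "S \<subseteq> carrier M" "{x. f x \<noteq> \<zero>} \<subseteq> S" for f S
    using free_cover_superset[OF assms(1)] that .
  have supp: "finite {x. f x \<noteq> \<zero>}" "{x. f x \<noteq> \<zero>} \<subseteq> carrier M" "f x \<in> carrier R"
    if "f \<in> carrier (free_module R B)" for f x using that B by auto
  show ?thesis unfolding lin_maps_def
  proof (intro CollectI conjI ballI)
    show "free_cover R M B \<in> carrier (free_module R B) \<rightarrow>\<^sub>E carrier M"
    proof (rule PiE_I)
      fix f assume f: "f \<in> carrier (free_module R B)"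
      note s = supp[OF f]
      show "free_cover R M B f \<in> carrier M"
        unfolding sup[OF f s(1,2) order_refl] using s by (intro M.finsum_closed) auto
    qed (simp add: free_cover_def del: free_module_simps)
    fix f assume f: "f \<in> carrier (free_module R B)"
    note s = supp[OF f]
    {
      fix g assume g: "g \<in> carrier (free_module R B)"
      note s' = supp[OF g]
      let ?S = "{x. f x \<noteq> \<zero>} \<union> {x. g x \<noteq> \<zero>}"
      have S: "finite ?S" "?S \<subseteq> carrier M" using s s' by auto
      have "{x. (f \<oplus>\<^bsub>free_module R B\<^esub> g) x \<noteq> \<zero>} \<subseteq> ?S" by auto
      note sup[OF F.a_closed[OF f g] S this]
      also have "finsum M (\<lambda>x. (f \<oplus>\<^bsub>free_module R B\<^esub> g) x \<odot>\<^bsub>M\<^esub> x) ?S =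
          finsum M (\<lambda>x. f x \<odot>\<^bsub>M\<^esub> x \<oplus>\<^bsub>M\<^esub> g x \<odot>\<^bsub>M\<^esub> x) ?S"
        by (rule M.finsum_cong'[OF refl]) (use s(3) s'(3) S in \<open>auto simp: subset_iff smult_l_distr\<close>)
      also have "\<dots> = finsum M (\<lambda>x. f x \<odot>\<^bsub>M\<^esub> x) ?S \<oplus>\<^bsub>M\<^esub> finsum M (\<lambda>x. g x \<odot>\<^bsub>M\<^esub> x) ?S"
        using s s' S by (intro M.finsum_addf) auto
      finally show "free_cover R M B (f \<oplus>\<^bsub>free_module R B\<^esub> g) =
          free_cover R M B f \<oplus>\<^bsub>M\<^esub> free_cover R M B g"
        by (simp only: sup[OF f S Un_upper1] sup[OF g S Un_upper2])
    }
    {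
      fix a assume a: "a \<in> carrier R"
      have "{x. (a \<odot>\<^bsub>free_module R B\<^esub> f) x \<noteq> \<zero>} \<subseteq> {x. f x \<noteq> \<zero>}" using a by auto
      note sup[OF F.smult_closed[OF a f] s(1,2) this]
      also have "finsum M (\<lambda>x. (a \<odot>\<^bsub>free_module R B\<^esub> f) x \<odot>\<^bsub>M\<^esub> x) {x. f x \<noteq> \<zero>} =
          finsum M (\<lambda>x. a \<odot>\<^bsub>M\<^esub> (f x \<odot>\<^bsub>M\<^esub> x)) {x. f x \<noteq> \<zero>}"
        by (rule M.finsum_cong'[OF refl]) (use s a in \<open>auto simp: subset_iff smult_assoc\<close>)
      also have "\<dots> = a \<odot>\<^bsub>M\<^esub> finsum M (\<lambda>x. f x \<odot>\<^bsub>M\<^esub> x) {x. f x \<noteq> \<zero>}"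
        using s a by (intro finsum_smult[symmetric]) auto
      finally show "free_cover R M B (a \<odot>\<^bsub>free_module R B\<^esub> f) = a \<odot>\<^bsub>M\<^esub> free_cover R M B f"
        by (simp only: sup[OF f s(1,2) order_refl])
    }
  qed
qed

lemma lin_mapsD:
  assumes "\<phi> \<in> lin_maps R M N"
  shows "x \<in> carrier M \<Longrightarrow> \<phi> x \<in> carrier N"
    "x \<in> carrier M \<Longrightarrow> y \<in> carrier M \<Longrightarrow> \<phi> (x \<oplus>\<^bsub>M\<^esub> y) = \<phi> x \<oplus>\<^bsub>N\<^esub> \<phi> y"
    "a \<in> carrier R \<Longrightarrow> x \<in> carrier M \<Longrightarrow> \<phi> (a \<odot>\<^bsub>M\<^esub> x) = a \<odot>\<^bsub>N\<^esub> \<phi> x"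
    "\<phi> \<in> extensional (carrier M)"
  using assms unfolding lin_maps_def by (auto simp: PiE_def)

lemma lin_maps_zero:
  assumes "left_module R M" "left_module R N" "\<phi> \<in> lin_maps R M N"
  shows "\<phi> \<zero>\<^bsub>M\<^esub> = \<zero>\<^bsub>N\<^esub>"
proof -
  interpret M: left_module R M by fact
  interpret N: left_module R N by fact
  have "\<phi> (\<zero>\<^bsub>R\<^esub> \<odot>\<^bsub>M\<^esub> \<zero>\<^bsub>M\<^esub>) = \<zero>\<^bsub>R\<^esub> \<odot>\<^bsub>N\<^esub> \<phi> \<zero>\<^bsub>M\<^esub>"
    using lin_mapsD(3)[OF assms(3)] by blast
  then show ?thesis using lin_mapsD(1)[OF assms(3)] by simp
qed

lemma submodule_a_kernel:
  assumes "left_module R M" "left_module R N" and \<phi>: "\<phi> \<in> lin_maps R M N"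
  shows "submodule (a_kernel M N \<phi>) R M"
proof -
  interpret M: left_module R M by fact
  interpret N: left_module R N by fact
  note l = lin_mapsD[OF \<phi>] and z = lin_maps_zero[OF assms]
  have minus: "\<phi> (\<ominus>\<^bsub>M\<^esub> x) = \<zero>\<^bsub>N\<^esub>" if "x \<in> carrier M" "\<phi> x = \<zero>\<^bsub>N\<^esub>" for x
    using l(2)[of "\<ominus>\<^bsub>M\<^esub> x" x] l(1)[of "\<ominus>\<^bsub>M\<^esub> x"] that z by (simp add: M.M.l_neg)
  show ?thesis
  proof
    show "inv\<^bsub>add_monoid M\<^esub> x \<in> a_kernel M N \<phi>" if "x \<in> a_kernel M N \<phi>" for x
      using that minus[of x] M.M.a_inv_closed[of x] by (auto simp: a_kernel_def' a_inv_def)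
  qed (auto simp: a_kernel_def' l z)
qed

lemma free_cover_in_submodule:
  assumes "left_module R M" and K: "submodule K R M" and f: "f \<in> carrier (free_module R K)"
  shows "free_cover R M K f \<in> K"
proof -
  interpret left_module R M by fact
  interpret K: submodule K R M by fact
  have sub: "K \<subseteq> carrier M" using K.subset by simp
  have "finsum M (\<lambda>x. f x \<odot>\<^bsub>M\<^esub> x) S \<in> K" if "finite S" "S \<subseteq> K" for S
    using that
  proof (induction S rule: finite_induct)
    case empty
    then show ?case using K.one_closed by simp
  next
    case (insert x S)
    have "f y \<in> carrier R" for y using f by simp
    then show ?case using insert sub K.smult_closed[of "f x" x] K.m_closed
      by (subst M.finsum_insert) (auto simp: subset_iff)
  qed
  then show ?thesis using f by (simp add: free_cover_def)
qed

text \<open>Dimension shifting: the second extension group is the cokernel of the restriction from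
  maps on \<open>F1\<close> to maps on the second syzygy \<open>K1\<close>. Composed with the cover
  of \<open>K1\<close>, the map \<open>z\<close> becomes a cocycle, hence a coboundary; the cover is
  onto \<open>K1\<close>, so the cochain on \<open>F1\<close> restricts to \<open>z\<close>.\<close>

lemma extend_from_second_syzygy:
  assumes M: "left_module R M" and N: "left_module R N" and triv: "trivial_group (Ext2 R M N)"
  defines "F0 \<equiv> free_module R (carrier M)"
  defines "K0 \<equiv> a_kernel F0 M (free_cover R M (carrier M))"
  defines "F1 \<equiv> free_module R K0"
  defines "K1 \<equiv> a_kernel F1 F0 (free_cover R F0 K0)"
  assumes z: "\<And>x. x \<in> K1 \<Longrightarrow> z x \<in> carrier N"
    "\<And>x y. x \<in> K1 \<Longrightarrow> y \<in> K1 \<Longrightarrow> z (x \<oplus>\<^bsub>F1\<^esub> y) = z x \<oplus>\<^bsub>N\<^esub> z y"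
    "\<And>a x. a \<in> carrier R \<Longrightarrow> x \<in> K1 \<Longrightarrow> z (a \<odot>\<^bsub>F1\<^esub> x) = a \<odot>\<^bsub>N\<^esub> z x"
  obtains \<psi> where "\<psi> \<in> lin_maps R F1 N" "\<And>x. x \<in> K1 \<Longrightarrow> \<psi> x = z x"
proof -
  interpret M: left_module R M by fact
  interpret N: left_module R N by fact
  note R = M.R.ring_axioms
  have F0: "left_module R F0" unfolding F0_def by (rule left_module_free_module[OF R])
  have F1: "left_module R F1" unfolding F1_def by (rule left_module_free_module[OF R])
  have d0: "free_cover R M (carrier M) \<in> lin_maps R F0 M"
    unfolding F0_def by (rule free_cover_lin_maps[OF M]) simp
  have K0: "submodule K0 R F0" unfolding K0_def by (rule submodule_a_kernel[OF F0 M d0])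
  have K0s: "K0 \<subseteq> carrier F0" by (auto simp: K0_def a_kernel_def')
  have d1: "free_cover R F0 K0 \<in> lin_maps R F1 F0"
    unfolding F1_def by (rule free_cover_lin_maps[OF F0 K0s])
  have K1: "submodule K1 R F1" unfolding K1_def by (rule submodule_a_kernel[OF F1 F0 d1])
  have K1s: "K1 \<subseteq> carrier F1" by (auto simp: K1_def a_kernel_def')
  define F2 where "F2 = free_module R K1"
  define d2 where "d2 = free_cover R F1 K1"
  have F2: "left_module R F2" unfolding F2_def by (rule left_module_free_module[OF R])
  have d2: "d2 \<in> lin_maps R F2 F1"
    unfolding F2_def d2_def by (rule free_cover_lin_maps[OF F1 K1s])
  have d2K: "d2 x \<in> K1" if "x \<in> carrier F2" for x
    using free_cover_in_submodule[OF F1 K1] that by (simp add: F2_def d2_def)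
  define K2 where "K2 = a_kernel F2 F1 d2"
  have K2: "submodule K2 R F2" unfolding K2_def by (rule submodule_a_kernel[OF F2 F1 d2])
  define F3 where "F3 = free_module R K2"
  define d3 where "d3 = free_cover R F2 K2"
  have d3K: "d3 x \<in> K2" if "x \<in> carrier F3" for x
    using free_cover_in_submodule[OF F2 K2] that by (simp add: F3_def d3_def)
  define Z where "Z = kernel (hom_group R F2 N) (hom_group R F3 N) (\<lambda>\<phi>. compose (carrier F3) \<phi> d3)"
  define B where "B = (\<lambda>\<psi>. compose (carrier F2) \<psi> d2) ` carrier (hom_group R F1 N)"
  define G where "G = (hom_group R F2 N)\<lparr>carrier := Z\<rparr>"
  have "Ext2 R M N = G Mod B"
    unfolding Ext2_def Let_def G_def Z_def B_def F3_def d3_def K2_def F2_def d2_def K1_def F1_def K0_def F0_def ..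
  \<comment> \<open>The unit of the quotient is the coset \<open>B\<close>, so triviality says that
    \<open>B\<close> is the only coset.\<close>
  then have coset: "rcosets\<^bsub>G\<^esub> B = {B}" using triv by (simp add: trivial_group_def FactGroup_def)
  interpret F1: left_module R F1 by (rule F1)
  interpret F2: left_module R F2 by (rule F2)
  have z0: "z \<zero>\<^bsub>F1\<^esub> = \<zero>\<^bsub>N\<^esub>"
  proof -
    have "\<zero>\<^bsub>F1\<^esub> \<in> K1" using submodule.axioms(1)[OF K1] subgroup.one_closed by fastforce
    then have "z \<zero>\<^bsub>F1\<^esub> \<in> carrier N" "z \<zero>\<^bsub>F1\<^esub> \<oplus>\<^bsub>N\<^esub> z \<zero>\<^bsub>F1\<^esub> = z \<zero>\<^bsub>F1\<^esub>"
      using z(1,2)[of "\<zero>\<^bsub>F1\<^esub>"] by (simp_all flip: z(2))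
    then show ?thesis by (metis N.M.add.r_cancel_one)
  qed
  define zz where "zz = (\<lambda>x\<in>carrier F2. z (d2 x))"
  have zz_lin: "zz \<in> lin_maps R F2 N"
    unfolding lin_maps_def zz_def using d2K by (auto simp: z lin_mapsD[OF d2])
  have "compose (carrier F3) zz d3 = (\<lambda>x\<in>carrier F3. \<zero>\<^bsub>N\<^esub>)"
  proof (rule extensionalityI)
    fix x assume x: "x \<in> carrier F3"
    have "d3 x \<in> carrier F2" "d2 (d3 x) = \<zero>\<^bsub>F1\<^esub>" using d3K[OF x] by (auto simp: K2_def a_kernel_def')
    then show "compose (carrier F3) zz d3 x = (\<lambda>x\<in>carrier F3. \<zero>\<^bsub>N\<^esub>) x"
      using x z0 by (simp add: compose_def zz_def)
  qed auto
  then have "zz \<in> Z" using zz_lin by (simp add: Z_def kernel_def hom_group_def)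
  then have "B #>\<^bsub>G\<^esub> zz \<in> rcosets\<^bsub>G\<^esub> B" by (auto simp: RCOSETS_def G_def)
  then have coset_zz: "B #>\<^bsub>G\<^esub> zz = B" using coset by simp
  have "(\<lambda>x\<in>carrier F1. \<zero>\<^bsub>N\<^esub>) \<in> lin_maps R F1 N" by (auto simp: lin_maps_def)
  moreover have "compose (carrier F2) (\<lambda>x\<in>carrier F1. \<zero>\<^bsub>N\<^esub>) d2 = (\<lambda>x\<in>carrier F2. \<zero>\<^bsub>N\<^esub>)"
    using lin_mapsD(1)[OF d2] by (auto simp: compose_def)
  ultimately have zB: "(\<lambda>x\<in>carrier F2. \<zero>\<^bsub>N\<^esub>) \<in> B" by (auto simp: B_def hom_group_def intro: rev_image_eqI)
  \<comment> \<open>Since the zero map belongs to \<open>B\<close>, this puts \<open>zz\<close> into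
    its own coset without first showing that \<open>B\<close> is a subgroup.\<close>
  have "zz = (\<lambda>x\<in>carrier F2. \<zero>\<^bsub>N\<^esub>) \<otimes>\<^bsub>G\<^esub> zz"
  proof (rule extensionalityI[OF lin_mapsD(4)[OF zz_lin]])
    fix x assume "x \<in> carrier F2"
    then show "zz x = ((\<lambda>x\<in>carrier F2. \<zero>\<^bsub>N\<^esub>) \<otimes>\<^bsub>G\<^esub> zz) x"
      using lin_mapsD(1)[OF zz_lin, of x] by (simp add: G_def hom_group_def)
  qed (simp add: G_def hom_group_def)
  then have "zz \<in> B #>\<^bsub>G\<^esub> zz" using zB unfolding r_coset_def by blast
  then obtain \<psi> where \<psi>: "\<psi> \<in> lin_maps R F1 N" "zz = compose (carrier F2) \<psi> d2"
    unfolding coset_zz by (auto simp: B_def hom_group_def)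
  have "\<psi> x = z x" if x: "x \<in> K1" for x
  proof -
    have c: "delta R x \<in> carrier F2" unfolding F2_def by (rule delta_in_free_module[OF R x])
    have d: "d2 (delta R x) = x" unfolding d2_def by (rule free_cover_delta[OF F1 K1s x])
    show ?thesis using fun_cong[OF \<psi>(2), of "delta R x"] c by (simp add: zz_def compose_def d)
  qed
  then show ?thesis using that \<psi>(1) by blast
qed

section \<open>Two-cocycles are coboundaries\<close>

definition supp_sum :: "('a, 's) ring_scheme \<Rightarrow> ('x \<Rightarrow> 'a \<Rightarrow> 'c) \<Rightarrow> ('x \<Rightarrow> 'a) \<Rightarrow> 'c::comm_monoid_add" where
  "supp_sum A h f = (\<Sum>x\<in>{x. f x \<noteq> \<zero>\<^bsub>A\<^esub>}. h x (f x))"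

lemma supp_sum_superset:
  assumes "finite S" "{x. f x \<noteq> \<zero>\<^bsub>A\<^esub>} \<subseteq> S" "\<And>x. x \<in> S \<Longrightarrow> h x \<zero>\<^bsub>A\<^esub> = 0"
  shows "supp_sum A h f = (\<Sum>x\<in>S. h x (f x))"
  unfolding supp_sum_def by (rule sum.mono_neutral_left) (use assms in auto)

lemma supp_sum_add:
  fixes A (structure)
  assumes "ring A" "f \<in> carrier (free_module A B)" "g \<in> carrier (free_module A B)"
    and h: "\<And>x. x \<in> B \<Longrightarrow> h x \<zero> = 0"
      "\<And>x a b. x \<in> B \<Longrightarrow> a \<in> carrier A \<Longrightarrow> b \<in> carrier A \<Longrightarrow> h x (a \<oplus> b) = h x a + h x b"
  shows "supp_sum A h (\<lambda>x. f x \<oplus> g x) = supp_sum A h f + supp_sum A h g"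
proof -
  interpret ring A by fact
  let ?S = "{x. f x \<noteq> \<zero>} \<union> {x. g x \<noteq> \<zero>}"
  have S: "finite ?S" "?S \<subseteq> B" using assms by auto
  have "{x. f x \<oplus> g x \<noteq> \<zero>} \<subseteq> ?S" by auto
  then have "supp_sum A h (\<lambda>x. f x \<oplus> g x) = (\<Sum>x\<in>?S. h x (f x \<oplus> g x))"
    using S h(1) by (intro supp_sum_superset) auto
  also have "\<dots> = (\<Sum>x\<in>?S. h x (f x) + h x (g x))"
    using S assms(2,3) by (intro sum.cong h) auto
  also have "\<dots> = supp_sum A h f + supp_sum A h g"
  proof -
    have "supp_sum A h k = (\<Sum>x\<in>?S. h x (k x))" if "{x. k x \<noteq> \<zero>} \<subseteq> ?S" for k
      using S h(1) that by (intro supp_sum_superset) auto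
    from this[of f] this[of g] show ?thesis by (auto simp: sum.distrib)
  qed
  finally show ?thesis .
qed

lemma matrix_vector_mult_sum: "A *v sum f S = (\<Sum>x\<in>S. A *v f x)"
  for A :: "'k::field^'n^'m"
  by (induction S rule: infinite_finite_induct) (auto simp: matrix_vector_right_distrib)

lemma mat_mult_vec: "mat t *v v = t *s v" for v :: "'k::field^'n"
  by (simp add: vec_eq_iff matrix_vector_mult_def mat_def if_distrib[of "\<lambda>x. x * _"] cong: if_cong)

lemma assoc_algebraD:
  assumes "assoc_algebra \<iota> A"
  shows "ring A" "\<iota> c \<in> carrier A" "a \<in> carrier A \<Longrightarrow> \<iota> c \<otimes>\<^bsub>A\<^esub> a = a \<otimes>\<^bsub>A\<^esub> \<iota> c"
    "\<iota> (c + d) = \<iota> c \<oplus>\<^bsub>A\<^esub> \<iota> d" "\<iota> (c * d) = \<iota> c \<otimes>\<^bsub>A\<^esub> \<iota> d" "\<iota> 1 = \<one>\<^bsub>A\<^esub>" "\<iota> 0 = \<zero>\<^bsub>A\<^esub>"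
proof -
  show r: "ring A" and "a \<in> carrier A \<Longrightarrow> \<iota> c \<otimes>\<^bsub>A\<^esub> a = a \<otimes>\<^bsub>A\<^esub> \<iota> c"
    using assms unfolding assoc_algebra_def by blast+
  have "\<iota> \<in> ring_hom univ_ring A" using assms unfolding assoc_algebra_def by blast
  then show c: "\<iota> c \<in> carrier A" and add: "\<iota> (c + d) = \<iota> c \<oplus>\<^bsub>A\<^esub> \<iota> d"
    and "\<iota> (c * d) = \<iota> c \<otimes>\<^bsub>A\<^esub> \<iota> d" "\<iota> 1 = \<one>\<^bsub>A\<^esub>" for c d
    by (auto simp: ring_hom_def univ_ring_def Pi_iff)
  interpret ring A by (rule r)
  have "\<iota> 0 \<oplus>\<^bsub>A\<^esub> \<iota> 0 = \<iota> 0" using add[of 0 0, symmetric] by simp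
  then show "\<iota> 0 = \<zero>\<^bsub>A\<^esub>" using add.l_cancel_one[of "\<iota> 0" "\<iota> 0"] c[of 0] by simp
qed

lemma rep_functorD:
  assumes "\<rho> \<in> rep_functor \<iota> A \<beta>"
  shows "a \<in> carrier A \<Longrightarrow> b \<in> carrier A \<Longrightarrow> \<rho> (a \<oplus>\<^bsub>A\<^esub> b) = \<rho> a + \<rho> b"
    "a \<in> carrier A \<Longrightarrow> b \<in> carrier A \<Longrightarrow> \<rho> (a \<otimes>\<^bsub>A\<^esub> b) = \<rho> a ** \<rho> b" "\<rho> (\<iota> c) = mat (\<beta> c)"
  using assms by (auto simp: rep_functor_def)

lemma module_frame_coords:
  fixes \<theta> :: "'k::field^'n \<Rightarrow> 'm"
  assumes A: "assoc_algebra \<iota> A" and M: "left_module A M" and fr: "module_frame \<iota> M \<theta>"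
  defines "\<tau> \<equiv> inv_into UNIV \<theta>"
  shows "\<theta> v \<in> carrier M" "\<tau> (\<theta> v) = v" "x \<in> carrier M \<Longrightarrow> \<theta> (\<tau> x) = x"
    "x \<in> carrier M \<Longrightarrow> y \<in> carrier M \<Longrightarrow> \<tau> (x \<oplus>\<^bsub>M\<^esub> y) = \<tau> x + \<tau> y" "\<tau> \<zero>\<^bsub>M\<^esub> = 0"
    "a \<in> carrier A \<Longrightarrow> x \<in> carrier M \<Longrightarrow> \<tau> (a \<odot>\<^bsub>M\<^esub> x) = rep_of_module A M \<theta> a *v \<tau> x"
proof -
  interpret left_module A M by fact
  note i = assoc_algebraD[OF A]
  have bij: "bij_betw \<theta> UNIV (carrier M)" using fr by (simp add: module_frame_def)
  show \<theta>c: "\<theta> v \<in> carrier M" for v using bij by (auto simp: bij_betw_def)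
  show \<tau>\<theta>: "\<tau> (\<theta> v) = v" for v unfolding \<tau>_def using bij by (auto simp: bij_betw_def)
  show \<theta>\<tau>: "\<theta> (\<tau> x) = x" if "x \<in> carrier M" for x
    unfolding \<tau>_def using bij that by (metis bij_betw_inv_into_right)
  have \<theta>: "\<theta> (u + v) = \<theta> u \<oplus>\<^bsub>M\<^esub> \<theta> v" "\<theta> (c *s v) = \<iota> c \<odot>\<^bsub>M\<^esub> \<theta> v" for u v c
    using fr by (auto simp: module_frame_def)
  show add: "\<tau> (x \<oplus>\<^bsub>M\<^esub> y) = \<tau> x + \<tau> y" if "x \<in> carrier M" "y \<in> carrier M" for x y
    using \<tau>\<theta>[of "\<tau> x + \<tau> y"] that by (simp add: \<theta> \<theta>\<tau>)
  show "\<tau> \<zero>\<^bsub>M\<^esub> = 0" using add[of "\<zero>\<^bsub>M\<^esub>" "\<zero>\<^bsub>M\<^esub>"] by simp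
  show "\<tau> (a \<odot>\<^bsub>M\<^esub> x) = rep_of_module A M \<theta> a *v \<tau> x" if a: "a \<in> carrier A" and x: "x \<in> carrier M"
  proof -
    have inj: "\<theta> u = \<theta> v \<Longrightarrow> u = v" for u v using \<tau>\<theta> by metis
    have "Vector_Spaces.linear (*s) (*s) (\<lambda>v. \<tau> (a \<odot>\<^bsub>M\<^esub> \<theta> v))"
    proof unfold_locales
      show "\<tau> (a \<odot>\<^bsub>M\<^esub> \<theta> (u + v)) = \<tau> (a \<odot>\<^bsub>M\<^esub> \<theta> u) + \<tau> (a \<odot>\<^bsub>M\<^esub> \<theta> v)" for u v
        using a \<theta>c by (simp add: \<theta> smult_r_distr add)
      show "\<tau> (a \<odot>\<^bsub>M\<^esub> \<theta> (c *s v)) = c *s \<tau> (a \<odot>\<^bsub>M\<^esub> \<theta> v)" for c v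
      proof (rule inj)
        have "a \<odot>\<^bsub>M\<^esub> (\<iota> c \<odot>\<^bsub>M\<^esub> \<theta> v) = \<iota> c \<odot>\<^bsub>M\<^esub> (a \<odot>\<^bsub>M\<^esub> \<theta> v)"
          using a \<theta>c i(2) i(3)[OF a, of c] by (metis smult_assoc)
        then show "\<theta> (\<tau> (a \<odot>\<^bsub>M\<^esub> \<theta> (c *s v))) = \<theta> (c *s \<tau> (a \<odot>\<^bsub>M\<^esub> \<theta> v))"
          using a \<theta>c i(2) by (simp add: \<theta> \<theta>\<tau>)
      qed
    qed
    from matrix_works[OF this, of "\<tau> x"] show ?thesis
      using a x by (simp add: rep_of_module_def \<theta>\<tau>[unfolded \<tau>_def] \<tau>_def)
  qed
qed

text \<open>A cocycle twists the action of \<open>A\<close> on \<open>M \<oplus> K\<^sub>0\<close>, where \<open>K\<^sub>0\<close> is the first syzygy of \<open>M\<close>; the twisted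
  module is an extension of \<open>K\<^sub>0\<close> by \<open>M\<close>, which splits because the obstruction lies in the second
  extension group. Restricting the splitting to the elements \<open>a \<cdot> v - 1 \<cdot> a v\<close> of the syzygy gives the
  cochain.\<close>

theorem cocycle_is_coboundary:
  fixes A :: "'a ring" (structure) and \<theta> :: "'k::field^'n \<Rightarrow> 'm" and c :: "'a \<Rightarrow> 'a \<Rightarrow> 'k^'n^'n"
  assumes A: "assoc_algebra \<iota> A" and M: "left_module A M" and fr: "module_frame \<iota> M \<theta>"
    and triv: "trivial_group (Ext2 A M M)"
  defines "\<rho> \<equiv> rep_of_module A M \<theta>"
  assumes c_add1: "\<And>a a' b. a \<in> carrier A \<Longrightarrow> a' \<in> carrier A \<Longrightarrow> b \<in> carrier A \<Longrightarrow>
      c (a \<oplus> a') b = c a b + c a' b"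
    and c_add2: "\<And>a b b'. a \<in> carrier A \<Longrightarrow> b \<in> carrier A \<Longrightarrow> b' \<in> carrier A \<Longrightarrow>
      c a (b \<oplus> b') = c a b + c a b'"
    and c_scale: "\<And>a b t i j. a \<in> carrier A \<Longrightarrow> b \<in> carrier A \<Longrightarrow> c a (\<iota> t \<otimes> b) $ i $ j = t * c a b $ i $ j"
    and c_unit: "\<And>t b. b \<in> carrier A \<Longrightarrow> c (\<iota> t) b = 0" "\<And>t b. b \<in> carrier A \<Longrightarrow> c b (\<iota> t) = 0"
    and cocycle: "\<And>a b d. a \<in> carrier A \<Longrightarrow> b \<in> carrier A \<Longrightarrow> d \<in> carrier A \<Longrightarrow>
      \<rho> a ** c b d + c a (b \<otimes> d) = c (a \<otimes> b) d + c a b ** \<rho> d"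
  obtains e where "\<And>a b. a \<in> carrier A \<Longrightarrow> b \<in> carrier A \<Longrightarrow> e (a \<oplus> b) = e a + e b" "\<And>t. e (\<iota> t) = 0"
    "\<And>a b. a \<in> carrier A \<Longrightarrow> b \<in> carrier A \<Longrightarrow> e (a \<otimes> b) = \<rho> a ** e b + e a ** \<rho> b + c a b"
proof -
  interpret left_module A M by fact
  note i = assoc_algebraD(2,4-)[OF A] and i_comm = assoc_algebraD(3)[OF A]
  define \<tau> where "\<tau> = inv_into UNIV \<theta>"
  note \<tau> = module_frame_coords[OF A M fr, folded \<tau>_def \<rho>_def]
  note \<rho> = rep_functorD[OF rep_of_module_in_rep_functor[OF A M fr], folded \<rho>_def]
  define F0 where "F0 = free_module A (carrier M)"
  define d0 where "d0 = free_cover A M (carrier M)"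
  define K0 where "K0 = a_kernel F0 M d0"
  define F1 where "F1 = free_module A K0"
  define d1 where "d1 = free_cover A F0 K0"
  define K1 where "K1 = a_kernel F1 F0 d1"
  have F0: "left_module A F0" and F1: "left_module A F1"
    unfolding F0_def F1_def by (rule left_module_free_module[OF R.ring_axioms])+
  interpret F0: left_module A F0 by (rule F0)
  interpret F1: left_module A F1 by (rule F1)
  have d0: "d0 \<in> lin_maps A F0 M" unfolding d0_def F0_def by (rule free_cover_lin_maps[OF M order_refl])
  have K0_sub: "K0 \<subseteq> carrier F0" by (auto simp: K0_def a_kernel_def')
  have K0: "submodule K0 A F0" unfolding K0_def by (rule submodule_a_kernel[OF F0 M d0])
  then interpret K0: submodule K0 A F0 .
  have d1: "d1 \<in> lin_maps A F1 F0" unfolding d1_def F1_def by (rule free_cover_lin_maps[OF F0 K0_sub])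
  have F0_simps: "f \<oplus>\<^bsub>F0\<^esub> g = (\<lambda>x. f x \<oplus> g x)" "a \<odot>\<^bsub>F0\<^esub> f = (\<lambda>x. a \<otimes> f x)" "\<zero>\<^bsub>F0\<^esub> = (\<lambda>_. \<zero>)" for f g a
    by (simp_all add: F0_def)
  have F1_simps: "f \<oplus>\<^bsub>F1\<^esub> g = (\<lambda>x. f x \<oplus> g x)" "a \<odot>\<^bsub>F1\<^esub> f = (\<lambda>x. a \<otimes> f x)" "\<zero>\<^bsub>F1\<^esub> = (\<lambda>_. \<zero>)" for f g a
    by (simp_all add: F1_def)
  have F0c: "f x \<in> carrier A" "finite {x. f x \<noteq> \<zero>}" "{x. f x \<noteq> \<zero>} \<subseteq> carrier M" if "f \<in> carrier F0" for f x
    using that by (auto simp: F0_def)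
  have F1c: "g f \<in> carrier A" "finite {x. g x \<noteq> \<zero>}" "{x. g x \<noteq> \<zero>} \<subseteq> K0" if "g \<in> carrier F1" for f g
    using that by (auto simp: F1_def)
  have c0: "c \<zero> b = 0" "c b \<zero> = 0" if "b \<in> carrier A" for b
    using c_unit[OF that, of 0] i by simp_all

  \<comment> \<open>In coordinates of \<open>M\<close>, the correction term of the twisted action,
    under which \<open>a\<close> sends \<open>(v, f)\<close> to
    \<open>(\<rho> a *v v + C a f, a f)\<close>.\<close>
  define C where "C b f = supp_sum A (\<lambda>x a. c b a *v \<tau> x) f" for b and f :: "'m \<Rightarrow> 'a"
  have C_superset: "C b f = (\<Sum>x\<in>S. c b (f x) *v \<tau> x)"
    if "b \<in> carrier A" "finite S" "{x. f x \<noteq> \<zero>} \<subseteq> S" for b f S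
    unfolding C_def using that by (intro supp_sum_superset) (auto simp: c0)
  have C_add: "C b (f \<oplus>\<^bsub>F0\<^esub> g) = C b f + C b g"
    if "b \<in> carrier A" "f \<in> carrier F0" "g \<in> carrier F0" for b f g
    unfolding C_def F0_simps
    by (rule supp_sum_add[OF R.ring_axioms that(2,3)[unfolded F0_def]])
      (use that(1) in \<open>simp_all add: c0 c_add2 matrix_vector_mult_add_rdistrib\<close>)
  have C_add1: "C (a \<oplus> b) f = C a f + C b f"
    if "a \<in> carrier A" "b \<in> carrier A" "f \<in> carrier F0" for a b f
    using that F0c[OF that(3)]
    by (simp add: C_def supp_sum_def c_add1 matrix_vector_mult_add_rdistrib sum.distrib)
  have C_zero: "C b (\<lambda>_. \<zero>) = 0" for b by (simp add: C_def supp_sum_def)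
  have C_iota: "C (\<iota> t) f = 0" if "f \<in> carrier F0" for t f
    using F0c[OF that] by (simp add: C_def supp_sum_def c_unit)
  have d0_coord: "\<tau> (d0 f) = (\<Sum>x\<in>{x. f x \<noteq> \<zero>}. \<rho> (f x) *v \<tau> x)" if f: "f \<in> carrier F0" for f
  proof -
    note s = F0c[OF f]
    have "d0 f = finsum M (\<lambda>x. f x \<odot>\<^bsub>M\<^esub> x) {x. f x \<noteq> \<zero>}"
      unfolding d0_def using free_cover_superset[OF M f[unfolded F0_def] s(2,3) order_refl] .
    then have "\<tau> (d0 f) = (\<Sum>x\<in>{x. f x \<noteq> \<zero>}. \<tau> (f x \<odot>\<^bsub>M\<^esub> x))"
      using s \<tau> by (simp add: M.finsum_additive subset_iff Pi_iff)
    also have "\<dots> = (\<Sum>x\<in>{x. f x \<noteq> \<zero>}. \<rho> (f x) *v \<tau> x)"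
      using s \<tau> by (intro sum.cong) auto
    finally show ?thesis .
  qed
  \<comment> \<open>The cocycle identity makes the twisted action associative up to
    \<open>c a b *v \<tau> (d0 f)\<close>, a defect that disappears on \<open>K0\<close>, the kernel
    of \<open>d0\<close>.\<close>
  have C_cocycle: "\<rho> a *v C b f + C a (b \<odot>\<^bsub>F0\<^esub> f) = C (a \<otimes> b) f + c a b *v \<tau> (d0 f)"
    if a: "a \<in> carrier A" and b: "b \<in> carrier A" and f: "f \<in> carrier F0" for a b f
  proof -
    note s = F0c[OF f]
    let ?S = "{x. f x \<noteq> \<zero>}"
    have sub: "{x. b \<otimes> f x \<noteq> \<zero>} \<subseteq> ?S" using b by auto
    have "\<rho> a *v C b f + C a (b \<odot>\<^bsub>F0\<^esub> f) =
        (\<Sum>x\<in>?S. \<rho> a *v (c b (f x) *v \<tau> x)) + (\<Sum>x\<in>?S. c a (b \<otimes> f x) *v \<tau> x)"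
      unfolding C_superset[OF b s(2) order_refl] F0_simps C_superset[OF a s(2) sub]
      by (simp only: matrix_vector_mult_sum)
    also have "\<dots> = (\<Sum>x\<in>?S. (\<rho> a ** c b (f x) + c a (b \<otimes> f x)) *v \<tau> x)"
      by (simp only: matrix_vector_mult_add_rdistrib matrix_vector_mul_assoc sum.distrib)
    also have "\<dots> = (\<Sum>x\<in>?S. (c (a \<otimes> b) (f x) + c a b ** \<rho> (f x)) *v \<tau> x)"
      by (simp only: cocycle[OF a b s(1)])
    also have "\<dots> = C (a \<otimes> b) f + c a b *v \<tau> (d0 f)"
      unfolding C_superset[OF R.m_closed[OF a b] s(2) order_refl] d0_coord[OF f]
      by (simp only: matrix_vector_mult_sum matrix_vector_mult_add_rdistrib
          matrix_vector_mul_assoc sum.distrib)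
    finally show ?thesis .
  qed
  have d0_K0: "d0 f = \<zero>\<^bsub>M\<^esub>" if "f \<in> K0" for f using that by (auto simp: K0_def a_kernel_def')

  \<comment> \<open>The \<open>M\<close>-component of the linear map from \<open>F1\<close> to the
    twisted module that sends the basis vector of \<open>f\<close> in \<open>K0\<close> to
    \<open>(0, f)\<close>; the other component is \<open>d1\<close>. On \<open>K1\<close>, where
    \<open>d1\<close> vanishes, the twist disappears and \<open>z\<close> is linear over
    \<open>A\<close>.\<close>
  define z where "z g = supp_sum A (\<lambda>f a. C a f) g" for g :: "('m \<Rightarrow> 'a) \<Rightarrow> 'a"
  have C0: "C \<zero> f = 0" if "f \<in> carrier F0" for f using C_iota[OF that, of 0] i by simp
  have z_add: "z (g \<oplus>\<^bsub>F1\<^esub> g') = z g + z g'" if "g \<in> carrier F1" "g' \<in> carrier F1" for g g'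
    unfolding z_def F1_simps
    by (rule supp_sum_add[OF R.ring_axioms that[unfolded F1_def]])
      (use K0_sub C0 C_add1 in auto)
  have z_smult: "z (a \<odot>\<^bsub>F1\<^esub> g) = \<rho> a *v z g + C a (d1 g)" if a: "a \<in> carrier A" and g: "g \<in> carrier F1" for a g
  proof -
    note s = F1c[OF g]
    let ?S = "{f. g f \<noteq> \<zero>}"
    have sub: "f \<in> carrier F0" "f \<in> K0" if "f \<in> ?S" for f using s(3) K0_sub that by auto
    have "z (a \<odot>\<^bsub>F1\<^esub> g) = (\<Sum>f\<in>?S. C (a \<otimes> g f) f)"
      unfolding z_def F1_simps using s a by (intro supp_sum_superset C0 sub) auto
    also have "\<dots> = (\<Sum>f\<in>?S. \<rho> a *v C (g f) f + C a (g f \<odot>\<^bsub>F0\<^esub> f))"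
    proof (rule sum.cong[OF refl])
      fix f assume f: "f \<in> ?S"
      show "C (a \<otimes> g f) f = \<rho> a *v C (g f) f + C a (g f \<odot>\<^bsub>F0\<^esub> f)"
        using C_cocycle[OF a s(1) sub(1)[OF f], of f] d0_K0[OF sub(2)[OF f]] \<tau> by simp
    qed
    also have "\<dots> = \<rho> a *v z g + (\<Sum>f\<in>?S. C a (g f \<odot>\<^bsub>F0\<^esub> f))"
      by (simp add: z_def supp_sum_def matrix_vector_mult_sum sum.distrib)
    also have "(\<Sum>f\<in>?S. C a (g f \<odot>\<^bsub>F0\<^esub> f)) = C a (finsum F0 (\<lambda>f. g f \<odot>\<^bsub>F0\<^esub> f) ?S)"
      using s sub C_add[OF a] C_zero by (intro F0.M.finsum_additive[symmetric]) (auto simp: F0_simps(3))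
    also have "finsum F0 (\<lambda>f. g f \<odot>\<^bsub>F0\<^esub> f) ?S = d1 g"
    proof -
      have "?S \<subseteq> carrier F0" using sub(1) by blast
      from free_cover_superset[OF F0 g[unfolded F1_def] s(2) this order_refl]
      show ?thesis by (simp add: d1_def)
    qed
    finally show ?thesis .
  qed
  have d1_K1: "d1 g = (\<lambda>_. \<zero>)" if "g \<in> K1" for g
    using that unfolding K1_def a_kernel_def' F0_simps by blast
  have K1_sub: "g \<in> carrier F1" if "g \<in> K1" for g
    using that unfolding K1_def a_kernel_def' by blast
  obtain \<psi> where \<psi>: "\<psi> \<in> lin_maps A F1 M" and \<psi>_eq: "\<And>g. g \<in> K1 \<Longrightarrow> \<psi> g = \<theta> (z g)"
  proof (rule extend_from_second_syzygy[OF M M triv, where z = "\<lambda>g. \<theta> (z g)",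
        folded F0_def d0_def, folded K0_def, folded F1_def d1_def, folded K1_def])
    show "\<theta> (z g) \<in> carrier M" for g by (rule \<tau>)
    show "\<theta> (z (g \<oplus>\<^bsub>F1\<^esub> g')) = \<theta> (z g) \<oplus>\<^bsub>M\<^esub> \<theta> (z g')" if "g \<in> K1" "g' \<in> K1" for g g'
      using fr z_add[OF K1_sub[OF that(1)] K1_sub[OF that(2)]] by (simp add: module_frame_def)
    show "\<theta> (z (a \<odot>\<^bsub>F1\<^esub> g)) = a \<odot>\<^bsub>M\<^esub> \<theta> (z g)" if a: "a \<in> carrier A" and g: "g \<in> K1" for a g
    proof -
      have "z (a \<odot>\<^bsub>F1\<^esub> g) = \<tau> (a \<odot>\<^bsub>M\<^esub> \<theta> (z g))"
        using z_smult[OF a K1_sub[OF g]] a by (simp add: d1_K1[OF g] C_zero \<tau>(1,2,6))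
      then show ?thesis using \<tau>(1,3) a by simp
    qed
  qed blast

  \<comment> \<open>Correcting \<open>z\<close> by the extension \<open>\<psi>\<close> makes it
    vanish on \<open>K1\<close>, so \<open>T\<close> depends only on \<open>d1 g\<close> and
    descends to \<open>K0\<close>.\<close>
  define T where "T g = \<tau> (\<psi> g) - z g" for g
  have T_add: "T (g \<oplus>\<^bsub>F1\<^esub> g') = T g + T g'" if "g \<in> carrier F1" "g' \<in> carrier F1" for g g'
    using that by (simp add: T_def z_add lin_mapsD[OF \<psi>] \<tau>)
  have T_smult: "T (a \<odot>\<^bsub>F1\<^esub> g) = \<rho> a *v T g - C a (d1 g)" if "a \<in> carrier A" "g \<in> carrier F1" for a g
    using that by (simp add: T_def z_smult lin_mapsD[OF \<psi>] \<tau> matrix_vector_mult_diff_distrib)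
  have T_K1: "T g = 0" if "g \<in> K1" for g using \<psi>_eq[OF that] by (simp add: T_def \<tau>)
  have T_cong: "T g = T g'" if g: "g \<in> carrier F1" "g' \<in> carrier F1" "d1 g = d1 g'" for g g'
  proof -
    have m: "\<ominus>\<^bsub>F1\<^esub> g' \<in> carrier F1" using g by simp
    have "d1 (g \<oplus>\<^bsub>F1\<^esub> \<ominus>\<^bsub>F1\<^esub> g') = d1 (g' \<oplus>\<^bsub>F1\<^esub> \<ominus>\<^bsub>F1\<^esub> g')"
      using g m by (simp add: lin_mapsD(2)[OF d1])
    also have "\<dots> = \<zero>\<^bsub>F0\<^esub>" using g by (simp add: F1.M.r_neg lin_maps_zero[OF F1 F0 d1])
    finally have K: "g \<oplus>\<^bsub>F1\<^esub> \<ominus>\<^bsub>F1\<^esub> g' \<in> K1" using g m by (simp add: K1_def a_kernel_def')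
    have "T g = T ((g \<oplus>\<^bsub>F1\<^esub> \<ominus>\<^bsub>F1\<^esub> g') \<oplus>\<^bsub>F1\<^esub> g')"
      using g m by (simp add: F1.M.a_assoc F1.M.l_neg)
    also have "\<dots> = T g'" using T_add[OF K1_sub[OF K] g(2)] T_K1[OF K] by simp
    finally show ?thesis .
  qed
  \<comment> \<open>The sign is chosen so that \<open>f\<close> maps to \<open>(s f, f)\<close>
    linearly in the twisted module: this is the splitting.\<close>
  define s where "s f = - T (delta A f)" for f
  have dc: "delta A f \<in> carrier F1" if "f \<in> K0" for f
    unfolding F1_def using delta_in_free_module[OF R.ring_axioms that] .
  have d1_delta: "d1 (delta A f) = f" if "f \<in> K0" for f
    unfolding d1_def by (rule free_cover_delta[OF F0 K0_sub that])
  have K0_add: "f \<oplus>\<^bsub>F0\<^esub> g \<in> K0" if "f \<in> K0" "g \<in> K0" for f g using K0.m_closed that by simp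
  have s_add: "s (f \<oplus>\<^bsub>F0\<^esub> g) = s f + s g" if f: "f \<in> K0" and g: "g \<in> K0" for f g
  proof -
    have "T (delta A (f \<oplus>\<^bsub>F0\<^esub> g)) = T (delta A f \<oplus>\<^bsub>F1\<^esub> delta A g)"
      using f g by (intro T_cong dc K0_add F1.M.a_closed) (simp_all add: d1_delta dc K0_add lin_mapsD(2)[OF d1])
    then show ?thesis using T_add[OF dc[OF f] dc[OF g]] by (simp add: s_def)
  qed
  have s_smult: "s (a \<odot>\<^bsub>F0\<^esub> f) = \<rho> a *v s f + C a f" if a: "a \<in> carrier A" and f: "f \<in> K0" for a f
  proof -
    have "T (delta A (a \<odot>\<^bsub>F0\<^esub> f)) = T (a \<odot>\<^bsub>F1\<^esub> delta A f)"
      using a f by (intro T_cong dc K0.smult_closed F1.smult_closed) (simp_all add: d1_delta dc lin_mapsD(3)[OF d1])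
    then show ?thesis
      using T_smult[OF a dc[OF f]] matrix_vector_mult_diff_distrib[of "\<rho> a" 0 "T (delta A f)"]
      by (simp add: s_def d1_delta[OF f])
  qed

  \<comment> \<open>Explicit elements of the first syzygy\<close>
  define \<beta> where "\<beta> j = \<theta> (axis j 1)" for j
  have inj: "inj \<beta>"
  proof
    fix j j' assume "\<beta> j = \<beta> j'"
    then have "axis j (1::'k) = axis j' 1" using \<tau>(2) unfolding \<beta>_def by metis
    then show "j = j'" by (simp add: axis_eq_axis)
  qed
  \<comment> \<open>In the free module on the set \<open>M\<close>,
    \<open>a \<cdot> v - 1 \<cdot> a v\<close> would not be additive in \<open>v\<close>. Expanding
    \<open>v\<close> and \<open>\<rho> a *v v\<close> in the basis \<open>\<beta>\<close> first
    gives an element with the same role that is linear in \<open>v\<close> and additive in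
    \<open>a\<close>.\<close>
  define \<omega> where "\<omega> a v x = (if x \<in> range \<beta> then a \<otimes> \<iota> (v $ inv_into UNIV \<beta> x) \<oplus> \<ominus> \<iota> ((\<rho> a *v v) $ inv_into UNIV \<beta> x) else \<zero>)" for a v x
  have \<omega>_\<beta>: "\<omega> a v (\<beta> j) = a \<otimes> \<iota> (v $ j) \<oplus> \<ominus> \<iota> ((\<rho> a *v v) $ j)" for a v j
    using inj by (simp add: \<omega>_def)
  have supp: "{x. \<omega> a v x \<noteq> \<zero>} \<subseteq> range \<beta>" for a v by (auto simp: \<omega>_def)
  have \<omega>F: "\<omega> a v \<in> carrier F0" if "a \<in> carrier A" for a v
  proof -
    have "range \<beta> \<subseteq> carrier M" by (auto simp: \<beta>_def \<tau>)
    moreover have "finite {x. \<omega> a v x \<noteq> \<zero>}" by (rule finite_subset[OF supp]) simp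
    ultimately show ?thesis using supp[of a v] that i by (auto simp: F0_def \<omega>_def)
  qed
  have \<rho>_minus: "\<rho> (\<ominus> a) = - \<rho> a" if "a \<in> carrier A" for a
  proof -
    have "\<rho> a + \<rho> (\<ominus> a) = \<rho> (\<iota> 0)" using that \<rho>(1)[of a "\<ominus> a"] i by (simp add: R.r_neg)
    also have "\<dots> = 0" using \<rho>(3)[of 0] by (simp add: mat_def vec_eq_iff)
    finally show ?thesis by (simp add: eq_neg_iff_add_eq_0 add.commute)
  qed
  have c_minus: "c b (\<ominus> \<iota> t) = 0" if "b \<in> carrier A" for b t
  proof -
    have "c b (\<iota> t) + c b (\<ominus> \<iota> t) = 0" using that c_add2[of b "\<iota> t" "\<ominus> \<iota> t"] i c0 by (simp add: R.r_neg)
    then show ?thesis using that by (simp add: c_unit)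
  qed
  have vec_expand: "(\<Sum>j\<in>UNIV. v $ j *s axis j 1) = v" for v :: "'k^'n" by (rule basis_expansion)
  have \<omega>K: "\<omega> a v \<in> K0" if a: "a \<in> carrier A" for a v
  proof -
    have r: "\<rho> (\<omega> a v (\<beta> j)) *v axis j 1 = \<rho> a *v (v $ j *s axis j 1) - (\<rho> a *v v) $ j *s axis j 1" for j
    proof -
      have "\<rho> (\<omega> a v (\<beta> j)) = \<rho> a ** mat (v $ j) - mat ((\<rho> a *v v) $ j)"
        using a i by (simp add: \<omega>_\<beta> \<rho> \<rho>_minus)
      then show ?thesis
        by (simp add: matrix_vector_mult_diff_rdistrib mat_mult_vec flip: matrix_vector_mul_assoc)
    qed
    have "\<tau> (d0 (\<omega> a v)) = (\<Sum>x\<in>range \<beta>. \<rho> (\<omega> a v x) *v \<tau> x)"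
      unfolding d0_coord[OF \<omega>F[OF a]]
      by (rule sum.mono_neutral_left) (use supp \<rho>(3)[of 0] i in \<open>auto simp: mat_def vec_eq_iff matrix_vector_mult_def\<close>)
    also have "\<dots> = (\<Sum>j\<in>UNIV. \<rho> (\<omega> a v (\<beta> j)) *v axis j 1)"
      by (subst sum.reindex[OF inj]) (simp add: \<beta>_def \<tau>)
    also have "\<dots> = \<rho> a *v (\<Sum>j\<in>UNIV. v $ j *s axis j 1) - (\<Sum>j\<in>UNIV. (\<rho> a *v v) $ j *s axis j 1)"
      by (simp only: r sum_subtractf matrix_vector_mult_sum)
    also have "\<dots> = 0" by (simp add: vec_expand)
    finally have "\<tau> (d0 (\<omega> a v)) = \<tau> \<zero>\<^bsub>M\<^esub>" by (simp add: \<tau>)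
    then have "d0 (\<omega> a v) = \<zero>\<^bsub>M\<^esub>" using \<tau>(3) lin_mapsD(1)[OF d0 \<omega>F[OF a]] by (metis M.zero_closed)
    then show ?thesis using \<omega>F[OF a] by (simp add: K0_def a_kernel_def')
  qed
  \<comment> \<open>The scalar part of each entry is killed because \<open>c\<close> is normalized;
    the remaining parts reassemble \<open>c b a *v v\<close>.\<close>
  have C_\<omega>: "C b (\<omega> a v) = c b a *v v" if a: "a \<in> carrier A" and b: "b \<in> carrier A" for a b v
  proof -
    have r: "c b (\<omega> a v (\<beta> j)) *v axis j 1 = c b a *v (v $ j *s axis j 1)" for j
    proof -
      have "c b (\<omega> a v (\<beta> j)) = c b (\<iota> (v $ j) \<otimes> a)"
        unfolding \<omega>_\<beta> i_comm[OF a] using a b i by (simp add: c_add2 c_minus)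
      then show ?thesis using a b by (simp add: vec_eq_iff matrix_vector_mult_def c_scale mult_ac)
    qed
    have "C b (\<omega> a v) = (\<Sum>x\<in>range \<beta>. c b (\<omega> a v x) *v \<tau> x)"
      using b supp by (intro C_superset) auto
    also have "\<dots> = (\<Sum>j\<in>UNIV. c b (\<omega> a v (\<beta> j)) *v axis j 1)"
      by (subst sum.reindex[OF inj]) (simp add: \<beta>_def \<tau>)
    also have "\<dots> = c b a *v (\<Sum>j\<in>UNIV. v $ j *s axis j 1)"
      by (simp only: r matrix_vector_mult_sum)
    finally show ?thesis by (simp add: vec_expand)
  qed
  have \<omega>_eqI: "f = g" if "\<And>j. f (\<beta> j) = g (\<beta> j)" "\<And>x. x \<notin> range \<beta> \<Longrightarrow> f x = g x" for f g :: "'m \<Rightarrow> 'a"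
    using that by (intro ext) (metis imageE)
  have \<iota>_ring: "\<ominus> (\<iota> u \<oplus> \<iota> v) = \<ominus> \<iota> u \<oplus> \<ominus> \<iota> v" for u v using i by (simp add: R.minus_add)
  have \<omega>_add: "\<omega> a (v + w) = \<omega> a v \<oplus>\<^bsub>F0\<^esub> \<omega> a w" if a: "a \<in> carrier A" for a v w
  proof (rule \<omega>_eqI)
    show "\<omega> a (v + w) (\<beta> j) = (\<omega> a v \<oplus>\<^bsub>F0\<^esub> \<omega> a w) (\<beta> j)" for j
      using a i by (simp add: \<omega>_\<beta> F0_simps matrix_vector_right_distrib \<iota>_ring R.r_distr R.a_ac)
  qed (simp add: \<omega>_def F0_simps)
  have \<omega>_scale: "\<omega> a (t *s v) = \<iota> t \<odot>\<^bsub>F0\<^esub> \<omega> a v" if a: "a \<in> carrier A" for a t v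
  proof (rule \<omega>_eqI)
    have 1: "a \<otimes> (\<iota> t \<otimes> \<iota> u) = \<iota> t \<otimes> (a \<otimes> \<iota> u)" for u
      using a i(1) by (metis R.m_assoc i_comm)
    show "\<omega> a (t *s v) (\<beta> j) = (\<iota> t \<odot>\<^bsub>F0\<^esub> \<omega> a v) (\<beta> j)" for j
      using a i(1,3) 1 by (simp add: \<omega>_\<beta> F0_simps R.r_distr R.r_minus vec.scale)
  qed (simp add: \<omega>_def F0_simps i)
  have \<omega>_add1: "\<omega> (a \<oplus> b) v = \<omega> a v \<oplus>\<^bsub>F0\<^esub> \<omega> b v" if a: "a \<in> carrier A" and b: "b \<in> carrier A" for a b v
  proof (rule \<omega>_eqI)
    show "\<omega> (a \<oplus> b) v (\<beta> j) = (\<omega> a v \<oplus>\<^bsub>F0\<^esub> \<omega> b v) (\<beta> j)" for j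
      using a b i by (simp add: \<omega>_\<beta> F0_simps \<rho> matrix_vector_mult_add_rdistrib \<iota>_ring R.l_distr R.a_ac)
  qed (simp add: \<omega>_def F0_simps)
  \<comment> \<open>Inserting and removing \<open>b \<cdot> a v\<close> splits
    \<open>b a \<cdot> v - 1 \<cdot> b a v\<close> into \<open>b\<close> times the element for
    \<open>a\<close>, plus the element for \<open>b\<close> at \<open>\<rho> a *v v\<close>.
    Applying \<open>s\<close>, whose twist contributes the cocycle, turns this into the coboundary
    equation.\<close>
  have \<omega>_mult: "\<omega> (b \<otimes> a) v = b \<odot>\<^bsub>F0\<^esub> \<omega> a v \<oplus>\<^bsub>F0\<^esub> \<omega> b (\<rho> a *v v)"
    if a: "a \<in> carrier A" and b: "b \<in> carrier A" for a b v
  proof (rule \<omega>_eqI)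
    fix j
    define x y w where "x = \<iota> (v $ j)" and "y = \<iota> ((\<rho> a *v v) $ j)" and "w = \<iota> ((\<rho> b *v (\<rho> a *v v)) $ j)"
    have c: "x \<in> carrier A" "y \<in> carrier A" "w \<in> carrier A" using i by (auto simp: x_def y_def w_def)
    have "b \<otimes> (a \<otimes> x \<oplus> \<ominus> y) \<oplus> (b \<otimes> y \<oplus> \<ominus> w) = b \<otimes> a \<otimes> x \<oplus> (\<ominus> (b \<otimes> y) \<oplus> b \<otimes> y) \<oplus> \<ominus> w"
      using a b c by (simp add: R.r_distr R.r_minus R.m_assoc R.a_assoc)
    also have "\<dots> = b \<otimes> a \<otimes> x \<oplus> \<ominus> w" using a b c by (simp add: R.l_neg)
    finally show "\<omega> (b \<otimes> a) v (\<beta> j) = (b \<odot>\<^bsub>F0\<^esub> \<omega> a v \<oplus>\<^bsub>F0\<^esub> \<omega> b (\<rho> a *v v)) (\<beta> j)"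
      using a b by (simp add: \<omega>_\<beta> F0_simps \<rho> x_def y_def w_def matrix_vector_mul_assoc)
  qed (use b in \<open>simp add: \<omega>_def F0_simps\<close>)
  have \<omega>_iota: "\<omega> (\<iota> t) v = \<zero>\<^bsub>F0\<^esub>" for t v
  proof (rule \<omega>_eqI)
    show "\<omega> (\<iota> t) v (\<beta> j) = \<zero>\<^bsub>F0\<^esub> (\<beta> j)" for j
      by (simp add: \<omega>_\<beta> F0_simps \<rho> mat_mult_vec i(1) R.r_neg flip: i(3))
  qed (simp add: \<omega>_def F0_simps)

  define e where "e a = matrix (\<lambda>v. s (\<omega> a v))" for a
  have e: "e a *v v = s (\<omega> a v)" if a: "a \<in> carrier A" for a v
    unfolding e_def
  proof (rule matrix_works, unfold_locales)
    show "s (\<omega> a (v + w)) = s (\<omega> a v) + s (\<omega> a w)" for v w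
      using a by (simp add: \<omega>_add s_add \<omega>K)
    show "s (\<omega> a (t *s v)) = t *s s (\<omega> a v)" for t v
      using a i by (simp add: \<omega>_scale s_smult \<omega>K \<rho> mat_mult_vec C_iota \<omega>F)
  qed
  have matrix_eqI: "P = Q" if "\<And>v. P *v v = Q *v v" for P Q :: "'k^'n^'n"
    using that by (simp add: matrix_eq)
  show ?thesis
  proof (rule that)
    show "e (a \<oplus> b) = e a + e b" if "a \<in> carrier A" "b \<in> carrier A" for a b
      by (rule matrix_eqI) (use that in \<open>simp add: e \<omega>_add1 s_add \<omega>K matrix_vector_mult_add_rdistrib\<close>)
    show "e (\<iota> t) = 0" for t
    proof (rule matrix_eqI)
      fix v
      have "\<zero>\<^bsub>F0\<^esub> \<in> K0" using K0.one_closed by simp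
      then have "s \<zero>\<^bsub>F0\<^esub> = 0" using s_add[of "\<zero>\<^bsub>F0\<^esub>" "\<zero>\<^bsub>F0\<^esub>"] by simp
      then show "e (\<iota> t) *v v = 0 *v v" by (simp add: e i \<omega>_iota)
    qed
    show "e (a \<otimes> b) = \<rho> a ** e b + e a ** \<rho> b + c a b" if a: "a \<in> carrier A" and b: "b \<in> carrier A" for a b
    proof (rule matrix_eqI)
      fix v
      have "s (\<omega> (a \<otimes> b) v) = \<rho> a *v s (\<omega> b v) + c a b *v v + s (\<omega> a (\<rho> b *v v))"
        using a b by (simp add: \<omega>_mult s_add s_smult \<omega>K C_\<omega>)
      then show "e (a \<otimes> b) *v v = (\<rho> a ** e b + e a ** \<rho> b + c a b) *v v"
        using a b by (simp add: matrix_vector_mult_add_rdistrib flip: e matrix_vector_mul_assoc)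
    qed
  qed
qed

section \<open>Equations for the representation scheme\<close>

lemma matrix_diff_ldistrib: "P ** (Q - R) = P ** Q - P ** R" for P :: "'b::ring_1^'n^'m"
  by (vector matrix_matrix_mult_def sum_subtractf[symmetric] right_diff_distrib)

lemma matrix_diff_rdistrib: "(P - Q) ** R = P ** R - Q ** R" for P :: "'b::ring_1^'n^'m"
  by (vector matrix_matrix_mult_def sum_subtractf[symmetric] left_diff_distrib)

lemma matrix_add_distrib:
  "P ** (Q + R) = P ** Q + P ** R" "(S + T) ** Q = S ** Q + T ** Q" for P S T :: "'b::ring_1^'n^'m"
  by (vector matrix_matrix_mult_def sum.distrib[symmetric] distrib_left distrib_right)+

lemma mat_mult_entry: "(mat x ** Q) $ i $ j = x * Q $ i $ j" for Q :: "'b::comm_ring_1^'n^'n"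
  by (simp add: matrix_matrix_mult_def mat_def if_distrib[of "\<lambda>x. x * _"] cong: if_cong)

text \<open>The hypotheses say that \<open>\<tau>\<close> is a representation modulo the ideal
  \<open>Q\<close>, one for each of the three families of relations; the generic entries are
  specialised to those of \<open>\<tau>\<close>.\<close>

lemma subst_rep_relations:
  fixes \<tau> :: "'a \<Rightarrow> (('w, 'k::field) mpoly)^'n^'n"
  assumes Q: "idl.subspace Q"
    and "\<And>a b i j. a \<in> carrier A \<Longrightarrow> b \<in> carrier A \<Longrightarrow> (\<tau> (a \<oplus>\<^bsub>A\<^esub> b) - \<tau> a - \<tau> b) $ i $ j \<in> Q"
    and "\<And>a b i j. a \<in> carrier A \<Longrightarrow> b \<in> carrier A \<Longrightarrow> (\<tau> (a \<otimes>\<^bsub>A\<^esub> b) - \<tau> a ** \<tau> b) $ i $ j \<in> Q"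
    and "\<And>c i j. (\<tau> (\<iota> c) - mat (mconst c)) $ i $ j \<in> Q"
    and r: "r \<in> rep_relations \<iota> A"
  shows "subst (\<lambda>(a, i, j). \<tau> a $ i $ j) r \<in> Q"
  using r unfolding rep_relations_def
proof (elim UnE CollectE exE conjE)
  fix a b i j assume "r = mvar (a \<oplus>\<^bsub>A\<^esub> b, i, j) - mvar (a, i, j) - mvar (b, i, j)"
    "a \<in> carrier A" "b \<in> carrier A"
  then show ?thesis using assms(2)[of a b i j] by simp
next
  fix a b i j assume "r = mvar (a \<otimes>\<^bsub>A\<^esub> b, i, j) - (\<Sum>l\<in>UNIV. mvar (a, i, l) * mvar (b, l, j))"
    "a \<in> carrier A" "b \<in> carrier A"
  then show ?thesis using assms(3)[of a b i j] by (simp add: matrix_matrix_mult_def)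
next
  fix c i j assume "r = mvar (\<iota> c, i, j) - (if i = j then mconst c else 0)"
  then show ?thesis using assms(4)[of c i j] by (cases "i = j") (simp_all add: mat_def)
qed

text \<open>The generic representation \<open>\<sigma>\<close> of \<open>A\<close> over \<open>k[T]/I\<close>, lifted to \<open>k[T]\<close> linearly and such that the
  given representation \<open>\<rho>\<close> sits at the origin.\<close>

lemma representation_chart:
  fixes A :: "'a ring" (structure) and \<rho> :: "'a \<Rightarrow> 'k::field^'n^'n"
  assumes A: "assoc_algebra \<iota> A" and fg: "finitely_generated_algebra \<iota> A"
    and \<rho>_rep: "\<rho> \<in> rep_functor \<iota> A id"
  obtains I :: "(nat, 'k) mpoly set" and N :: nat and \<sigma> :: "'a \<Rightarrow> ((nat, 'k) mpoly)^'n^'n"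
    and u :: "nat \<Rightarrow> ('a \<times> 'n \<times> 'n, 'k) mpoly" where
    "I \<subseteq> polys {..<N}" "0 \<in> I" "\<And>p q. p \<in> I \<Longrightarrow> q \<in> I \<Longrightarrow> p + q \<in> I"
    "\<And>p q. p \<in> polys {..<N} \<Longrightarrow> q \<in> I \<Longrightarrow> p * q \<in> I" "I \<subseteq> ordge (Suc 0)"
    "\<And>a i j. a \<in> carrier A \<Longrightarrow> \<sigma> a $ i $ j \<in> polys {..<N}"
    "\<And>a b. a \<in> carrier A \<Longrightarrow> b \<in> carrier A \<Longrightarrow> \<sigma> (a \<oplus> b) = \<sigma> a + \<sigma> b"
    "\<And>b t. b \<in> carrier A \<Longrightarrow> \<sigma> (\<iota> t \<otimes> b) = mat (mconst t) ** \<sigma> b"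
    "\<And>t. \<sigma> (\<iota> t) = mat (mconst t)"
    "\<And>a b i j. a \<in> carrier A \<Longrightarrow> b \<in> carrier A \<Longrightarrow> (\<sigma> (a \<otimes> b) - \<sigma> a ** \<sigma> b) $ i $ j \<in> I"
    "\<And>a i j. a \<in> carrier A \<Longrightarrow> lookup (\<sigma> a $ i $ j) 0 = \<rho> a $ i $ j"
    "\<And>q. q \<in> I \<Longrightarrow> subst u q \<in> idl.span (rep_relations \<iota> A)"
    "\<And>j. j < N \<Longrightarrow> \<exists>a\<in>carrier A. \<exists>i l. u j = mvar (a, i, l) - mconst (\<rho> a $ i $ l) \<and>
      \<sigma> a $ i $ l - mconst (\<rho> a $ i $ l) - mvar j \<in> I"
    "\<And>a i j. a \<in> carrier A \<Longrightarrow> subst u (\<sigma> a $ i $ j) - mvar (a, i, j) \<in> idl.span (rep_relations \<iota> A)"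
proof -
  note i = assoc_algebraD(2,4-)[OF A]
  interpret A: ring A by (rule assoc_algebraD(1)[OF A])
  note \<rho> = rep_functorD[OF \<rho>_rep]
  define Rel where "Rel = (rep_relations \<iota> A :: ('a \<times> 'n \<times> 'n, 'k) mpoly set)"
  define pt where "pt = (\<lambda>(a, i, j). \<rho> a $ i $ j)"
  define cg where "cg x y \<longleftrightarrow> x - y \<in> idl.span Rel" for x y
  have cg_refl: "cg x x" for x by (simp add: cg_def idl.span_zero)
  have cg_sym: "cg x y \<Longrightarrow> cg y x" for x y using idl.span_neg[of "x - y" Rel] by (simp add: cg_def)
  have cg_trans: "cg x y \<Longrightarrow> cg y z \<Longrightarrow> cg x z" for x y z
    using idl.span_add[of "x - y" Rel "y - z"] by (simp add: cg_def)
  have cg_add: "cg x y \<Longrightarrow> cg x' y' \<Longrightarrow> cg (x + x') (y + y')" for x y x' y'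
    using idl.span_add[of "x - y" Rel "x' - y'"] by (simp add: cg_def algebra_simps)
  have cg_minus: "cg x y \<Longrightarrow> cg (- x) (- y)" for x y
    using idl.span_neg[of "x - y" Rel] by (simp add: cg_def)
  have cg_mult: "cg (x * x') (y * y')" if "cg x y" "cg x' y'" for x y x' y'
  proof -
    have "x' * (x - y) + y * (x' - y') \<in> idl.span Rel"
      using that unfolding cg_def by (rule idl.span_add[OF idl.span_scale idl.span_scale])
    then show ?thesis by (simp add: cg_def algebra_simps)
  qed
  have cg_sum: "(\<And>l. cg (h l) (h' l)) \<Longrightarrow> cg (sum h S) (sum h' S)" for h h' :: "'n \<Rightarrow> _" and S
    by (induction S rule: infinite_finite_induct) (auto intro: cg_refl cg_add)
  have rel: "cg x y" if "x - y \<in> Rel" for x y using that by (simp add: cg_def idl.span_base)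
  have R1: "cg (mvar (a \<oplus> b, i, j)) (mvar (a, i, j) + mvar (b, i, j))"
    if "a \<in> carrier A" "b \<in> carrier A" for a b i j
    by (rule rel) (use that in \<open>auto simp: Rel_def rep_relations_def diff_diff_eq\<close>)
  have R2: "cg (mvar (a \<otimes> b, i, j)) (\<Sum>l\<in>UNIV. mvar (a, i, l) * mvar (b, l, j))"
    if "a \<in> carrier A" "b \<in> carrier A" for a b i j
    by (rule rel) (use that in \<open>auto simp: Rel_def rep_relations_def\<close>)
  have R3: "cg (mvar (\<iota> c, i, j)) (if i = j then mconst c else 0)" for c i j
    by (rule rel) (auto simp: Rel_def rep_relations_def)

  \<comment> \<open>The constant matrices with the entries of \<open>\<rho>\<close> satisfy the
    relations modulo polynomials vanishing at the origin, so vanishing at the point is another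
    instance of a representation modulo an ideal.\<close>
  have eval_Rel: "peval pt r = 0" if "r \<in> idl.span Rel" for r
  proof -
    have ev: "lookup (subst (\<lambda>v. mconst (pt v) :: (nat, 'k) mpoly) r) 0 = peval pt r" for r
      unfolding mpoly_eval_zero[symmetric] mpoly_eval_subst by (simp add: mpoly_eval_zero)
    define C :: "'a \<Rightarrow> ((nat, 'k) mpoly)^'n^'n" where "C a = (\<chi> i j. mconst (\<rho> a $ i $ j))" for a
    have "subst (\<lambda>(a, i, j). C a $ i $ j) r \<in> ordge (Suc 0)" if "r \<in> Rel" for r
    proof (rule subst_rep_relations[OF subspace_ordge _ _ _ that[unfolded Rel_def]])
      fix a b i j assume a: "a \<in> carrier A" "b \<in> carrier A"
      show "(C (a \<oplus> b) - C a - C b) $ i $ j \<in> ordge (Suc 0)"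
        using a by (simp add: C_def \<rho> in_ordge_1_iff lookup_minus)
      show "(C (a \<otimes> b) - C a ** C b) $ i $ j \<in> ordge (Suc 0)"
        using a by (simp add: C_def \<rho> in_ordge_1_iff lookup_minus matrix_matrix_mult_def lookup_sum lookup_0_mult)
    next
      fix c i j
      show "(C (\<iota> c) - mat (mconst c)) $ i $ j \<in> ordge (Suc 0)"
        by (simp add: C_def \<rho> in_ordge_1_iff lookup_minus mat_def)
    qed
    then have "peval pt r = 0" if "r \<in> Rel" for r
      using that ev[of r] by (simp add: C_def pt_def in_ordge_1_iff case_prod_unfold)
    then have "idl.span Rel \<subseteq> {r. peval pt r = 0}"
      by (intro idl.span_minimal subspace_kernel_mpoly_eval) auto
    then show ?thesis using that by blast
  qed

  obtain S where S: "finite S" "S \<subseteq> carrier A" "generate_ring A (range \<iota> \<union> S) = carrier A"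
    using fg unfolding finitely_generated_algebra_def by blast
  define N where "N = card (S \<times> (UNIV :: ('n \<times> 'n) set))"
  obtain en where en: "bij_betw en {..<N} (S \<times> (UNIV :: ('n \<times> 'n) set))"
    using ex_bij_betw_nat_finite[of "S \<times> (UNIV :: ('n \<times> 'n) set)"] S(1) by (auto simp: N_def atLeast0LessThan)
  \<comment> \<open>The variables are the matrix entries of the algebra generators, shifted so that
    the given point becomes the origin. The default 0 vanishes at the point as well, so
    \<open>eval_u\<close> holds for every polynomial.\<close>
  define u where "u j = (if j < N then mvar (en j) - mconst (pt (en j)) else 0 :: ('a \<times> 'n \<times> 'n, 'k) mpoly)" for j
  have eval_u: "peval pt (subst u q) = lookup q 0" for q
  proof -
    have "peval pt (u j) = 0" for j
      by (cases "j < N") (simp_all only: u_def if_True if_False peval_diff peval_mvar peval_mconst peval_0 diff_self)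
    then show ?thesis unfolding mpoly_eval_subst by (simp only: mpoly_eval_zero)
  qed
  \<comment> \<open>Every coordinate is a polynomial in the chosen ones modulo the relations: follow
    how the element of \<open>A\<close> is built from scalars and generators.\<close>
  have "\<forall>i j. \<exists>p\<in>polys {..<N}. cg (subst u p) (mvar (a, i, j))" if "a \<in> carrier A" for a
    using that unfolding S(3)[symmetric]
  proof (induction a rule: generate_ring.induct)
    case one
    show ?case
    proof (intro allI)
      fix i j :: 'n
      show "\<exists>p\<in>polys {..<N}. cg (subst u p) (mvar (\<one>, i, j))"
        using cg_sym[OF R3[of 1 i j]] i
        by (intro bexI[of _ "if i = j then mconst 1 else 0"]) (auto intro: polys_closed)
    qed
  next
    case (incl h)
    show ?case
    proof (intro allI)
      fix k l :: 'n
      show "\<exists>p\<in>polys {..<N}. cg (subst u p) (mvar (h, k, l))"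
      proof (cases "h \<in> S")
        case True
        then have "(h, k, l) \<in> en ` {..<N}" using en by (auto simp: bij_betw_def)
        then obtain j where "j < N" "en j = (h, k, l)" by auto
        then show ?thesis
          by (intro bexI[of _ "mvar j + mconst (pt (en j))"]) (auto simp: u_def cg_refl intro: polys_closed)
      next
        case False
        then obtain c where "h = \<iota> c" using incl by blast
        then show ?thesis using cg_sym[OF R3[of c k l]]
          by (intro bexI[of _ "if k = l then mconst c else 0"]) (auto intro: polys_closed)
      qed
    qed
  next
    case (a_inv h)
    have h: "h \<in> carrier A" using a_inv(1) S(3) by simp
    show ?case
    proof (intro allI)
      fix k l :: 'n
      obtain p where p: "p \<in> polys {..<N}" "cg (subst u p) (mvar (h, k, l))" using a_inv by blast
      have "cg (mvar (h, k, l) + mvar (\<ominus> h, k, l)) (mvar (\<iota> 0, k, l))"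
        using cg_sym[OF R1[of h "\<ominus> h" k l]] h i by (simp add: A.r_neg)
      moreover have "cg (mvar (\<iota> 0, k, l)) 0" using R3[of 0 k l] by (simp add: mconst_hom split: if_splits)
      ultimately have "cg (mvar (h, k, l) + mvar (\<ominus> h, k, l)) 0" by (rule cg_trans)
      then have "cg (- mvar (h, k, l)) (mvar (\<ominus> h, k, l))"
        using cg_minus[of "mvar (h, k, l) + mvar (\<ominus> h, k, l)" 0] by (simp add: cg_def algebra_simps)
      then have "cg (subst u (0 - p)) (mvar (\<ominus> h, k, l))"
        using cg_trans[OF cg_minus[OF p(2)]] unfolding subst_simps by simp
      then show "\<exists>p\<in>polys {..<N}. cg (subst u p) (mvar (\<ominus> h, k, l))"
        using p(1) by (intro bexI[of _ "0 - p"]) (auto intro!: polys_closed)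
    qed
  next
    case (eng_add a b)
    have ab: "a \<in> carrier A" "b \<in> carrier A" using eng_add S(3) by simp_all
    show ?case
    proof (intro allI)
      fix k l :: 'n
      obtain p q where p: "p \<in> polys {..<N}" "cg (subst u p) (mvar (a, k, l))"
        and q: "q \<in> polys {..<N}" "cg (subst u q) (mvar (b, k, l))" using eng_add by blast
      show "\<exists>p\<in>polys {..<N}. cg (subst u p) (mvar (a \<oplus> b, k, l))"
        using p q cg_trans[OF cg_add[OF p(2) q(2)] cg_sym[OF R1[OF ab]]]
        by (intro bexI[of _ "p + q"]) (auto intro!: polys_closed)
    qed
  next
    case (eng_mult a b)
    have ab: "a \<in> carrier A" "b \<in> carrier A" using eng_mult S(3) by simp_all
    show ?case
    proof (intro allI)
      fix k l :: 'n
      obtain p q where p: "\<And>k l. p k l \<in> polys {..<N}" "\<And>k l. cg (subst u (p k l)) (mvar (a, k, l))"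
        and q: "\<And>k l. q k l \<in> polys {..<N}" "\<And>k l. cg (subst u (q k l)) (mvar (b, k, l))"
        using eng_mult by metis
      have "cg (subst u (\<Sum>r\<in>UNIV. p k r * q r l)) (\<Sum>r\<in>UNIV. mvar (a, k, r) * mvar (b, r, l))"
        by (simp add: cg_sum cg_mult p q)
      then show "\<exists>p\<in>polys {..<N}. cg (subst u p) (mvar (a \<otimes> b, k, l))"
        using p q cg_trans[OF _ cg_sym[OF R2[OF ab]]]
        by (intro bexI[of _ "\<Sum>r\<in>UNIV. p k r * q r l"]) (auto intro!: polys_closed)
    qed
  qed
  then have "\<forall>a i j. \<exists>p. a \<in> carrier A \<longrightarrow> p \<in> polys {..<N} \<and> cg (subst u p) (mvar (a, i, j))" by blast
  then obtain q where q: "\<And>a i j. a \<in> carrier A \<Longrightarrow> q a i j \<in> polys {..<N}"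
    "\<And>a i j. a \<in> carrier A \<Longrightarrow> cg (subst u (q a i j)) (mvar (a, i, j))" by metis

  \<comment> \<open>The kernel of the map from the polynomials in the chart to the coordinate ring,
    so the chart is a closed embedding.\<close>
  define I where "I = {p \<in> polys {..<N}. subst u p \<in> idl.span Rel}"
  have I: "I \<subseteq> polys {..<N}" "0 \<in> I" "\<And>p q. p \<in> I \<Longrightarrow> q \<in> I \<Longrightarrow> p + q \<in> I"
    "\<And>p q. p \<in> polys {..<N} \<Longrightarrow> q \<in> I \<Longrightarrow> p * q \<in> I"
    by (auto simp: I_def idl.span_zero intro: polys_closed idl.span_add idl.span_scale)
  have I_diff: "p - q \<in> I" if "p \<in> I" "q \<in> I" for p q
    using that by (auto simp: I_def intro: polys_closed idl.span_diff)
  have I_ord: "lookup p 0 = 0" if "p \<in> I" for p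
    using that eval_Rel[of "subst u p"] by (auto simp: I_def eval_u)
  have I_iff: "p - q \<in> I \<longleftrightarrow> cg (subst u p) (subst u q)" if "p \<in> polys {..<N}" "q \<in> polys {..<N}" for p q
    using that by (auto simp: I_def cg_def intro: polys_closed)
  interpret W: Vector_Spaces.vector_space "\<lambda>c p. mconst c * p :: (nat, 'k) mpoly" by (rule vector_space_mpoly)
  note W.scale_scale [simp del]
  have "W.subspace I" unfolding W.subspace_def using I(2,3) I(4)[OF mpoly_ring_closed(1)] by blast
  then obtain pr where pr: "Vector_Spaces.linear (\<lambda>c p. mconst c * p) (\<lambda>c p. mconst c * p) pr"
    "\<And>p. p \<in> I \<Longrightarrow> pr p = 0" "\<And>p. p - pr p \<in> I" using W.projection_along by blast
  interpret pr: Vector_Spaces.linear "\<lambda>c p. mconst c * p" "\<lambda>c p. mconst c * p" pr by (rule pr(1))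
  \<comment> \<open>The projection \<open>pr\<close> is a linear normal form modulo \<open>I\<close>
    but may move 1. The added term lies in \<open>I\<close> and restores \<open>nf 1 = 1\<close>,
    which later makes scalars act by scalar matrices; it depends only on the class of
    \<open>p\<close>, since elements of \<open>I\<close> vanish at the origin.\<close>
  define nf where "nf p = pr p + mconst (lookup p 0) * (1 - pr 1)" for p
  have nf_add: "nf (p + p') = nf p + nf p'" for p p'
    by (simp add: nf_def pr.add lookup_add mconst_hom algebra_simps)
  have nf_scale: "nf (mconst c * p) = mconst c * nf p" for c p
    by (simp add: nf_def pr.scale lookup_0_mult mconst_hom distrib_left mult.assoc)
  have nf_1: "nf 1 = 1" by (simp add: nf_def mconst_hom)
  have nf_diff: "p - nf p \<in> I" for p
  proof -
    have "(p - pr p) - mconst (lookup p 0) * (1 - pr 1) \<in> I"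
      by (intro I_diff pr(3) I(4)) (rule polys_closed)
    then show ?thesis by (simp add: nf_def algebra_simps)
  qed
  have nf_cong: "nf p = nf p'" if "p - p' \<in> I" for p p'
  proof -
    have "nf (p - p') = 0" using pr(2)[OF that] I_ord[OF that] by (simp add: nf_def mconst_hom)
    then show ?thesis using nf_add[of "p - p'" p'] by simp
  qed
  have nf_polys: "nf p \<in> polys {..<N}" if "p \<in> polys {..<N}" for p
    using mpoly_ring_closed(4)[OF that, of "p - nf p"] nf_diff[of p] I(1) by auto
  define \<sigma> where "\<sigma> a = (\<chi> i j. nf (q a i j))" for a
  have \<sigma>_polys: "\<sigma> a $ i $ j \<in> polys {..<N}" if "a \<in> carrier A" for a i j
    using nf_polys q(1)[OF that] by (simp add: \<sigma>_def)
  have \<sigma>_cg: "cg (subst u (\<sigma> a $ i $ j)) (mvar (a, i, j))" if "a \<in> carrier A" for a i j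
  proof -
    have "cg (subst u (q a i j)) (subst u (\<sigma> a $ i $ j))"
      using nf_diff[of "q a i j"] I_iff[OF q(1)[OF that, of i j] nf_polys[OF q(1)[OF that, of i j]]]
      by (simp add: \<sigma>_def)
    then show ?thesis using cg_trans[OF cg_sym q(2)[OF that]] by blast
  qed
  \<comment> \<open>Any polynomial representing a coordinate may be used to compute
    \<open>\<sigma>\<close>, so the exact laws below follow from congruences.\<close>
  have \<sigma>_eq: "\<sigma> a $ i $ j = nf p" if "a \<in> carrier A" "p \<in> polys {..<N}" "cg (subst u p) (mvar (a, i, j))" for a i j p
  proof -
    have "q a i j - p \<in> I"
      using I_iff[OF q(1)[OF that(1)] that(2)] cg_trans[OF q(2)[OF that(1)] cg_sym[OF that(3)]] by simp
    then show ?thesis by (simp add: \<sigma>_def nf_cong)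
  qed
  have \<sigma>_add: "\<sigma> (a \<oplus> b) = \<sigma> a + \<sigma> b" if ab: "a \<in> carrier A" "b \<in> carrier A" for a b
  proof -
    have "\<sigma> (a \<oplus> b) $ i $ j = nf (q a i j + q b i j)" for i j
      using ab q cg_trans[OF cg_add cg_sym[OF R1]] by (intro \<sigma>_eq) (auto intro!: polys_closed)
    then show ?thesis by (simp add: vec_eq_iff nf_add) (simp add: \<sigma>_def)
  qed
  have \<sigma>_scale: "\<sigma> (\<iota> t \<otimes> b) = mat (mconst t) ** \<sigma> b" if b: "b \<in> carrier A" for t b
  proof -
    have "\<sigma> (\<iota> t \<otimes> b) $ k $ j = nf (mconst t * q b k j)" for k j
    proof (rule \<sigma>_eq)
      have h1: "cg (mvar (\<iota> t \<otimes> b, k, j)) (\<Sum>l\<in>UNIV. mvar (\<iota> t, k, l) * mvar (b, l, j))"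
        using b i by (intro R2) auto
      have h2: "cg (\<Sum>l\<in>UNIV. mvar (\<iota> t, k, l) * mvar (b, l, j))
          (\<Sum>l\<in>UNIV. (if k = l then mconst t else 0) * mvar (b, l, j))"
        by (intro cg_sum cg_mult R3 cg_refl)
      have h3: "(\<Sum>l\<in>UNIV. (if k = l then mconst t else 0) * mvar (b, l, j)) = mconst t * mvar (b, k, j)"
        by (simp add: if_distrib[of "\<lambda>x. x * _"] cong: if_cong)
      have "cg (subst u (mconst t * q b k j)) (mconst t * mvar (b, k, j))"
        using cg_mult[OF cg_refl q(2)[OF b], of "mconst t" k j] by simp
      then show "cg (subst u (mconst t * q b k j)) (mvar (\<iota> t \<otimes> b, k, j))"
        using cg_trans[OF _ cg_sym[OF cg_trans[OF h1 h2]]] unfolding h3 by blast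
    qed (use b i q in \<open>auto intro!: polys_closed\<close>)
    then show ?thesis by (simp add: vec_eq_iff nf_scale mat_mult_entry) (simp add: \<sigma>_def)
  qed
  have \<sigma>_iota: "\<sigma> (\<iota> t) = mat (mconst t)" for t
  proof -
    have "\<sigma> (\<iota> t) $ k $ j = nf (mconst (if k = j then t else 0) * 1)" for k j
      using cg_sym[OF R3[of t k j]] i by (intro \<sigma>_eq) (auto simp: mconst_hom split: if_splits intro: polys_closed)
    then show ?thesis unfolding nf_scale nf_1 by (simp add: vec_eq_iff mat_def mconst_hom)
  qed
  have \<sigma>_mult: "(\<sigma> (a \<otimes> b) - \<sigma> a ** \<sigma> b) $ k $ j \<in> I" if ab: "a \<in> carrier A" "b \<in> carrier A" for a b k j
  proof -
    have h1: "cg (subst u (\<sigma> (a \<otimes> b) $ k $ j)) (\<Sum>l\<in>UNIV. mvar (a, k, l) * mvar (b, l, j))"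
      using cg_trans[OF \<sigma>_cg R2[OF ab]] ab by simp
    have h2: "cg (\<Sum>l\<in>UNIV. mvar (a, k, l) * mvar (b, l, j)) (\<Sum>l\<in>UNIV. subst u (\<sigma> a $ k $ l) * subst u (\<sigma> b $ l $ j))"
      by (intro cg_sum cg_mult cg_sym[OF \<sigma>_cg] ab)
    have "cg (subst u (\<sigma> (a \<otimes> b) $ k $ j)) (subst u (\<Sum>l\<in>UNIV. \<sigma> a $ k $ l * \<sigma> b $ l $ j))"
      using cg_trans[OF h1 h2] by simp
    then show ?thesis
      using I_iff[of "\<sigma> (a \<otimes> b) $ k $ j" "\<Sum>l\<in>UNIV. \<sigma> a $ k $ l * \<sigma> b $ l $ j"] ab \<sigma>_polys
      by (auto simp: matrix_matrix_mult_def intro!: polys_closed)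
  qed
  have \<sigma>_0: "lookup (\<sigma> a $ k $ j) 0 = \<rho> a $ k $ j" if "a \<in> carrier A" for a k j
  proof -
    have "peval pt (subst u (\<sigma> a $ k $ j) - mvar (a, k, j)) = 0"
      using \<sigma>_cg[OF that] by (intro eval_Rel) (simp add: cg_def)
    then have "peval pt (subst u (\<sigma> a $ k $ j)) = pt (a, k, j)" by (simp only: peval_diff peval_mvar eq_iff_diff_eq_0[symmetric])
    then show ?thesis unfolding eval_u by (simp add: pt_def)
  qed
  have u_form: "\<exists>a\<in>carrier A. \<exists>k l. u j = mvar (a, k, l) - mconst (\<rho> a $ k $ l) \<and>
      \<sigma> a $ k $ l - mconst (\<rho> a $ k $ l) - mvar j \<in> I" if j: "j < N" for j
  proof -
    obtain a k l where e: "en j = (a, k, l)" by (metis prod_cases3)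
    have "en j \<in> S \<times> UNIV" using en j by (auto simp: bij_betw_def)
    then have a: "a \<in> carrier A" using e S(2) by auto
    have uj: "u j = mvar (a, k, l) - mconst (\<rho> a $ k $ l)" using j by (simp add: u_def e pt_def)
    have "cg (subst u (\<sigma> a $ k $ l)) (subst u (mvar j + mconst (\<rho> a $ k $ l)))"
      using \<sigma>_cg[OF a, of k l] by (simp add: uj)
    then have m: "\<sigma> a $ k $ l - (mvar j + mconst (\<rho> a $ k $ l)) \<in> I"
      using I_iff[OF \<sigma>_polys[OF a] polys_closed(3)[OF polys_closed(2) polys_closed(1)]] j by simp
    have eq: "\<sigma> a $ k $ l - mconst (\<rho> a $ k $ l) - mvar j =
        \<sigma> a $ k $ l - (mvar j + mconst (\<rho> a $ k $ l))" by simp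
    have "\<sigma> a $ k $ l - mconst (\<rho> a $ k $ l) - mvar j \<in> I" using m by (simp only: eq)
    then show ?thesis using a uj by blast
  qed
  show ?thesis
  proof (rule that[OF I _ \<sigma>_polys \<sigma>_add \<sigma>_scale \<sigma>_iota \<sigma>_mult \<sigma>_0 _ u_form])
    show "I \<subseteq> ordge (Suc 0)" using I_ord by (auto simp: in_ordge_1_iff)
    show "subst u p \<in> idl.span (rep_relations \<iota> A)" if "p \<in> I" for p using that by (simp add: I_def Rel_def)
    show "subst u (\<sigma> a $ k $ j) - mvar (a, k, j) \<in> idl.span (rep_relations \<iota> A)" if "a \<in> carrier A" for a k j
      using \<sigma>_cg[OF that] by (simp add: cg_def Rel_def)
  qed
qed

theorem theorem5p0p5:
  fixes A :: "'a ring"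
    and \<iota> :: "'k::alg_closed_field \<Rightarrow> 'a"
    and M :: "('a, 'm) module"
    and \<theta> :: "'k^'n \<Rightarrow> 'm"
  assumes "assoc_algebra \<iota> A"
    and "finitely_generated_algebra \<iota> A"
    and "coherent_algebra \<iota> A"
    and "left_module A M"
    and "module_frame \<iota> M \<theta>"
    and "trivial_group (Ext2 A M M)"
  shows "smooth_point (rep_scalar \<iota> A) (rep_ring \<iota> A) (point_of_rep (rep_of_module A M \<theta>))"
proof -
  note A = assms(1) and M = assms(4) and fr = assms(5)
  note i = assoc_algebraD(2)[OF A] and i_comm = assoc_algebraD(3)[OF A]
  interpret A: ring A by (rule assoc_algebraD(1)[OF A])
  define \<rho> where "\<rho> = rep_of_module A M \<theta>"
  have \<rho>: "\<rho> \<in> rep_functor \<iota> A id" unfolding \<rho>_def by (rule rep_of_module_in_rep_functor[OF A M fr])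
  define Rel where "Rel = (rep_relations \<iota> A :: ('a \<times> 'n \<times> 'n, 'k) mpoly set)"
  obtain I :: "(nat, 'k) mpoly set" and N :: nat and \<sigma> u where I: "I \<subseteq> polys {..<N}" "0 \<in> I" "\<And>p q. p \<in> I \<Longrightarrow> q \<in> I \<Longrightarrow> p + q \<in> I"
      "\<And>p q. p \<in> polys {..<N} \<Longrightarrow> q \<in> I \<Longrightarrow> p * q \<in> I" "I \<subseteq> ordge (Suc 0)"
    and \<sigma>_polys: "\<And>a i j. a \<in> carrier A \<Longrightarrow> \<sigma> a $ i $ j \<in> polys {..<N}"
    and \<sigma>_add: "\<And>a b. a \<in> carrier A \<Longrightarrow> b \<in> carrier A \<Longrightarrow> \<sigma> (a \<oplus>\<^bsub>A\<^esub> b) = \<sigma> a + \<sigma> b"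
    and \<sigma>_scale: "\<And>b t. b \<in> carrier A \<Longrightarrow> \<sigma> (\<iota> t \<otimes>\<^bsub>A\<^esub> b) = mat (mconst t) ** \<sigma> b"
    and \<sigma>_iota: "\<And>t. \<sigma> (\<iota> t) = mat (mconst t)"
    and \<sigma>_mult: "\<And>a b i j. a \<in> carrier A \<Longrightarrow> b \<in> carrier A \<Longrightarrow> (\<sigma> (a \<otimes>\<^bsub>A\<^esub> b) - \<sigma> a ** \<sigma> b) $ i $ j \<in> I"
    and \<sigma>_0: "\<And>a i j. a \<in> carrier A \<Longrightarrow> lookup (\<sigma> a $ i $ j) 0 = \<rho> a $ i $ j"
    and uI: "\<And>q. q \<in> I \<Longrightarrow> subst u q \<in> idl.span Rel"
    and u: "\<And>j. j < N \<Longrightarrow> \<exists>a\<in>carrier A. \<exists>i l. u j = mvar (a, i, l) - mconst (\<rho> a $ i $ l) \<and>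
      \<sigma> a $ i $ l - mconst (\<rho> a $ i $ l) - mvar j \<in> I"
    and us: "\<And>a i j. a \<in> carrier A \<Longrightarrow> subst u (\<sigma> a $ i $ j) - mvar (a, i, j) \<in> idl.span Rel"
  proof (rule representation_chart[OF A assms(2) \<rho>, folded Rel_def], goal_cases)
    case (1 I N \<sigma> u)
    show ?case by (rule 1(1)[OF 1(2-)])
  qed

  have lift: "\<exists>t. (\<forall>j. t j - mvar j \<in> Q) \<and> (\<forall>G\<in>I. l (subst t G) = 0)"
    if Q: "idl.subspace Q" "I \<subseteq> Q" "Q \<subseteq> ordge (Suc 0)"
      and l_add: "\<And>p q. l (p + q) = l p + l q" and l_scale: "\<And>c p. l (mconst c * p) = c * l p"
      and l_van: "\<And>u v. u \<in> ordge (Suc 0) \<Longrightarrow> v \<in> Q \<Longrightarrow> l (u * v) = 0"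
      and F: "F \<in> I" "l F = 1"
    for Q F and l :: "(nat, 'k) mpoly \<Rightarrow> 'k"
  proof -
    have l_0: "l 0 = 0" using l_scale[of 0 0] by simp
    have l_diff: "l (p - q) = l p - l q" for p q using l_add[of "p - q" q] by simp
    have l_sum: "l (sum h S) = (\<Sum>x\<in>S. l (h x))" for h :: "'n \<Rightarrow> _" and S
      by (induction S rule: infinite_finite_induct) (simp_all add: l_0 l_add)
    \<comment> \<open>On \<open>Q\<close> the functional kills products with polynomials vanishing
      at the origin, so the ring acts through evaluation there.\<close>
    have l_mult: "l (p * v) = lookup p 0 * l v" if v: "v \<in> Q" for p v
    proof -
      have "p - mconst (lookup p 0) \<in> ordge (Suc 0)"
        by (simp add: in_ordge_1_iff lookup_minus)
      from l_van[OF this v] show ?thesis by (simp add: left_diff_distrib l_diff l_scale)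
    qed
    \<comment> \<open>The failure of the generic matrices to be multiplicative has entries in
      \<open>I\<close>, hence in \<open>Q\<close>; its image under \<open>l\<close> is the
      obstruction cocycle \<open>c\<close>.\<close>
    define D where "D a b = \<sigma> (a \<otimes>\<^bsub>A\<^esub> b) - \<sigma> a ** \<sigma> b" for a b
    have DQ: "D a b $ i $ j \<in> Q" if "a \<in> carrier A" "b \<in> carrier A" for a b i j
      using \<sigma>_mult[OF that] Q(2) by (auto simp: D_def)
    define c where "c a b = (\<chi> i j. l (D a b $ i $ j))" for a b
    have D_add1: "D (a \<oplus>\<^bsub>A\<^esub> a') b = D a b + D a' b"
      if "a \<in> carrier A" "a' \<in> carrier A" "b \<in> carrier A" for a a' b
      using that by (simp add: D_def A.l_distr \<sigma>_add matrix_add_distrib)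
    have D_add2: "D a (b \<oplus>\<^bsub>A\<^esub> b') = D a b + D a b'"
      if "a \<in> carrier A" "b \<in> carrier A" "b' \<in> carrier A" for a b b'
      using that by (simp add: D_def A.r_distr \<sigma>_add matrix_add_distrib)
    have mat_comm: "P ** mat x = mat x ** P" for P :: "((nat, 'k) mpoly)^'n^'n" and x
      by (simp add: vec_eq_iff mat_mult_entry)
        (simp add: matrix_matrix_mult_def mat_def if_distrib[of "\<lambda>x. _ * x"] mult.commute cong: if_cong)
    have D_scale: "D a (\<iota> t \<otimes>\<^bsub>A\<^esub> b) = mat (mconst t) ** D a b"
      if a: "a \<in> carrier A" and b: "b \<in> carrier A" for a b t
    proof -
      have "a \<otimes>\<^bsub>A\<^esub> (\<iota> t \<otimes>\<^bsub>A\<^esub> b) = \<iota> t \<otimes>\<^bsub>A\<^esub> (a \<otimes>\<^bsub>A\<^esub> b)"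
        using a b i[of t] i_comm[OF a, of t] by (metis A.m_assoc)
      moreover have "\<sigma> a ** (mat (mconst t) ** \<sigma> b) = mat (mconst t) ** (\<sigma> a ** \<sigma> b)"
        by (simp only: matrix_mul_assoc mat_comm)
      ultimately show ?thesis using a b by (simp add: D_def \<sigma>_scale matrix_diff_ldistrib)
    qed
    have D_unit: "D (\<iota> t) b = 0" "D b (\<iota> t) = 0" if b: "b \<in> carrier A" for t b
    proof -
      show "D (\<iota> t) b = 0" using b by (simp add: D_def \<sigma>_scale \<sigma>_iota)
      have "b \<otimes>\<^bsub>A\<^esub> \<iota> t = \<iota> t \<otimes>\<^bsub>A\<^esub> b" using i_comm[OF b] by simp
      then show "D b (\<iota> t) = 0" using b by (simp add: D_def \<sigma>_scale \<sigma>_iota mat_comm)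
    qed
    \<comment> \<open>Both sides equal
      \<open>\<sigma> (a b d) - \<sigma> a ** \<sigma> b ** \<sigma> d\<close>. The identity is
      exact over the polynomials, and \<open>l\<close> turns the outer factors
      \<open>\<sigma>\<close> into \<open>\<rho>\<close>.\<close>
    have D_cocycle: "\<sigma> a ** D b d + D a (b \<otimes>\<^bsub>A\<^esub> d) = D (a \<otimes>\<^bsub>A\<^esub> b) d + D a b ** \<sigma> d"
      if "a \<in> carrier A" "b \<in> carrier A" "d \<in> carrier A" for a b d
      using that by (simp add: D_def matrix_diff_ldistrib matrix_diff_rdistrib A.m_assoc matrix_mul_assoc)
    obtain e where e_add: "\<And>a b. a \<in> carrier A \<Longrightarrow> b \<in> carrier A \<Longrightarrow> e (a \<oplus>\<^bsub>A\<^esub> b) = e a + e b"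
      and e_iota: "\<And>t. e (\<iota> t) = 0"
      and e_mult: "\<And>a b. a \<in> carrier A \<Longrightarrow> b \<in> carrier A \<Longrightarrow> e (a \<otimes>\<^bsub>A\<^esub> b) = \<rho> a ** e b + e a ** \<rho> b + c a b"
    proof (rule cocycle_is_coboundary[OF A M fr assms(6), of c, folded \<rho>_def])
      show "c (a \<oplus>\<^bsub>A\<^esub> a') b = c a b + c a' b" if "a \<in> carrier A" "a' \<in> carrier A" "b \<in> carrier A" for a a' b
        using that by (simp add: c_def D_add1 l_add vec_eq_iff)
      show "c a (b \<oplus>\<^bsub>A\<^esub> b') = c a b + c a b'" if "a \<in> carrier A" "b \<in> carrier A" "b' \<in> carrier A" for a b b'
        using that by (simp add: c_def D_add2 l_add vec_eq_iff)
      show "c a (\<iota> t \<otimes>\<^bsub>A\<^esub> b) $ i $ j = t * c a b $ i $ j" if "a \<in> carrier A" "b \<in> carrier A" for a b t i j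
        using that by (simp add: c_def D_scale mat_mult_entry l_scale)
      show "c (\<iota> t) b = 0" "c b (\<iota> t) = 0" if "b \<in> carrier A" for t b
        using that by (simp_all add: c_def D_unit l_0 vec_eq_iff)
      show "\<rho> a ** c b d + c a (b \<otimes>\<^bsub>A\<^esub> d) = c (a \<otimes>\<^bsub>A\<^esub> b) d + c a b ** \<rho> d"
        if abd: "a \<in> carrier A" "b \<in> carrier A" "d \<in> carrier A" for a b d
      proof -
        have 1: "(\<rho> a ** c b d) $ i $ j = l ((\<sigma> a ** D b d) $ i $ j)" for i j
          using abd by (simp add: matrix_matrix_mult_def c_def l_sum l_mult DQ \<sigma>_0)
        have 2: "(c a b ** \<rho> d) $ i $ j = l ((D a b ** \<sigma> d) $ i $ j)" for i j
          using abd by (simp add: matrix_matrix_mult_def c_def l_sum mult.commute[of "D a b $ _ $ _"] l_mult DQ \<sigma>_0)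
            (simp add: mult.commute)
        have "(\<rho> a ** c b d + c a (b \<otimes>\<^bsub>A\<^esub> d)) $ i $ j = l ((\<sigma> a ** D b d + D a (b \<otimes>\<^bsub>A\<^esub> d)) $ i $ j)" for i j
          by (simp add: 1 l_add) (simp add: c_def)
        moreover have "(c (a \<otimes>\<^bsub>A\<^esub> b) d + c a b ** \<rho> d) $ i $ j = l ((D (a \<otimes>\<^bsub>A\<^esub> b) d + D a b ** \<sigma> d) $ i $ j)" for i j
          by (simp add: 2 l_add) (simp add: c_def)
        ultimately show ?thesis by (simp add: vec_eq_iff D_cocycle[OF abd])
      qed
    qed blast
    \<comment> \<open>Since \<open>l F = 1\<close>, a multiple of \<open>F\<close> by a constant
      matrix changes the defect by exactly that matrix after applying \<open>l\<close>, up to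
      products that \<open>l\<close> evaluates at the origin.\<close>
    define \<sigma>' where "\<sigma>' a = (\<chi> i j. \<sigma> a $ i $ j - mconst (e a $ i $ j) * F)" for a
    define Q' where "Q' = {v \<in> Q. l v = 0}"
    have Q': "idl.subspace Q'"
      using Q(1) by (auto simp: Q'_def idl.subspace_def l_0 l_add l_mult)
    have FQ: "F \<in> Q" using F Q by blast
    have F0: "lookup F 0 = 0" using FQ Q(3) by (auto simp: in_ordge_1_iff)
    have \<sigma>'_Rel: "subst (\<lambda>(a, i, j). \<sigma>' a $ i $ j) r \<in> Q'" if "r \<in> Rel" for r
    proof (rule subst_rep_relations[OF Q' _ _ _ that[unfolded Rel_def]])
      fix a b i j assume ab: "a \<in> carrier A" "b \<in> carrier A"
      have "(\<sigma>' (a \<oplus>\<^bsub>A\<^esub> b) - \<sigma>' a - \<sigma>' b) $ i $ j = 0"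
        using ab by (simp add: \<sigma>'_def \<sigma>_add e_add mconst_hom algebra_simps)
      then show "(\<sigma>' (a \<oplus>\<^bsub>A\<^esub> b) - \<sigma>' a - \<sigma>' b) $ i $ j \<in> Q'"
        using idl.subspace_0[OF Q'] by simp
      \<comment> \<open>All terms of the new defect that involve \<open>F\<close>, with one factor
        \<open>F\<close> taken out. Its value at the origin is the negative of the cocycle, by the
        coboundary equation; the quadratic term drops out because \<open>F\<close> vanishes
        there.\<close>
      define w where "w = (\<Sum>k\<in>UNIV. \<sigma> a $ i $ k * mconst (e b $ k $ j) + mconst (e a $ i $ k) * \<sigma> b $ k $ j -
          mconst (e a $ i $ k) * mconst (e b $ k $ j) * F) - mconst (e (a \<otimes>\<^bsub>A\<^esub> b) $ i $ j)"
      have "(\<sigma>' a ** \<sigma>' b) $ i $ j = (\<Sum>k\<in>UNIV. \<sigma> a $ i $ k * \<sigma> b $ k $ j -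
          (\<sigma> a $ i $ k * mconst (e b $ k $ j) + mconst (e a $ i $ k) * \<sigma> b $ k $ j -
          mconst (e a $ i $ k) * mconst (e b $ k $ j) * F) * F)"
        by (simp add: matrix_matrix_mult_def \<sigma>'_def algebra_simps)
      then have *: "(\<sigma>' (a \<otimes>\<^bsub>A\<^esub> b) - \<sigma>' a ** \<sigma>' b) $ i $ j = D a b $ i $ j + w * F"
        by (simp add: D_def \<sigma>'_def w_def sum_subtractf sum_distrib_right left_diff_distrib matrix_matrix_mult_def)
      have "lookup w 0 = (\<rho> a ** e b + e a ** \<rho> b) $ i $ j - e (a \<otimes>\<^bsub>A\<^esub> b) $ i $ j"
        using ab by (simp add: w_def lookup_minus lookup_add lookup_sum lookup_0_mult \<sigma>_0 F0
            matrix_matrix_mult_def sum.distrib)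
      also have "\<dots> = - c a b $ i $ j" using ab by (simp add: e_mult)
      finally have "l (D a b $ i $ j + w * F) = 0" by (simp add: l_add l_mult[OF FQ] F c_def)
      moreover have "D a b $ i $ j + w * F \<in> Q"
        using Q(1) DQ[OF ab] FQ by (intro idl.subspace_add idl.subspace_scale)
      ultimately show "(\<sigma>' (a \<otimes>\<^bsub>A\<^esub> b) - \<sigma>' a ** \<sigma>' b) $ i $ j \<in> Q'" unfolding * by (simp add: Q'_def)
    next
      fix t i j
      have "(\<sigma>' (\<iota> t) - mat (mconst t)) $ i $ j = 0"
        by (simp add: \<sigma>'_def \<sigma>_iota e_iota mconst_hom)
      then show "(\<sigma>' (\<iota> t) - mat (mconst t)) $ i $ j \<in> Q'" using idl.subspace_0[OF Q'] by simp
    qed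
    \<comment> \<open>The chart coordinates of the corrected representation. Variables beyond
      \<open>N\<close> stay fixed, so the congruence with \<open>mvar j\<close> modulo
      \<open>Q\<close> holds for every \<open>j\<close>.\<close>
    define t where "t j = (if j < N then subst (\<lambda>(a, i, j). \<sigma>' a $ i $ j) (u j) else mvar j)" for j
    have "t j - mvar j \<in> Q" for j
    proof (cases "j < N")
      case True
      obtain a k m where a: "a \<in> carrier A" "u j = mvar (a, k, m) - mconst (\<rho> a $ k $ m)"
        "\<sigma> a $ k $ m - mconst (\<rho> a $ k $ m) - mvar j \<in> I" using u[OF True] by blast
      have "(\<sigma> a $ k $ m - mconst (\<rho> a $ k $ m) - mvar j) - mconst (e a $ k $ m) * F \<in> Q"
        by (rule idl.subspace_diff[OF Q(1) subsetD[OF Q(2) a(3)] idl.subspace_scale[OF Q(1) FQ]])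
      moreover have "t j - mvar j = (\<sigma> a $ k $ m - mconst (\<rho> a $ k $ m) - mvar j) - mconst (e a $ k $ m) * F"
        using True a(2) by (simp add: t_def \<sigma>'_def)
      ultimately show ?thesis by (simp only:)
    qed (use Q in \<open>simp add: t_def idl.subspace_0\<close>)
    moreover have "l (subst t G) = 0" if G: "G \<in> I" for G
    proof -
      \<comment> \<open>Through \<open>u\<close>, the element \<open>G\<close> of \<open>I\<close>
        becomes a combination of the defining relations, and the corrected matrices send these into
        the kernel of \<open>l\<close> on \<open>Q\<close>.\<close>
      have "subst t G = subst (\<lambda>(a, i, j). \<sigma>' a $ i $ j) (subst u G)"
        unfolding subst_subst using G I(1) by (intro subst_cong[of G "{..<N}"]) (auto simp: t_def)
      also have "\<dots> \<in> idl.span (subst (\<lambda>(a, i, j). \<sigma>' a $ i $ j) ` Rel)"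
        by (rule subst_idl_span[OF uI[OF G]])
      also have "\<dots> \<subseteq> Q'" using \<sigma>'_Rel by (intro idl.span_minimal[OF _ Q']) auto
      finally show ?thesis by (simp add: Q'_def)
    qed
    ultimately show ?thesis by blast
  qed

  obtain c f g where f: "\<And>i. i < c \<Longrightarrow> f i \<in> I"
    "\<And>w. (\<forall>j<N. (\<Sum>i<c. w i * lookup (f i) (single j 1)) = 0) \<Longrightarrow> (\<forall>i<c. w i = 0)"
    and g: "g \<in> polys {..<N}" "lookup g 0 = 1" "\<And>F. F \<in> I \<Longrightarrow> g * F \<in> idl.span (f ` {..<c::nat})"
  proof (rule smooth_equations[of I N], goal_cases)
    case (7 c f g)
    show ?case by (rule 7(1)[OF 7(2-)])
  qed (rule I lift; assumption)+
  let ?V = "carrier A \<times> (UNIV :: ('n \<times> 'n) set)"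
  let ?s = "\<lambda>(a, i, j). \<sigma> a $ i $ j"
  have "smooth_point (\<lambda>a. genideal (mpoly_ring ?V) Rel +>\<^bsub>mpoly_ring ?V\<^esub> mconst a)
    (mpoly_ring ?V Quot genideal (mpoly_ring ?V) Rel)
    (\<lambda>C. the_elem (mpoly_eval id (\<lambda>(a, i, j). \<rho> a $ i $ j) ` C))"
  proof (rule smooth_point_of_equations[OF _ I(1,5), where s = ?s and u = u and c = c and f = f and g = g])
    show "Rel \<subseteq> polys ?V"
      using rep_relations_in_carrier[OF A] by (simp add: Rel_def rep_poly_ring_def)
    show "?s v \<in> polys {..<N}" if "v \<in> ?V" for v using that \<sigma>_polys by auto
    show "u j \<in> polys ?V" if "j < N" for j using u[OF that] by (auto intro!: polys_closed)
    show "subst ?s r \<in> idl.span I" if "r \<in> Rel" for r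
    proof (rule subst_rep_relations[OF idl.subspace_span _ _ _ that[unfolded Rel_def]])
      fix a b i j assume ab: "a \<in> carrier A" "b \<in> carrier A"
      show "(\<sigma> (a \<oplus>\<^bsub>A\<^esub> b) - \<sigma> a - \<sigma> b) $ i $ j \<in> idl.span I"
        using ab by (simp add: \<sigma>_add idl.span_zero)
      show "(\<sigma> (a \<otimes>\<^bsub>A\<^esub> b) - \<sigma> a ** \<sigma> b) $ i $ j \<in> idl.span I"
        using \<sigma>_mult[OF ab] by (rule idl.span_base)
    qed (simp add: \<sigma>_iota idl.span_zero)
    show "subst u q \<in> idl.span Rel" if "q \<in> I" for q by (rule uI[OF that])
    show "subst ?s (u j) - mvar j \<in> idl.span I" if j: "j < N" for j
      using u[OF j] by (auto intro: idl.span_base)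
    show "subst u (?s v) - mvar v \<in> idl.span Rel" if "v \<in> ?V" for v
      using that us by auto
    show "lookup (?s v) 0 = (case v of (a, i, j) \<Rightarrow> \<rho> a $ i $ j)" if "v \<in> ?V" for v
      using that \<sigma>_0 by auto
  qed (use f g in blast)+
  then show ?thesis
    unfolding rep_scalar_def[abs_def] rep_ring_def rep_ideal_def rep_poly_ring_def point_of_rep_def[abs_def]
      Rel_def \<rho>_def .
qed

end
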